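(* Let $n\ge1$. The cubical Dupont homotopy $\mathbf s$ is a special deformation retraction of the differential forms $\Omega^\bullet(|\square^n|)$ on the $n$-cube onto the cubical cochains $C^\bullet(\square^n)$, with inclusion the cubical Whitney map $\mathbf W:C^\bullet(\square^n)\to\Omega^\bullet(|\square^n|)$ and projection the integration map $\mathbf R:\Omega^\bullet(|\square^n|)\to C^\bullet(\square^n)$; that is, $\mathbf W,\mathbf R$ are cochain maps with $$\mathbf R\mathbf W=1,\qquad d\mathbf s+\mathbf sd=1-\mathbf W\mathbf R,\qquad \mathbf s^2=0,\qquad \mathbf s\mathbf W=0,\qquad \mathbf R\mathbf s=0.$$
   Context: One-dimensional data. $\Delta^1$ has vertices $e_0,e_1$ and edge $[e_0,e_1]$; $|\Delta^1|=[0,1]$ with coordinate $t$ ($e_0$ at $0$, $e_1$ at $1$). $C^\bullet(\Delta^1)$ is the complex of real simplicial cochains with dual basis $\widehat e_0,\widehat e_1,\widehat{[e_0,e_1]}$, and $\Omega^\bullet(|\Delta^1|)$ the smooth forms on $[0,1]$. $R:\Omega^\bullet(|\Delta^1|)\to C^\bullet(\Delta^1)$ is integration, $R(f)=f(0)\widehat e_0+f(1)\widehat e_1$, $R(g\,dt)=(\int_0^1g\,dt)\widehat{[e_0,e_1]}$. $W:C^\bullet(\Delta^1)\to\Omega^\bullet(|\Delta^1|)$ is $W(\widehat e_0)=1-t$, $W(\widehat e_1)=t$, $W(\widehat{[e_0,e_1]})=dt$. $s:\Omega^\bullet(|\Delta^1|)\to\Omega^{\bullet-1}(|\Delta^1|)$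 is $s(f)=0$ on functions and $s(g\,dt)=\int_0^tg(u)\,du-t\int_0^1g(u)\,du$. Cubes. $\square^n=(\Delta^1)^{\times n}$, $C^\bullet(\square^n)=C^\bullet(\Delta^1)^{\otimes n}$, and $\Omega^\bullet(|\square^n|)=\Omega^\bullet(|\Delta^1|)^{\widehat\otimes n}$ is the complex of smooth forms on $[0,1]^n$, where $\widehat\otimes$ is the completed projective tensor product; tensor products of continuous maps extend to it, and tensor products of graded maps use the Koszul sign rule. Cubical maps. $\mathbf R=R\otimes\dots\otimes R$, $\mathbf W=W\otimes\dots\otimes W$ ($n$ factors), $$\mathbf s_0=\sum_{j=1}^n1^{\otimes(j-1)}\otimes s\otimes(WR)^{\otimes(n-j)},\qquad \mathbf s=\frac1{n!}\sum_{\sigma\in S_n}\tau_\sigma\circ\mathbf s_0\circ\tau_\sigma^{-1},$$ where $\tau_\sigma:\Omega^\bullet(|\square^n|)\to\Omega^\bullet(|\square^n|)$ is the linear map induced by the permutation $\sigma$ of the coordinates of the cube. *)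

theory Defs
  imports "HOL-Analysis.Analysis" "HOL-Combinatorics.Permutations"
begin

section \<open>Tensor products of graded maps between function spaces\<close>

text \<open>
  A graded vector space is presented by functions \<open>F :: 'x \<Rightarrow> real\<close> on a set of labels,
  each label carrying a degree. An element of the \<open>n\<close>-fold (completed) tensor product is a
  function on lists of \<open>n\<close> labels, the elementary tensor
  \<open>a\<^sub>1 \<otimes> \<dots> \<otimes> a\<^sub>n\<close> being the function that sends \<open>[x\<^sub>1, \<dots>, x\<^sub>n]\<close> to
  \<open>a\<^sub>1 x\<^sub>1 * \<dots> * a\<^sub>n x\<^sub>n\<close>.
\<close>

definition koszul :: "int \<Rightarrow> int \<Rightarrow> real" where
  "koszul p q = (if odd p \<and> odd q then -1 else 1)"

text \<open>
  A list of pairs (degree, map) is tensored from left to right by the Koszul rule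
  \<open>(T \<otimes> T') (a \<otimes> b) = (-1)^(|T'| * |a|) T a \<otimes> T' b\<close>. The factor \<open>T'\<close> acts on the remaining
  labels while the first one is held fixed, then \<open>T\<close> acts on the first label; this slicewise
  action is the continuous extension from elementary tensors to the completed tensor product.
\<close>

fun tensor :: "('x \<Rightarrow> int) \<Rightarrow> (int \<times> (('x \<Rightarrow> real) \<Rightarrow> 'y \<Rightarrow> real)) list
    \<Rightarrow> ('x list \<Rightarrow> real) \<Rightarrow> 'y list \<Rightarrow> real" where
  "tensor dg [] F [] = F []"
| "tensor dg [] F (y # ys) = 0"
| "tensor dg (T # Ts) F [] = 0"
| "tensor dg ((p, T) # Ts) F (y # ys) =
     T (\<lambda>x. koszul (sum_list (map fst Ts)) (dg x) * tensor dg Ts (\<lambda>xs. F (x # xs)) ys) y"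

definition homogeneous :: "('p \<Rightarrow> int) \<Rightarrow> ('p \<Rightarrow> real) set \<Rightarrow> int \<Rightarrow> ('p \<Rightarrow> real) set" where
  "homogeneous dg V k = {F \<in> V. \<forall>p. F p \<noteq> 0 \<longrightarrow> dg p = k}"

definition graded_linear_map :: "('p \<Rightarrow> int) \<Rightarrow> ('p \<Rightarrow> real) set \<Rightarrow> ('q \<Rightarrow> int) \<Rightarrow> ('q \<Rightarrow> real) set
    \<Rightarrow> int \<Rightarrow> (('p \<Rightarrow> real) \<Rightarrow> 'q \<Rightarrow> real) \<Rightarrow> bool" where
  "graded_linear_map dg V dg' V' k T \<longleftrightarrow>
     (\<forall>F\<in>V. T F \<in> V') \<and>
     (\<forall>F\<in>V. \<forall>G\<in>V. \<forall>a b. T (\<lambda>p. a * F p + b * G p) = (\<lambda>q. a * T F q + b * T G q)) \<and>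
     (\<forall>m. \<forall>F\<in>homogeneous dg V m. T F \<in> homogeneous dg' V' (m + k))"

text \<open>
  \<open>h\<close> is a special deformation retraction of the complex \<open>(A, dA)\<close> onto the complex \<open>(B, dB)\<close>
  with inclusion \<open>i\<close> and projection \<open>p\<close>.
\<close>

definition special_deformation_retraction ::
  "('x \<Rightarrow> int) \<Rightarrow> ('x \<Rightarrow> real) set \<Rightarrow> (('x \<Rightarrow> real) \<Rightarrow> 'x \<Rightarrow> real)
    \<Rightarrow> ('y \<Rightarrow> int) \<Rightarrow> ('y \<Rightarrow> real) set \<Rightarrow> (('y \<Rightarrow> real) \<Rightarrow> 'y \<Rightarrow> real)
    \<Rightarrow> (('y \<Rightarrow> real) \<Rightarrow> 'x \<Rightarrow> real) \<Rightarrow> (('x \<Rightarrow> real) \<Rightarrow> 'y \<Rightarrow> real)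
    \<Rightarrow> (('x \<Rightarrow> real) \<Rightarrow> 'x \<Rightarrow> real) \<Rightarrow> bool" where
  "special_deformation_retraction dgA A dA dgB B dB i p h \<longleftrightarrow>
     graded_linear_map dgB B dgA A 0 i \<and>
     graded_linear_map dgA A dgB B 0 p \<and>
     graded_linear_map dgA A dgA A (-1) h \<and>
     (\<forall>c\<in>B. dA (i c) = i (dB c)) \<and>
     (\<forall>F\<in>A. dB (p F) = p (dA F)) \<and>
     (\<forall>c\<in>B. p (i c) = c) \<and>
     (\<forall>F\<in>A. (\<lambda>x. dA (h F) x + h (dA F) x) = (\<lambda>x. F x - i (p F) x)) \<and>
     (\<forall>F\<in>A. h (h F) = (\<lambda>x. 0)) \<and>
     (\<forall>c\<in>B. h (i c) = (\<lambda>x. 0)) \<and>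
     (\<forall>F\<in>A. p (h F) = (\<lambda>y. 0))"

section \<open>The interval\<close>

datatype cell = V0 | V1 | E01

fun cell_deg :: "cell \<Rightarrow> int" where
  "cell_deg V0 = 0"
| "cell_deg V1 = 0"
| "cell_deg E01 = 1"

text \<open>
  A form \<open>f + g dt\<close> on \<open>[0,1]\<close> is the function with \<open>(False, t) \<mapsto> f t\<close> and
  \<open>(True, t) \<mapsto> g t\<close> for \<open>t \<in> {0..1}\<close>. Forms vanish at labels outside the interval (and, below,
  outside the cube), so that equality of forms is equality of functions.
\<close>

type_synonym form_label = "bool \<times> real"

definition form_deg :: "form_label \<Rightarrow> int" where
  "form_deg x = (if fst x then 1 else 0)"

definition d1 :: "(form_label \<Rightarrow> real) \<Rightarrow> form_label \<Rightarrow> real" where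
  "d1 F = (\<lambda>(b, t). if b \<and> t \<in> {0..1}
     then vector_derivative (\<lambda>u. F (False, u)) (at t within {0..1}) else 0)"

fun delta1 :: "(cell \<Rightarrow> real) \<Rightarrow> cell \<Rightarrow> real" where
  "delta1 c V0 = 0"
| "delta1 c V1 = 0"
| "delta1 c E01 = c V1 - c V0"

fun R1 :: "(form_label \<Rightarrow> real) \<Rightarrow> cell \<Rightarrow> real" where
  "R1 F V0 = F (False, 0)"
| "R1 F V1 = F (False, 1)"
| "R1 F E01 = integral {0..1} (\<lambda>t. F (True, t))"

definition W1 :: "(cell \<Rightarrow> real) \<Rightarrow> form_label \<Rightarrow> real" where
  "W1 c = (\<lambda>(b, t). if t \<in> {0..1}
     then (if b then c E01 else c V0 * (1 - t) + c V1 * t) else 0)"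

definition s1 :: "(form_label \<Rightarrow> real) \<Rightarrow> form_label \<Rightarrow> real" where
  "s1 F = (\<lambda>(b, t). if \<not> b \<and> t \<in> {0..1}
     then integral {0..t} (\<lambda>u. F (True, u)) - t * integral {0..1} (\<lambda>u. F (True, u)) else 0)"

section \<open>Smooth forms and cochains on the cube\<close>

definition cube :: "nat \<Rightarrow> real list set" where
  "cube n = {x. length x = n \<and> set x \<subseteq> {0..1}}"

text \<open>
  Continuity on \<open>[0,1]^n\<close>, with lists replaced by sequences carrying the product topology, of
  which only the first \<open>n\<close> entries are used.
\<close>

definition cube_continuous :: "nat \<Rightarrow> (real list \<Rightarrow> real) \<Rightarrow> bool" where
  "cube_continuous n f \<longleftrightarrow>
     continuous_on {x :: nat \<Rightarrow> real. \<forall>i. x i \<in> {0..1}} (\<lambda>x. f (map x [0..<n]))"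

text \<open>
  Smoothness up to the boundary: all iterated partial derivatives (one-sided at the faces) exist
  and are continuous on the closed cube. \<open>D \<alpha>\<close> is the iterated partial derivative of \<open>f\<close>
  along the list of directions \<open>\<alpha>\<close>.
\<close>

definition cube_smooth :: "nat \<Rightarrow> (real list \<Rightarrow> real) \<Rightarrow> bool" where
  "cube_smooth n f \<longleftrightarrow> (\<exists>D :: nat list \<Rightarrow> real list \<Rightarrow> real.
     (\<forall>x\<in>cube n. D [] x = f x) \<and>
     (\<forall>\<alpha>\<in>lists {..<n}. cube_continuous n (D \<alpha>) \<and>
       (\<forall>i<n. \<forall>x\<in>cube n.
         ((\<lambda>u. D \<alpha> (x[i := u])) has_real_derivative D (i # \<alpha>) x) (at (x ! i) within {0..1}))))"

text \<open>
  The value of a form at \<open>[(b\<^sub>1, t\<^sub>1), \<dots>, (b\<^sub>n, t\<^sub>n)]\<close> is the coefficient, at the point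
  \<open>(t\<^sub>1, \<dots>, t\<^sub>n)\<close>, of the wedge product in increasing order of the \<open>dt\<^sub>i\<close> with \<open>b\<^sub>i\<close> true.
\<close>

definition cube_forms :: "nat \<Rightarrow> (form_label list \<Rightarrow> real) set" where
  "cube_forms n = {F.
     (\<forall>p. map snd p \<notin> cube n \<longrightarrow> F p = 0) \<and>
     (\<forall>bs. length bs = n \<longrightarrow> cube_smooth n (\<lambda>t. F (zip bs t)))}"

definition cube_cochains :: "nat \<Rightarrow> (cell list \<Rightarrow> real) set" where
  "cube_cochains n = {c. \<forall>p. length p \<noteq> n \<longrightarrow> c p = 0}"

definition form_degs :: "form_label list \<Rightarrow> int" where
  "form_degs p = sum_list (map form_deg p)"

definition cell_degs :: "cell list \<Rightarrow> int" where
  "cell_degs p = sum_list (map cell_deg p)"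

text \<open>Differentials of the tensor powers; the first one is the exterior derivative.\<close>

definition d_form :: "nat \<Rightarrow> (form_label list \<Rightarrow> real) \<Rightarrow> form_label list \<Rightarrow> real" where
  "d_form n F = (\<lambda>p. \<Sum>j<n. tensor form_deg
     (replicate j (0, \<lambda>G. G) @ [(1, d1)] @ replicate (n - 1 - j) (0, \<lambda>G. G)) F p)"

definition d_cochain :: "nat \<Rightarrow> (cell list \<Rightarrow> real) \<Rightarrow> cell list \<Rightarrow> real" where
  "d_cochain n c = (\<lambda>p. \<Sum>j<n. tensor cell_deg
     (replicate j (0, \<lambda>G. G) @ [(1, delta1)] @ replicate (n - 1 - j) (0, \<lambda>G. G)) c p)"

section \<open>The cubical maps\<close>

definition cubical_R :: "nat \<Rightarrow> (form_label list \<Rightarrow> real) \<Rightarrow> cell list \<Rightarrow> real" where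
  "cubical_R n = tensor form_deg (replicate n (0, R1))"

definition cubical_W :: "nat \<Rightarrow> (cell list \<Rightarrow> real) \<Rightarrow> form_label list \<Rightarrow> real" where
  "cubical_W n = tensor cell_deg (replicate n (0, W1))"

definition cubical_s0 :: "nat \<Rightarrow> (form_label list \<Rightarrow> real) \<Rightarrow> form_label list \<Rightarrow> real" where
  "cubical_s0 n F = (\<lambda>p. \<Sum>j<n. tensor form_deg
     (replicate j (0, \<lambda>G. G) @ [(-1, s1)] @ replicate (n - 1 - j) (0, W1 \<circ> R1)) F p)"

text \<open>
  Pullback of forms along \<open>(t\<^sub>i)\<^sub>i \<mapsto> (t\<^bsub>\<sigma> i\<^esub>)\<^sub>i\<close>. The sign reorders the wedge product of the
  \<open>dt\<^bsub>\<sigma> i\<^esub>\<close>: one factor \<open>-1\<close> for each inversion of \<open>\<sigma>\<close> between two factors of degree one.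
\<close>

definition form_perm :: "(nat \<Rightarrow> nat) \<Rightarrow> (form_label list \<Rightarrow> real) \<Rightarrow> form_label list \<Rightarrow> real" where
  "form_perm \<sigma> F = (\<lambda>p.
     (\<Prod>(i, j)\<in>{(i, j). i < j \<and> j < length p \<and> \<sigma> j < \<sigma> i}.
        koszul (form_deg (p ! \<sigma> i)) (form_deg (p ! \<sigma> j))) *
     F (map (\<lambda>i. p ! \<sigma> i) [0..<length p]))"

definition cubical_s :: "nat \<Rightarrow> (form_label list \<Rightarrow> real) \<Rightarrow> form_label list \<Rightarrow> real" where
  "cubical_s n F = (\<lambda>p. 1 / fact n *
     (\<Sum>\<sigma> | \<sigma> permutes {..<n}. (form_perm \<sigma> \<circ> cubical_s0 n \<circ> form_perm (inv \<sigma>)) F p))"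

end

(*
  Each of the maps d, s and WR of the interval acts on one coordinate of a form on the cube. Smooth
  forms on the cube are preserved, and operators acting on different coordinates commute up to the
  Koszul sign: Fubini's theorem for two integrals, differentiation under the integral sign for an
  integral and a derivative. What remains is algebra. Write s_i, p_i for s, WR in coordinate i.
  Conjugation by a permutation sigma only relabels the coordinates, so the cubical homotopy is the
  average over sigma of the sums of s_(sigma j) p_(sigma (j+1)) ... p_(sigma (n-1)). For each sigma the
  homotopy formula telescopes. Any two operators s_i p_B and s_k p_C with i not in B and k not in C
  anticommute, even if they come from different permutations, so every sum of such operators
  squares to zero.
*)
theory Submission
  imports Defs
begin

section \<open>Smooth functions on the cube\<close>

text \<open>With the labels of the other slots frozen, an operator in slot i sees only the slice
  \<open>\<lambda>x. F (p[i := x])\<close>, so identities on the interval carry over slot by slot.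
  What has to be earned is that these slices are regular enough for derivatives and integrals to be
  linear and to be interchanged. The Koszul rule is concentrated in a prefix sign carried by the odd
  operators d_i and s_i; p_i is even and carries none. Claims about cochains are reduced to claims
  about forms: W is injective, its image consists of the forms fixed by every p_i, and R is the
  product of all p_i read off at one chosen label per cell. Two contractions that share a coordinate
  are handled by the side conditions on the interval. If k lies in B, then p_k s_k = 0 kills s_i p_B
  s_k p_C; in the reverse product s_k is moved next to p_B, where s_k p_k = 0 kills it. That
  conjugation merely relabels is a statement about signs: inversions involving the contracted
  coordinate account exactly for the difference of the two prefix signs.\<close>

lemma cube_nth: "x \<in> cube n \<Longrightarrow> i < n \<Longrightarrow> x ! i \<in> {0..1}"
  unfolding cube_def by (metis (mono_tags, lifting) mem_Collect_eq nth_mem subsetD)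

lemma cubeI: "length x = n \<Longrightarrow> (\<And>i. i < n \<Longrightarrow> x ! i \<in> {0..1}) \<Longrightarrow> x \<in> cube n"
  unfolding cube_def by (auto simp: in_set_conv_nth)

lemma cube_length: "x \<in> cube n \<Longrightarrow> length x = n"
  by (simp add: cube_def)

lemma cube_update: "x \<in> cube n \<Longrightarrow> u \<in> {0..1} \<Longrightarrow> x[i := u] \<in> cube n"
  unfolding cube_def
  by (metis (mono_tags, lifting) insert_subset length_list_update mem_Collect_eq
      set_update_subset_insert subset_trans)

lemma cube_continuous_on_compose:
  assumes "cube_continuous n f"
    and "\<And>z. z \<in> X \<Longrightarrow> g z \<in> cube n"
    and "\<And>i. i < n \<Longrightarrow> continuous_on X (\<lambda>z. g z ! i)"
  shows "continuous_on X (\<lambda>z. f (g z))"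
proof -
  \<comment> \<open>Padding by 0 keeps the sequence inside the product of unit intervals.\<close>
  let ?h = "\<lambda>z i. if i < n then g z ! i else 0"
  have "continuous_on X ?h"
  proof (rule continuous_on_coordinatewise_then_product)
    fix i show "continuous_on X (\<lambda>z. ?h z i)"
      using assms(3)[of i] by (cases "i < n") simp_all
  qed
  moreover have "?h ` X \<subseteq> {x. \<forall>i. x i \<in> {0..1}}"
    using cube_nth[OF assms(2)] by auto
  ultimately have "continuous_on X (\<lambda>z. f (map (?h z) [0..<n]))"
    using continuous_on_compose2[of _ "\<lambda>x. f (map x [0..<n])" X ?h] assms(1)
    unfolding cube_continuous_def by auto
  moreover have "map (?h z) [0..<n] = g z" if "z \<in> X" for z
    using cube_length[OF assms(2)[OF that]] by (intro nth_equalityI) auto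
  ultimately show ?thesis
    by (simp cong: continuous_on_cong)
qed

text \<open>The definition of \<open>cube_continuous\<close> is this test for the single map
  \<open>\<lambda>x. map x [0..<n]\<close>, which is why parameters range over
  \<open>nat \<Rightarrow> real\<close>. Continuity of composite expressions can then be checked
  along an arbitrary \<open>g\<close>, coordinate by coordinate.\<close>

lemma cube_continuousI:
  assumes "\<And>X g. (\<And>z :: nat \<Rightarrow> real. z \<in> X \<Longrightarrow> g z \<in> cube n) \<Longrightarrow>
      (\<And>i. i < n \<Longrightarrow> continuous_on X (\<lambda>z. g z ! i)) \<Longrightarrow> continuous_on X (\<lambda>z. f (g z))"
  shows "cube_continuous n f"
  unfolding cube_continuous_def
proof (rule assms)
  show "map x [0..<n] \<in> cube n" if "x \<in> {x. \<forall>i. x i \<in> {0..1}}" for x :: "nat \<Rightarrow> real"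
    using that by (auto simp: cube_def)
  show "continuous_on {x :: nat \<Rightarrow> real. \<forall>i. x i \<in> {0..1}} (\<lambda>x. map x [0..<n] ! i)" if "i < n" for i
    using that by (auto intro: continuous_on_subset[OF continuous_on_product_coordinates])
qed

definition partial_deriv :: "nat \<Rightarrow> nat \<Rightarrow> (real list \<Rightarrow> real) \<Rightarrow> (real list \<Rightarrow> real) \<Rightarrow> bool" where
  "partial_deriv n i f h \<longleftrightarrow> (\<forall>x\<in>cube n.
     ((\<lambda>u. f (x[i := u])) has_real_derivative h x) (at (x ! i) within {0..1}))"

lemma partial_deriv_cong:
  assumes "partial_deriv n i f h" "i < n" "\<And>x. x \<in> cube n \<Longrightarrow> f x = f' x"
    "\<And>x. x \<in> cube n \<Longrightarrow> h x = h' x"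
  shows "partial_deriv n i f' h'"
  unfolding partial_deriv_def
proof
  fix x assume x: "x \<in> cube n"
  have "((\<lambda>u. f (x[i := u])) has_real_derivative h x) (at (x ! i) within {0..1})"
    using assms(1) x by (simp add: partial_deriv_def)
  then have "((\<lambda>u. f' (x[i := u])) has_real_derivative h x) (at (x ! i) within {0..1})"
    by (rule has_field_derivative_transform_within[OF _ zero_less_one])
      (use x assms cube_nth cube_update in auto)
  then show "((\<lambda>u. f' (x[i := u])) has_real_derivative h' x) (at (x ! i) within {0..1})"
    using assms(4) x by simp
qed

text \<open>Smooth functions form the largest class of continuous functions in which every member
  has its partial derivatives inside the class, so exhibiting one such class \<open>S\<close>
  suffices. Choosing derivatives inside \<open>S\<close> spares the closure lemmas all formulas for
  iterated derivatives.\<close>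

lemma cube_smooth_coinduct:
  assumes "S f"
    and "\<And>g. S g \<Longrightarrow> cube_continuous n g"
    and "\<And>g i. S g \<Longrightarrow> i < n \<Longrightarrow> \<exists>h. S h \<and> partial_deriv n i g h"
  shows "cube_smooth n f"
proof -
  define pd where "pd g i = (SOME h. S h \<and> partial_deriv n i g h)" for g i
  have pd: "S (pd g i) \<and> partial_deriv n i g (pd g i)" if "S g" "i < n" for g i
    unfolding pd_def using assms(3)[OF that] by (rule someI_ex)
  \<comment> \<open>The recursion peels off the head because \<open>D (i # \<alpha>)\<close> has to
    be a derivative of \<open>D \<alpha>\<close>.\<close>
  define D where "D = rec_list f (\<lambda>i _ g. pd g i)"
  have D: "S (D \<alpha>)" if "\<alpha> \<in> lists {..<n}" for \<alpha>
    using that by (induction \<alpha>) (auto simp: D_def assms(1) pd)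
  show ?thesis
    unfolding cube_smooth_def
  proof (intro exI[of _ D] conjI ballI allI impI)
    show "D [] x = f x" for x by (simp add: D_def)
    show "cube_continuous n (D \<alpha>)" if "\<alpha> \<in> lists {..<n}" for \<alpha>
      using D[OF that] assms(2) by blast
    show "((\<lambda>u. D \<alpha> (x[i := u])) has_real_derivative D (i # \<alpha>) x) (at (x ! i) within {0..1})"
      if "\<alpha> \<in> lists {..<n}" "i < n" "x \<in> cube n" for \<alpha> i x
      using pd[OF D[OF that(1)] that(2)] that(3) by (simp add: partial_deriv_def D_def)
  qed
qed

lemma cube_smooth_cong:
  assumes "cube_smooth n f" "\<And>x. x \<in> cube n \<Longrightarrow> f x = g x"
  shows "cube_smooth n g"
  using assms unfolding cube_smooth_def by simp

lemma cube_smooth_ex_derivs: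
  assumes "cube_smooth n f"
  shows "\<exists>D. (\<forall>x\<in>cube n. D [] x = f x) \<and> (\<forall>\<alpha>\<in>lists {..<n}. cube_continuous n (D \<alpha>)) \<and>
    (\<forall>\<alpha>\<in>lists {..<n}. \<forall>i<n. partial_deriv n i (D \<alpha>) (D (i # \<alpha>)))"
  using assms unfolding cube_smooth_def partial_deriv_def ball_conj_distrib .

lemma cube_smooth_continuous: "cube_smooth n f \<Longrightarrow> cube_continuous n f"
proof -
  assume "cube_smooth n f"
  then obtain D where D: "(\<forall>x\<in>cube n. D [] x = f x) \<and> (\<forall>\<alpha>\<in>lists {..<n}. cube_continuous n (D \<alpha>)) \<and>
    (\<forall>\<alpha>\<in>lists {..<n}. \<forall>i<n. partial_deriv n i (D \<alpha>) (D (i # \<alpha>)))"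
    by (elim exE[OF cube_smooth_ex_derivs])
  then have D: "\<forall>x\<in>cube n. D [] x = f x" "\<forall>\<alpha>\<in>lists {..<n}. cube_continuous n (D \<alpha>)"
    by simp_all
  show ?thesis
  proof (rule cube_continuousI)
    fix X and g :: "(nat \<Rightarrow> real) \<Rightarrow> real list"
    assume g: "\<And>z. z \<in> X \<Longrightarrow> g z \<in> cube n" "\<And>i. i < n \<Longrightarrow> continuous_on X (\<lambda>z. g z ! i)"
    have "continuous_on X (\<lambda>z. D [] (g z))"
      using cube_continuous_on_compose[OF D(2)[rule_format, OF lists.Nil] g] .
    then show "continuous_on X (\<lambda>z. f (g z))"
      using D(1) g(1) by (simp cong: continuous_on_cong)
  qed
qed

text \<open>The members of one tower of derivatives are closed under differentiation, hence form an
  admissible class for the coinduction.\<close>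

lemma cube_smooth_partial_deriv:
  assumes "cube_smooth n f" "i < n"
  shows "\<exists>h. cube_smooth n h \<and> partial_deriv n i f h"
proof -
  obtain D where D: "(\<forall>x\<in>cube n. D [] x = f x) \<and> (\<forall>\<alpha>\<in>lists {..<n}. cube_continuous n (D \<alpha>)) \<and>
    (\<forall>\<alpha>\<in>lists {..<n}. \<forall>i<n. partial_deriv n i (D \<alpha>) (D (i # \<alpha>)))"
    using cube_smooth_ex_derivs[OF assms(1)] by (elim exE)
  then have D: "\<forall>x\<in>cube n. D [] x = f x" "\<forall>\<alpha>\<in>lists {..<n}. cube_continuous n (D \<alpha>)"
    "\<forall>\<alpha>\<in>lists {..<n}. \<forall>i<n. partial_deriv n i (D \<alpha>) (D (i # \<alpha>))"
    by simp_all
  have "cube_smooth n (D [i])"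
  proof (rule cube_smooth_coinduct[where S = "\<lambda>g. \<exists>\<alpha>\<in>lists {..<n}. g = D \<alpha>"])
    show "\<exists>\<alpha>\<in>lists {..<n}. D [i] = D \<alpha>" using assms(2) by (intro bexI[of _ "[i]"]) auto
  next
    fix g j assume "\<exists>\<alpha>\<in>lists {..<n}. g = D \<alpha>"
    then obtain \<alpha> where \<alpha>: "\<alpha> \<in> lists {..<n}" "g = D \<alpha>" by (elim bexE)
    show "cube_continuous n g" using D(2) \<alpha> by simp
    assume j: "j < n"
    show "\<exists>h. (\<exists>\<alpha>\<in>lists {..<n}. h = D \<alpha>) \<and> partial_deriv n j g h"
      using D(3) \<alpha> j by (intro exI[of _ "D (j # \<alpha>)"] conjI bexI[of _ "j # \<alpha>"]) auto
  qed
  moreover have "partial_deriv n i f (D [i])"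
    using partial_deriv_cong[OF D(3)[rule_format, OF lists.Nil, of i]] assms(2) D(1) by auto
  ultimately show ?thesis by blast
qed

lemma partial_deriv_lin:
  assumes "partial_deriv n i f f'" "partial_deriv n i g g'"
  shows "partial_deriv n i (\<lambda>x. a * f x + b * g x) (\<lambda>x. a * f' x + b * g' x)"
  using assms unfolding partial_deriv_def by (auto intro!: derivative_eq_intros)

lemma cube_continuous_lin:
  assumes "cube_continuous n f" "cube_continuous n g"
  shows "cube_continuous n (\<lambda>x. a * f x + b * g x)"
  using assms unfolding cube_continuous_def by (intro continuous_intros)

lemma cube_smooth_lin:
  assumes "cube_smooth n f" "cube_smooth n g"
  shows "cube_smooth n (\<lambda>x. a * f x + b * g x)"
proof (rule cube_smooth_coinduct[where
      S = "\<lambda>h. \<exists>f g. cube_smooth n f \<and> cube_smooth n g \<and> h = (\<lambda>x. a * f x + b * g x)"])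
  show "\<exists>f' g'. cube_smooth n f' \<and> cube_smooth n g' \<and>
      (\<lambda>x. a * f x + b * g x) = (\<lambda>x. a * f' x + b * g' x)"
    using assms by blast
next
  fix h i
  assume "\<exists>f g. cube_smooth n f \<and> cube_smooth n g \<and> h = (\<lambda>x. a * f x + b * g x)"
  then obtain f g where fg: "cube_smooth n f" "cube_smooth n g" "h = (\<lambda>x. a * f x + b * g x)"
    by blast
  show "cube_continuous n h"
    using fg cube_continuous_lin cube_smooth_continuous by simp
  assume i: "i < n"
  obtain f' g' where "cube_smooth n f'" "partial_deriv n i f f'"
    "cube_smooth n g'" "partial_deriv n i g g'"
    using cube_smooth_partial_deriv[OF fg(1) i] cube_smooth_partial_deriv[OF fg(2) i] by blast
  then show "\<exists>h'. (\<exists>f g. cube_smooth n f \<and> cube_smooth n g \<and> h' = (\<lambda>x. a * f x + b * g x)) \<and>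
      partial_deriv n i h h'"
    unfolding fg(3) by (blast intro: partial_deriv_lin)
qed

lemma cube_smooth_const: "cube_smooth n (\<lambda>x. c)"
  by (rule cube_smooth_coinduct[where S = "\<lambda>h. \<exists>c. h = (\<lambda>x. c)"])
    (auto simp: cube_continuous_def partial_deriv_def intro!: exI[of _ "\<lambda>x :: real list. 0 :: real"])

lemma cube_smooth_mult_coord:
  assumes "cube_smooth n f" "j < n"
  shows "cube_smooth n (\<lambda>x. x ! j * f x)"
proof -
  \<comment> \<open>The extra summand \<open>g\<close> absorbs the term \<open>f\<close> that the
    product rule creates in direction \<open>j\<close>.\<close>
  let ?S = "\<lambda>h. \<exists>f g. cube_smooth n f \<and> cube_smooth n g \<and> h = (\<lambda>x. x ! j * f x + g x)"
  show ?thesis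
  proof (rule cube_smooth_coinduct[where S = ?S])
    show "?S (\<lambda>x. x ! j * f x)"
      using assms cube_smooth_const[of n 0] by force
  next
    fix h i assume "?S h"
    then obtain f g where fg: "cube_smooth n f" "cube_smooth n g" "h = (\<lambda>x. x ! j * f x + g x)"
      by blast
    show "cube_continuous n h"
      unfolding fg(3)
      by (intro cube_continuousI continuous_intros
          cube_continuous_on_compose[OF cube_smooth_continuous[OF fg(1)]]
          cube_continuous_on_compose[OF cube_smooth_continuous[OF fg(2)]])
        (use assms in auto)
    assume i: "i < n"
    obtain f' g' where f'g': "cube_smooth n f'" "partial_deriv n i f f'"
      "cube_smooth n g'" "partial_deriv n i g g'"
      using cube_smooth_partial_deriv[OF fg(1) i] cube_smooth_partial_deriv[OF fg(2) i] by blast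
    let ?e = "if i = j then 1 else 0 :: real"
    have "((\<lambda>u. x[i := u] ! j) has_real_derivative ?e) (at (x ! i) within {0..1})"
      if "x \<in> cube n" for x
      using that i by (cases "i = j") (auto simp: cube_length)
    then have "partial_deriv n i h (\<lambda>x. x ! j * f' x + (?e * f x + 1 * g' x))"
      using f'g' i unfolding fg(3) partial_deriv_def
      by (fastforce intro!: derivative_eq_intros simp: cube_length)
    then show "\<exists>h'. ?S h' \<and> partial_deriv n i h h'"
      using f'g'(1) cube_smooth_lin[OF fg(1) f'g'(3), of ?e 1] by blast
  qed
qed

text \<open>Freezing coordinate \<open>j\<close> kills the derivative in direction \<open>j\<close>
  and commutes with the derivatives in all other directions.\<close>

lemma cube_smooth_eval:
  assumes "cube_smooth n f" "j < n" and a: "a \<in> {0..1}"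
  shows "cube_smooth n (\<lambda>x. f (x[j := a]))"
proof -
  let ?S = "\<lambda>h. \<exists>f. cube_smooth n f \<and> h = (\<lambda>x. f (x[j := a]))"
  show ?thesis
  proof (rule cube_smooth_coinduct[where S = ?S])
    show "?S (\<lambda>x. f (x[j := a]))"
      using assms by blast
  next
    fix h i assume "?S h"
    then obtain f where f: "cube_smooth n f" "h = (\<lambda>x. f (x[j := a]))"
      by blast
    show "cube_continuous n h"
      unfolding f(2)
    proof (intro cube_continuousI cube_continuous_on_compose[OF cube_smooth_continuous[OF f(1)]])
      fix X and g :: "(nat \<Rightarrow> real) \<Rightarrow> real list" and i
      assume g: "\<And>z. z \<in> X \<Longrightarrow> g z \<in> cube n" "\<And>i. i < n \<Longrightarrow> continuous_on X (\<lambda>z. g z ! i)"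
      show "(g z)[j := a] \<in> cube n" if "z \<in> X" for z using g(1) that a cube_update by blast
      assume "i < n"
      moreover have "length (g z) = n" if "z \<in> X" for z using g(1)[OF that] by (rule cube_length)
      ultimately show "continuous_on X (\<lambda>z. (g z)[j := a] ! i)"
        using g(2) by (cases "i = j") (simp_all cong: continuous_on_cong)
    qed
    assume i: "i < n"
    obtain f' where f': "cube_smooth n f'" "partial_deriv n i f f'"
      using cube_smooth_partial_deriv[OF f(1) i] by blast
    show "\<exists>h'. ?S h' \<and> partial_deriv n i h h'"
    proof (cases "i = j")
      case True
      then have "partial_deriv n i h (\<lambda>x. 0)"
        unfolding f(2) partial_deriv_def by simp
      then show ?thesis using cube_smooth_const[of n 0] by blast
    next
      case False
      have "partial_deriv n i h (\<lambda>x. f' (x[j := a]))"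
        unfolding partial_deriv_def
      proof
        fix x assume "x \<in> cube n"
        then have "((\<lambda>u. f (x[j := a, i := u])) has_real_derivative f' (x[j := a]))
            (at (x[j := a] ! i) within {0..1})"
          using f'(2) a cube_update unfolding partial_deriv_def by blast
        then show "((\<lambda>u. h (x[i := u])) has_real_derivative f' (x[j := a])) (at (x ! i) within {0..1})"
          using False by (simp add: f(2) list_update_swap)
      qed
      then show ?thesis using f'(1) by blast
    qed
  qed
qed

section \<open>Primitives in one coordinate of the cube\<close>

definition integral_upto :: "nat \<Rightarrow> (real list \<Rightarrow> real) \<Rightarrow> real list \<Rightarrow> real" where
  "integral_upto j f x = integral {0..x ! j} (\<lambda>u. f (x[j := u]))"

lemma cube_slice_continuous:
  assumes "cube_continuous n f" "x \<in> cube n" "j < n"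
  shows "continuous_on {0..1} (\<lambda>u. f (x[j := u]))"
proof (rule cube_continuous_on_compose[OF assms(1)])
  show "x[j := u] \<in> cube n" if "u \<in> {0..1}" for u
    using that assms(2) cube_update by blast
  show "continuous_on {0..1} (\<lambda>u. x[j := u] ! i)" if "i < n" for i
    using assms(2,3) by (cases "i = j") (simp_all add: cube_length)
qed

text \<open>Moves a variable upper limit into the integrand, so that continuity of parameter
  integrals over a fixed interval becomes applicable.\<close>

lemma integral_rescale:
  fixes g :: "real \<Rightarrow> real"
  assumes "0 \<le> t"
  shows "integral {0..t} g = t * integral {0..1} (\<lambda>v. g (t * v))"
proof (cases "t = 0")
  case False
  have "(\<lambda>x. x / t) ` {0..t} = {0..1}"
    using False assms by (auto simp: image_iff field_simps intro!: bexI[of _ "_ * t"])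
  then show ?thesis
    using integral_stretch_real[OF False, of 0 t g] assms False by simp
qed simp

lemma cube_continuous_integral_upto:
  assumes "cube_continuous n f" "j < n"
  shows "cube_continuous n (integral_upto j f)"
proof (rule cube_continuousI)
  fix X and g :: "(nat \<Rightarrow> real) \<Rightarrow> real list"
  assume g: "\<And>z. z \<in> X \<Longrightarrow> g z \<in> cube n" "\<And>i. i < n \<Longrightarrow> continuous_on X (\<lambda>z. g z ! i)"
  have "continuous_on (X \<times> cbox 0 (1::real)) (\<lambda>y. f ((g (fst y))[j := g (fst y) ! j * snd y]))"
  proof (rule cube_continuous_on_compose[OF assms(1)])
    show "(g (fst y))[j := g (fst y) ! j * snd y] \<in> cube n" if "y \<in> X \<times> cbox 0 (1::real)" for y
    proof (rule cube_update)
      show "g (fst y) \<in> cube n" using that g(1) by auto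
      then have "g (fst y) ! j \<in> {0..1}" using assms(2) cube_nth by blast
      then show "g (fst y) ! j * snd y \<in> {0..1}"
        using that by (auto intro: mult_le_one)
    qed
    fix i assume i: "i < n"
    have c: "continuous_on (X \<times> cbox 0 (1::real)) (\<lambda>y. g (fst y) ! i)"
      by (rule continuous_on_compose2[OF g(2)[OF i]]) (auto intro: continuous_intros)
    show "continuous_on (X \<times> cbox 0 (1::real)) (\<lambda>y. (g (fst y))[j := g (fst y) ! j * snd y] ! i)"
    proof (cases "i = j")
      case True
      have "continuous_on (X \<times> cbox 0 (1::real)) (\<lambda>y. g (fst y) ! i * snd y)"
        by (intro continuous_intros c)
      moreover have "length (g (fst y)) = n" if "y \<in> X \<times> cbox 0 (1::real)" for y
        using that g(1) cube_length by auto
      ultimately show ?thesis using True i by (simp cong: continuous_on_cong)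
    next
      case False
      then show ?thesis using c by simp
    qed
  qed
  then have "continuous_on X (\<lambda>z. integral (cbox 0 1) (\<lambda>v. f ((g z)[j := g z ! j * v])))"
    by (intro integral_continuous_on_param) (simp add: split_def)
  then have "continuous_on X (\<lambda>z. g z ! j * integral {0..1} (\<lambda>v. f ((g z)[j := g z ! j * v])))"
    using g(2)[OF assms(2)] by (auto intro!: continuous_intros)
  moreover have "g z ! j * integral {0..1} (\<lambda>v. f ((g z)[j := g z ! j * v])) = integral_upto j f (g z)"
    if "z \<in> X" for z
    unfolding integral_upto_def
    using integral_rescale[of "g z ! j" "\<lambda>u. f ((g z)[j := u])"] cube_nth[OF g(1)[OF that] assms(2)]
    by simp
  ultimately show "continuous_on X (\<lambda>z. integral_upto j f (g z))"
    by (simp cong: continuous_on_cong)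
qed

lemma partial_deriv_integral_upto_same:
  assumes "cube_continuous n f" "j < n"
  shows "partial_deriv n j (integral_upto j f) f"
  unfolding partial_deriv_def
proof
  fix x assume x: "x \<in> cube n"
  then have "((\<lambda>t. integral {0..t} (\<lambda>u. f (x[j := u]))) has_real_derivative f (x[j := x ! j]))
      (at (x ! j) within {0..1})"
    by (intro integral_has_real_derivative cube_slice_continuous[OF assms(1) x assms(2)]
        cube_nth[OF x assms(2)])
  then show "((\<lambda>u. integral_upto j f (x[j := u])) has_real_derivative f x) (at (x ! j) within {0..1})"
    using x assms(2) by (simp add: integral_upto_def cube_length)
qed

lemma cube_slice2_continuous:
  assumes "cube_continuous n f" "x \<in> cube n" "i < n" "j < n" "i \<noteq> j"
  shows "continuous_on ({0..1} \<times> {0..1}) (\<lambda>(u, v). f (x[i := u, j := v]))"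
  unfolding split_def
proof (rule cube_continuous_on_compose[OF assms(1)])
  show "x[i := fst y, j := snd y] \<in> cube n" if "y \<in> {0..1} \<times> {0..1}" for y
    using that assms(2) by (auto intro!: cube_update)
  show "continuous_on ({0..1} \<times> {0..1}) (\<lambda>y. x[i := fst y, j := snd y] ! k)" if "k < n" for k
    using assms(2-) that by (cases "k = j"; cases "k = i") (auto simp: cube_length intro: continuous_intros)
qed

text \<open>Since \<open>i\<close> differs from \<open>j\<close>, the upper limit
  \<open>x ! j\<close> stays fixed and the Leibniz rule differentiates under the integral.\<close>

lemma partial_deriv_integral_upto_other:
  assumes f: "cube_continuous n f" "partial_deriv n i f f'" "cube_continuous n f'"
    and "i < n" "j < n" "i \<noteq> j"
  shows "partial_deriv n i (integral_upto j f) (integral_upto j f')"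
  unfolding partial_deriv_def
proof
  fix x assume x: "x \<in> cube n"
  have xj: "x ! j \<in> {0..1}" and xi: "x ! i \<in> {0..1}"
    using cube_nth x assms by blast+
  have "((\<lambda>t. integral (cbox 0 (x ! j)) (\<lambda>u. f (x[i := t, j := u]))) has_real_derivative
      integral (cbox 0 (x ! j)) (\<lambda>u. f' (x[i := x ! i, j := u]))) (at (x ! i) within {0..1})"
  proof (rule leibniz_rule_field_derivative)
    fix s t assume st: "s \<in> {0..1::real}" "t \<in> cbox 0 (x ! j)"
    then have "x[j := t, i := s] \<in> cube n"
      using x xj by (intro cube_update) auto
    then have "((\<lambda>u. f (x[j := t, i := s, i := u])) has_real_derivative f' (x[j := t, i := s]))
        (at (x[j := t, i := s] ! i) within {0..1})"
      using f(2) unfolding partial_deriv_def by blast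
    then show "((\<lambda>s. f (x[i := s, j := t])) has_real_derivative f' (x[i := s, j := t]))
        (at s within {0..1})"
      using x assms by (simp add: cube_length list_update_swap)
  next
    fix s assume s: "s \<in> {0..1::real}"
    have "continuous_on {0..1} (\<lambda>u. f (x[i := s, j := u]))"
      using cube_slice_continuous[OF f(1) cube_update[OF x s] assms(5)] .
    then have "continuous_on (cbox 0 (x ! j)) (\<lambda>u. f (x[i := s, j := u]))"
      by (rule continuous_on_subset) (use xj in auto)
    then show "(\<lambda>u. f (x[i := s, j := u])) integrable_on cbox 0 (x ! j)"
      by (rule integrable_continuous)
  next
    show "continuous_on ({0..1} \<times> cbox 0 (x ! j)) (\<lambda>(s, t). f' (x[i := s, j := t]))"
      by (rule continuous_on_subset[OF cube_slice2_continuous[OF f(3) x]]) (use assms xj in auto)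
  qed (use xi in auto)
  then show "((\<lambda>u. integral_upto j f (x[i := u])) has_real_derivative integral_upto j f' x)
      (at (x ! i) within {0..1})"
    using x assms by (simp add: integral_upto_def)
qed

lemma cube_smooth_integral_upto:
  assumes "cube_smooth n f" "j < n"
  shows "cube_smooth n (integral_upto j f)"
proof -
  \<comment> \<open>Differentiating in direction \<open>j\<close> removes the integral, so the class
    has to contain the smooth functions themselves as well.\<close>
  let ?S = "\<lambda>h. \<exists>f. cube_smooth n f \<and> h = f \<or> cube_smooth n f \<and> h = integral_upto j f"
  show ?thesis
  proof (rule cube_smooth_coinduct[where S = ?S])
    show "?S (integral_upto j f)" using assms by blast
  next
    fix h assume "?S h"
    then show "cube_continuous n h"
      using cube_smooth_continuous cube_continuous_integral_upto assms(2) by blast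
  next
    fix h i assume h: "?S h" and i: "i < n"
    show "\<exists>h'. ?S h' \<and> partial_deriv n i h h'"
    proof (cases "cube_smooth n h")
      case True
      then show ?thesis using cube_smooth_partial_deriv i by blast
    next
      case False
      then obtain f where f: "cube_smooth n f" "h = integral_upto j f" using h by blast
      obtain f' where f': "cube_smooth n f'" "partial_deriv n i f f'"
        using cube_smooth_partial_deriv[OF f(1) i] by blast
      show ?thesis
      proof (cases "i = j")
        case True
        then show ?thesis
          using partial_deriv_integral_upto_same[OF cube_smooth_continuous[OF f(1)] i] f by blast
      next
        case False
        then have "partial_deriv n i h (integral_upto j f')"
          unfolding f(2) using f f' i assms(2)
          by (intro partial_deriv_integral_upto_other cube_smooth_continuous) auto
        then show ?thesis using f'(1) by blast
      qed
    qed
  qed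
qed

section \<open>Forms on the interval\<close>

text \<open>The regularity retained when a form on the cube is restricted to one slot: continuously
  differentiable in the remaining coordinate for each bit, and zero off the interval.\<close>

definition smooth_slice :: "(form_label \<Rightarrow> real) \<Rightarrow> bool" where
  "smooth_slice f \<longleftrightarrow> (\<forall>b t. t \<notin> {0..1} \<longrightarrow> f (b, t) = 0) \<and>
     (\<exists>f'. (\<forall>b. continuous_on {0..1} (\<lambda>u. f' (b, u))) \<and>
       (\<forall>b. \<forall>t\<in>{0..1}. ((\<lambda>u. f (b, u)) has_real_derivative f' (b, t)) (at t within {0..1})))"

lemma smooth_slice_continuous: "smooth_slice f \<Longrightarrow> continuous_on {0..1} (\<lambda>u. f (b, u))"
  unfolding smooth_slice_def
  by (meson DERIV_continuous continuous_on_eq_continuous_within)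

lemma smooth_slice_zero: "smooth_slice f \<Longrightarrow> snd x \<notin> {0..1} \<Longrightarrow> f x = 0"
  by (cases x) (simp add: smooth_slice_def)

text \<open>\<open>vector_derivative\<close> is a choice; one-sided derivatives on a nondegenerate
  interval are unique, also at the endpoints, and this fixes the chosen value.\<close>

lemma d1_eq:
  assumes "((\<lambda>u. f (False, u)) has_real_derivative c) (at t within {0..1})" "t \<in> {0..1}"
  shows "d1 f (True, t) = c"
  using vector_derivative_within_cbox[of 0 1 t "\<lambda>u. f (False, u)" c] assms
  by (simp add: d1_def has_real_derivative_iff_has_vector_derivative)

lemma d1_eq_0: "\<not> (fst x \<and> snd x \<in> {0..1}) \<Longrightarrow> d1 f x = 0"
  by (cases x) (auto simp: d1_def)

definition whitney_proj :: "(form_label \<Rightarrow> real) \<Rightarrow> form_label \<Rightarrow> real" where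
  "whitney_proj = W1 \<circ> R1"

lemma R1_W1: "R1 (W1 c) = c"
proof
  fix z show "R1 (W1 c) z = c z"
  proof (cases z)
    case E01
    have "integral {0..1} (\<lambda>t. W1 c (True, t)) = integral {0..1} (\<lambda>t :: real. c E01)"
      by (rule Henstock_Kurzweil_Integration.integral_cong) (simp add: W1_def)
    then show ?thesis using E01 by simp
  qed (simp_all add: W1_def)
qed

text \<open>A Whitney form has a constant \<open>dt\<close> coefficient, whose primitive is linear
  and is cancelled by the correction term of \<open>s1\<close>.\<close>

lemma s1_W1: "s1 (W1 c) = (\<lambda>x. 0)"
proof
  fix x show "s1 (W1 c) x = 0"
  proof (cases "\<not> fst x \<and> snd x \<in> {0..1}")
    case True
    have "integral {0..r} (\<lambda>t. W1 c (True, t)) = c E01 * r" if "r \<in> {0..1}" for r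
    proof -
      have "integral {0..r} (\<lambda>t. W1 c (True, t)) = integral {0..r} (\<lambda>t :: real. c E01)"
        using that by (intro Henstock_Kurzweil_Integration.integral_cong) (simp add: W1_def)
      then show ?thesis using that by simp
    qed
    then show ?thesis using True by (cases x) (simp add: s1_def)
  qed (cases x, auto simp: s1_def)
qed

text \<open>The primitive vanishes at 0, the correction term makes the result vanish at 1, and there
  is no \<open>dt\<close> part left to integrate.\<close>

lemma R1_s1: "R1 (s1 f) = (\<lambda>z. 0)"
proof
  show "R1 (s1 f) z = 0" for z by (cases z) (simp_all add: s1_def)
qed

text \<open>\<open>s1\<close> reads only the \<open>dt\<close> coefficient and produces a form
  without one.\<close>

lemma s1_s1: "s1 (s1 f) = (\<lambda>x. 0)"
  by (auto simp: s1_def fun_eq_iff)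

lemma d1_W1: "d1 (W1 c) = W1 (delta1 c)"
proof
  fix x show "d1 (W1 c) x = W1 (delta1 c) x"
  proof (cases "fst x \<and> snd x \<in> {0..1}")
    case True
    then obtain t where t: "x = (True, t)" "t \<in> {0..1}" by (cases x) auto
    have "((\<lambda>u. c V0 * (1 - u) + c V1 * u) has_real_derivative c V1 - c V0) (at t within {0..1})"
      by (auto intro!: derivative_eq_intros)
    then have "((\<lambda>u. W1 c (False, u)) has_real_derivative c V1 - c V0) (at t within {0..1})"
      by (rule has_field_derivative_transform_within[OF _ zero_less_one])
        (use t in \<open>auto simp: W1_def\<close>)
    then show ?thesis using t d1_eq[of "W1 c"] by (simp add: W1_def)
  next
    case False
    then show ?thesis by (cases x) (auto simp: d1_def W1_def)
  qed
qed

lemma integral_deriv_slice: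
  assumes f: "smooth_slice f" and r: "r \<in> {0..1}"
  shows "integral {0..r} (\<lambda>u. d1 f (True, u)) = f (False, r) - f (False, 0)"
proof -
  obtain f' where f': "\<forall>b. \<forall>t\<in>{0..1}. ((\<lambda>u. f (b, u)) has_real_derivative f' (b, t)) (at t within {0..1})"
    using f unfolding smooth_slice_def by blast
  have "((\<lambda>u. d1 f (True, u)) has_integral f (False, r) - f (False, 0)) {0..r}"
  proof (rule fundamental_theorem_of_calculus)
    fix t assume "t \<in> {0..r}"
    then have t: "t \<in> {0..1}" using r by auto
    then have "((\<lambda>u. f (False, u)) has_real_derivative d1 f (True, t)) (at t within {0..1})"
      using f' d1_eq[of f "f' (False, t)" t] by metis
    then show "((\<lambda>u. f (False, u)) has_vector_derivative d1 f (True, t)) (at t within {0..r})"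
      using r by (auto simp: has_real_derivative_iff_has_vector_derivative
          intro: has_vector_derivative_within_subset)
  qed (use r in simp)
  then show ?thesis by (rule integral_unique)
qed

text \<open>Stokes' theorem on the interval.\<close>

lemma R1_d1: "smooth_slice f \<Longrightarrow> R1 (d1 f) = delta1 (R1 f)"
proof
  show "R1 (d1 f) z = delta1 (R1 f) z" if "smooth_slice f" for z
    using integral_deriv_slice[OF that, of 1] by (cases z) (simp_all add: d1_def)
qed

lemma d1_s1:
  assumes f: "smooth_slice f"
  shows "d1 (s1 f) x + s1 (d1 f) x = f x - W1 (R1 f) x"
proof -
  obtain b t where x: "x = (b, t)" by (cases x)
  consider "t \<notin> {0..1}" | "t \<in> {0..1}" "b" | "t \<in> {0..1}" "\<not> b" by blast
  then show ?thesis
  proof cases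
    case 1
    then show ?thesis using smooth_slice_zero[OF f, of x]
      by (auto simp: d1_def s1_def W1_def x)
  next
    case 2
    \<comment> \<open>On the \<open>dt\<close> part the primitive differentiates back to
      \<open>f\<close>, and the correction contributes the constant \<open>?c\<close>, which is the
      \<open>dt\<close> coefficient of \<open>W1 (R1 f)\<close>.\<close>
    let ?c = "integral {0..1} (\<lambda>u. f (True, u))"
    have "((\<lambda>t. integral {0..t} (\<lambda>u. f (True, u)) - t * ?c) has_real_derivative f (True, t) - ?c)
        (at t within {0..1})"
      by (rule derivative_eq_intros refl integral_has_real_derivative
          smooth_slice_continuous[OF f] 2)+ simp
    then have "((\<lambda>t. s1 f (False, t)) has_real_derivative f (True, t) - ?c) (at t within {0..1})"
      by (rule has_field_derivative_transform_within[OF _ zero_less_one])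
        (use 2 in \<open>auto simp: s1_def\<close>)
    then show ?thesis using 2 d1_eq[of "s1 f" _ t] by (auto simp: x s1_def W1_def)
  next
    case 3
    then have "d1 (s1 f) x = 0" by (simp add: d1_eq_0 x)
    \<comment> \<open>At \<open>r = t\<close> and \<open>r = 1\<close> this turns
      \<open>s1 (d1 f)\<close> into \<open>f\<close> minus the linear interpolation of its endpoint
      values.\<close>
    moreover have "integral {0..r} (\<lambda>u. d1 f (True, u)) = f (False, r) - f (False, 0)"
      if "r \<in> {0..1}" for r using integral_deriv_slice[OF f that] .
    ultimately show ?thesis
      using 3 by (simp add: x s1_def[of "d1 f"] W1_def) (simp add: algebra_simps)
  qed
qed

text \<open>Linearity is restricted to regular slices because derivatives and integrals take default
  values on other functions and are not additive there.\<close>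

definition slice_linear :: "((form_label \<Rightarrow> real) \<Rightarrow> form_label \<Rightarrow> real) \<Rightarrow> bool" where
  "slice_linear T \<longleftrightarrow> (\<forall>f g a b y. smooth_slice f \<longrightarrow> smooth_slice g \<longrightarrow>
     T (\<lambda>x. a * f x + b * g x) y = a * T f y + b * T g y)"

lemma smooth_slice_0: "smooth_slice (\<lambda>x. 0)"
  unfolding smooth_slice_def by (auto intro!: exI[of _ "\<lambda>x. 0"])

lemma slice_linear_scale:
  assumes "slice_linear T" "smooth_slice f"
  shows "T (\<lambda>x. a * f x) y = a * T f y"
proof -
  have "T (\<lambda>x. a * f x + 0 * f x) y = a * T f y + 0 * T f y"
    using assms unfolding slice_linear_def by blast
  then show ?thesis by simp
qed

lemma slice_linear_0: "slice_linear T \<Longrightarrow> T (\<lambda>x. 0) y = 0"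
  using slice_linear_scale[OF _ smooth_slice_0, of T 0 y] by simp

lemma integral_slice_lin:
  assumes "\<And>b. continuous_on {0..1} (\<lambda>u. f (b, u))" "\<And>b. continuous_on {0..1} (\<lambda>u. g (b, u))"
    and "r \<in> {0..1::real}"
  shows "integral {0..r} (\<lambda>u. a * f (True, u) + b * g (True, u)) =
    a * integral {0..r} (\<lambda>u. f (True, u)) + b * integral {0..r} (\<lambda>u. g (True, u :: real) :: real)"
proof -
  have "(\<lambda>u. f (True, u)) integrable_on {0..r}" "(\<lambda>u. g (True, u)) integrable_on {0..r}"
    using assms by (auto intro!: integrable_continuous_interval continuous_on_subset[OF assms(1)]
        continuous_on_subset[OF assms(2)])
  then show ?thesis by (simp add: integral_add integrable_on_mult_right)
qed

lemma d1_slice_linear: "slice_linear d1"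
  unfolding slice_linear_def
proof (intro allI impI)
  fix f g a b and y :: form_label
  assume fg: "smooth_slice f" "smooth_slice g"
  obtain f' where f': "\<forall>b. \<forall>t\<in>{0..1}. ((\<lambda>u. f (b, u)) has_real_derivative f' (b, t)) (at t within {0..1})"
    using fg(1) unfolding smooth_slice_def by blast
  obtain g' where g': "\<forall>b. \<forall>t\<in>{0..1}. ((\<lambda>u. g (b, u)) has_real_derivative g' (b, t)) (at t within {0..1})"
    using fg(2) unfolding smooth_slice_def by blast
  show "d1 (\<lambda>x. a * f x + b * g x) y = a * d1 f y + b * d1 g y"
  proof (cases "fst y \<and> snd y \<in> {0..1}")
    case True
    then obtain t where t: "y = (True, t)" "t \<in> {0..1}" by (cases y) auto
    have *: "((\<lambda>u. f (False, u)) has_real_derivative f' (False, t)) (at t within {0..1})"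
      "((\<lambda>u. g (False, u)) has_real_derivative g' (False, t)) (at t within {0..1})"
      using f' g' t(2) by blast+
    then have "((\<lambda>u. a * f (False, u) + b * g (False, u)) has_real_derivative
        a * f' (False, t) + b * g' (False, t)) (at t within {0..1})"
      by (intro DERIV_add DERIV_cmult)
    then show ?thesis
      using d1_eq[of "\<lambda>x. a * f x + b * g x" _ t] d1_eq[OF *(1) t(2)] d1_eq[OF *(2) t(2)] t by simp
  next
    case False
    then show ?thesis by (simp add: d1_eq_0)
  qed
qed

text \<open>
  For fixed \<open>y\<close>, both \<open>f \<mapsto> s1 f y\<close> and \<open>f \<mapsto> W1 (R1 f) y\<close> are built from evaluations and
  integrals; such functionals of different variables commute with each other (Fubini) and with
  derivatives (Leibniz).
\<close>

inductive slice_functional :: "((form_label \<Rightarrow> real) \<Rightarrow> real) \<Rightarrow> bool" where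
  eval: "snd x \<in> {0..1} \<Longrightarrow> slice_functional (\<lambda>f. f x)"
| integral: "r \<in> {0..1} \<Longrightarrow> slice_functional (\<lambda>f. integral {0..r} (\<lambda>u. f (True, u)))"
| lin: "slice_functional L \<Longrightarrow> slice_functional L' \<Longrightarrow> slice_functional (\<lambda>f. a * L f + b * L' f)"

lemma slice_functional_0: "slice_functional (\<lambda>f. 0)"
  \<comment> \<open>A combination with both coefficients 0; the point of evaluation is
    arbitrary.\<close>
  using slice_functional.lin[OF slice_functional.eval slice_functional.eval,
      of "(True, 0)" "(True, 0)" 0 0] by simp

lemma s1_slice_functional: "slice_functional (\<lambda>f. s1 f y)"
proof (cases "\<not> fst y \<and> snd y \<in> {0..1}")
  case True
  then have "s1 f y = 1 * integral {0..snd y} (\<lambda>u. f (True, u))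
      + (- snd y) * integral {0..1} (\<lambda>u. f (True, u))" for f
    by (cases y) (simp add: s1_def)
  then show ?thesis
    using slice_functional.lin[OF slice_functional.integral slice_functional.integral,
        of "snd y" 1 1 "- snd y"] True by simp
next
  case False
  then have "s1 f y = 0" for f by (cases y) (auto simp: s1_def)
  then show ?thesis by (simp add: slice_functional_0)
qed

lemma whitney_proj_slice_functional: "slice_functional (\<lambda>f. whitney_proj f y)"
proof -
  consider "snd y \<notin> {0..1}" | "snd y \<in> {0..1}" "fst y" | "snd y \<in> {0..1}" "\<not> fst y" by blast
  then show ?thesis
  proof cases
    case 1
    then have "whitney_proj f y = 0" for f by (cases y) (auto simp: whitney_proj_def W1_def)
    then show ?thesis by (simp add: slice_functional_0)
  next
    case 2
    then have "whitney_proj f y = integral {0..1} (\<lambda>u. f (True, u))" for f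
      by (cases y) (auto simp: whitney_proj_def W1_def)
    then show ?thesis using slice_functional.integral[of 1] by simp
  next
    case 3
    then have "whitney_proj f y = (1 - snd y) * f (False, 0) + snd y * f (False, 1)" for f
      by (cases y) (auto simp: whitney_proj_def W1_def)
    then show ?thesis
      using slice_functional.lin[OF slice_functional.eval slice_functional.eval,
          of "(False, 0)" "(False, 1)" "1 - snd y" "snd y"] by simp
  qed
qed

definition continuous_slice :: "(form_label \<Rightarrow> real) \<Rightarrow> bool" where
  "continuous_slice f \<longleftrightarrow> (\<forall>b. continuous_on {0..1} (\<lambda>u. f (b, u)))"

definition continuous_slice2 :: "(form_label \<Rightarrow> form_label \<Rightarrow> real) \<Rightarrow> bool" where
  "continuous_slice2 G \<longleftrightarrow>
     (\<forall>b b'. continuous_on ({0..1} \<times> {0..1}) (\<lambda>(u, v). G (b, u) (b', v)))"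

lemma continuous_slice2_subset:
  assumes "continuous_slice2 G" "X \<subseteq> {0..1} \<times> {0..1}"
  shows "continuous_on X (\<lambda>(u, v). G (b, u) (b', v))"
  using assms continuous_on_subset unfolding continuous_slice2_def by blast

lemma continuous_slice2_left:
  assumes "continuous_slice2 G" "snd x \<in> {0..1}"
  shows "continuous_slice (G x)"
  unfolding continuous_slice_def
proof
  fix b
  have "continuous_on {0..1} (\<lambda>v. (\<lambda>(u, v). G (fst x, u) (b, v)) (snd x, v))"
    by (rule continuous_on_compose2[of "{0..1} \<times> {0..1}"])
      (use assms in \<open>auto simp: continuous_slice2_def intro!: continuous_intros\<close>)
  then show "continuous_on {0..1} (\<lambda>v. G x (b, v))" by simp
qed

lemma continuous_slice2_flip:
  assumes "continuous_slice2 G"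
  shows "continuous_slice2 (\<lambda>x y. G y x)"
  unfolding continuous_slice2_def
proof (intro allI)
  fix b b'
  have "continuous_on ({0..1} \<times> {0..1}) (\<lambda>z. (\<lambda>(u, v). G (b', u) (b, v)) (snd z, fst z))"
    by (rule continuous_on_compose2[of "{0..1} \<times> {0..1}"])
      (use assms in \<open>auto simp: continuous_slice2_def intro!: continuous_intros\<close>)
  then show "continuous_on ({0..1} \<times> {0..1}) (\<lambda>(u, v). G (b', v) (b, u))"
    by (simp add: split_def)
qed

lemma slice_functional_linear:
  assumes "slice_functional L" "continuous_slice f" "continuous_slice g"
  shows "L (\<lambda>x. a * f x + b * g x) = a * L f + b * L g"
  using assms(1)
proof induction
  case (integral r)
  then show ?case
    using integral_slice_lin[of f g r] assms(2,3) by (simp add: continuous_slice_def)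
next
  case (lin L L' c d)
  then show ?case by (simp add: algebra_simps)
qed simp

lemma slice_functional_continuous:
  assumes "slice_functional L" "continuous_slice2 G"
  shows "continuous_slice (\<lambda>y. L (\<lambda>x. G x y))"
  using assms(1)
proof induction
  case (eval x)
  then show ?case using continuous_slice2_left assms(2) by blast
next
  case (integral r)
  show ?case
    unfolding continuous_slice_def
  proof
    fix b
    have "continuous_on ({0..1} \<times> cbox 0 r) (\<lambda>(v, u). G (True, u) (b, v))"
      by (rule continuous_slice2_subset[OF continuous_slice2_flip[OF assms(2)]])
        (use integral in auto)
    from integral_continuous_on_param[OF this]
    show "continuous_on {0..1} (\<lambda>v. integral {0..r} (\<lambda>u. G (True, u) (b, v)))" by simp
  qed
next
  case (lin L L' a b)
  then show ?case by (auto simp: continuous_slice_def intro!: continuous_intros)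
qed

text \<open>Induction on \<open>L\<close> reduces the exchange to Fubini's theorem for two integrals
  of a jointly continuous function.\<close>

lemma slice_functional_swap_integral:
  assumes "slice_functional L" "continuous_slice2 G" "r \<in> {0..1}"
  shows "integral {0..r} (\<lambda>u. L (G (True, u))) = L (\<lambda>y. integral {0..r} (\<lambda>u. G (True, u) y))"
  using assms(1)
proof induction
  case (eval x)
  show ?case by simp
next
  case (integral r')
  have "continuous_on (cbox (0, 0) (r, r')) (\<lambda>(u, v). G (True, u) (True, v))"
    by (rule continuous_slice2_subset[OF assms(2)]) (use assms(3) integral in \<open>auto simp: cbox_Pair_eq\<close>)
  from integral_swap_continuous[OF this] show ?case by simp
next
  case (lin L L' a b)
  have "continuous_slice (\<lambda>x. L (G x))" "continuous_slice (\<lambda>x. L' (G x))"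
    using slice_functional_continuous[OF _ continuous_slice2_flip[OF assms(2)]] lin.hyps by auto
  then show ?case
    using integral_slice_lin[of "\<lambda>x. L (G x)" "\<lambda>x. L' (G x)" r a b] lin.IH assms(3)
    by (simp add: continuous_slice_def)
qed

text \<open>A second induction, now on the outer functional: an evaluation commutes by unfolding, an
  integral is covered by \<open>slice_functional_swap_integral\<close>, and combinations use
  linearity of \<open>L'\<close>.\<close>

lemma slice_functional_swap:
  assumes "slice_functional L" "slice_functional L'" "continuous_slice2 G"
  shows "L (\<lambda>x. L' (G x)) = L' (\<lambda>y. L (\<lambda>x. G x y))"
  using assms(1)
proof induction
  case (integral r)
  then show ?case using slice_functional_swap_integral[OF assms(2,3)] by simp
next
  case (lin L1 L2 a b)
  then show ?case
    using slice_functional_linear[OF assms(2) slice_functional_continuous[OF _ assms(3)]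
        slice_functional_continuous[OF _ assms(3)], of L1 L2 a b] by simp
qed simp

text \<open>For an integral this is the Leibniz rule; evaluations and linear combinations are
  immediate.\<close>

lemma slice_functional_deriv:
  assumes "slice_functional L" "continuous_slice2 G" "continuous_slice2 G'"
    and deriv: "\<And>x v. snd x \<in> {0..1} \<Longrightarrow> v \<in> {0..1} \<Longrightarrow>
      ((\<lambda>v. G x (b, v)) has_real_derivative G' x (b, v)) (at v within {0..1})"
    and v: "v \<in> {0..1}"
  shows "((\<lambda>v. L (\<lambda>x. G x (b, v))) has_real_derivative L (\<lambda>x. G' x (b, v))) (at v within {0..1})"
  using assms(1)
proof induction
  case (eval x)
  then show ?case using deriv v by blast
next
  case (integral r)
  have "((\<lambda>v. integral (cbox 0 r) (\<lambda>u. G (True, u) (b, v))) has_real_derivative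
      integral (cbox 0 r) (\<lambda>u. G' (True, u) (b, v))) (at v within {0..1})"
  proof (rule leibniz_rule_field_derivative)
    show "continuous_on ({0..1} \<times> cbox 0 r) (\<lambda>(v, u). G' (True, u) (b, v))"
      by (rule continuous_slice2_subset[OF continuous_slice2_flip[OF assms(3)]])
        (use integral in auto)
    fix v :: real assume v: "v \<in> {0..1}"
    then have "continuous_on {0..1} (\<lambda>u. G (True, u) (b, v))"
      using continuous_slice2_left[OF continuous_slice2_flip[OF assms(2)], of "(b, v)"]
      by (simp add: continuous_slice_def)
    then show "(\<lambda>u. G (True, u) (b, v)) integrable_on cbox 0 r"
      using integral by (auto intro!: integrable_continuous_interval intro: continuous_on_subset)
    show "((\<lambda>v. G (True, u) (b, v)) has_real_derivative G' (True, u) (b, v)) (at v within {0..1})"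
      if "u \<in> cbox 0 r" for u
      using deriv[of "(True, u)" v] v that integral by auto
  qed (use v in auto)
  then show ?case by simp
next
  case (lin L L' c d)
  then show ?case by (auto intro!: derivative_eq_intros)
qed

text \<open>Covers \<open>s1\<close> and \<open>whitney_proj\<close>. A derivative is not a
  combination of evaluations and integrals, so \<open>d1\<close> has exchange lemmas of its
  own.\<close>

definition slice_map :: "((form_label \<Rightarrow> real) \<Rightarrow> form_label \<Rightarrow> real) \<Rightarrow> bool" where
  "slice_map T \<longleftrightarrow> (\<forall>y. slice_functional (\<lambda>f. T f y))"

lemma slice_map_functional: "slice_map T \<Longrightarrow> slice_functional (\<lambda>f. T f y)"
  unfolding slice_map_def by blast

lemma slice_map_s1: "slice_map s1"
  by (simp add: slice_map_def s1_slice_functional)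

lemma slice_map_whitney_proj: "slice_map whitney_proj"
  by (simp add: slice_map_def whitney_proj_slice_functional)

lemma slice_map_linear: "slice_map T \<Longrightarrow> slice_linear T"
  unfolding slice_linear_def
  by (intro allI impI slice_functional_linear[OF slice_map_functional])
    (simp_all add: continuous_slice_def smooth_slice_continuous)

lemmas s1_slice_linear = slice_map_linear[OF slice_map_s1]
lemmas whitney_proj_slice_linear = slice_map_linear[OF slice_map_whitney_proj]

section \<open>Operators acting on one slot of a form\<close>

definition slot :: "nat \<Rightarrow> (('x \<Rightarrow> real) \<Rightarrow> 'x \<Rightarrow> real) \<Rightarrow> ('x list \<Rightarrow> real) \<Rightarrow> 'x list \<Rightarrow> real" where
  "slot i T F p = T (\<lambda>x. F (p[i := x])) (p ! i)"

definition prefix_sign :: "('x \<Rightarrow> int) \<Rightarrow> nat \<Rightarrow> 'x list \<Rightarrow> real" where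
  "prefix_sign dg i p = (\<Prod>k<i. koszul 1 (dg (p ! k)))"

text \<open>The operator that the Koszul rule assigns to an odd \<open>T\<close> tensored with
  identities in the other slots; the sign counts the odd labels that \<open>T\<close> has to pass.
  For even \<open>T\<close> the unsigned \<open>slot\<close> plays this part.\<close>

definition sslot :: "nat \<Rightarrow> ((form_label \<Rightarrow> real) \<Rightarrow> form_label \<Rightarrow> real)
    \<Rightarrow> (form_label list \<Rightarrow> real) \<Rightarrow> form_label list \<Rightarrow> real" where
  "sslot i T F p = prefix_sign form_deg i p * slot i T F p"

lemma koszul_square: "koszul a b * koszul a b = 1"
  by (simp add: koszul_def)

lemma prefix_sign_square: "prefix_sign dg i p * prefix_sign dg i p = 1"
  unfolding prefix_sign_def by (simp add: prod.distrib[symmetric] koszul_square)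

lemma prefix_sign_update_ge: "i \<le> k \<Longrightarrow> prefix_sign dg i (p[k := x]) = prefix_sign dg i p"
  unfolding prefix_sign_def by (rule prod.cong) auto

text \<open>Label \<open>k\<close> contributes one factor to the prefix; since signs square to 1,
  multiplying by the old factor removes it.\<close>

lemma prefix_sign_update_less:
  assumes "k < i" "k < length p"
  shows "prefix_sign dg i (p[k := x]) = koszul 1 (dg (p ! k)) * prefix_sign dg i p * koszul 1 (dg x)"
proof -
  have "prefix_sign dg i q = koszul 1 (dg (q ! k)) * (\<Prod>l\<in>{..<i} - {k}. koszul 1 (dg (q ! l)))" for q
    unfolding prefix_sign_def using assms(1) by (simp add: prod.remove)
  moreover have "(\<Prod>l\<in>{..<i} - {k}. koszul 1 (dg (p[k := x] ! l))) =
      (\<Prod>l\<in>{..<i} - {k}. koszul 1 (dg (p ! l)))"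
    by (rule prod.cong) auto
  ultimately show ?thesis
    using assms(2) koszul_square[of 1 "dg (p ! k)"] by (simp add: mult.assoc[symmetric])
qed

lemma cube_forms_zero: "F \<in> cube_forms n \<Longrightarrow> map snd p \<notin> cube n \<Longrightarrow> F p = 0"
  unfolding cube_forms_def by blast

lemma cube_forms_zero_length: "F \<in> cube_forms n \<Longrightarrow> length p \<noteq> n \<Longrightarrow> F p = 0"
  by (rule cube_forms_zero) (auto simp: cube_def)

lemma cube_forms_smooth: "F \<in> cube_forms n \<Longrightarrow> length bs = n \<Longrightarrow> cube_smooth n (\<lambda>t. F (zip bs t))"
  unfolding cube_forms_def by blast

lemma cube_forms_lin:
  assumes "F \<in> cube_forms n" "G \<in> cube_forms n"
  shows "(\<lambda>p. a * F p + b * G p) \<in> cube_forms n"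
  using assms cube_smooth_lin[of n "\<lambda>t. F (zip bs t)" "\<lambda>t. G (zip bs t)" a b for bs]
  unfolding cube_forms_def by auto

lemma cube_forms_const0: "(\<lambda>p. 0) \<in> cube_forms n"
  unfolding cube_forms_def by (auto simp: cube_smooth_const)

lemma zip_fst_snd_update:
  "p[i := (b, u)] = zip ((map fst p)[i := b]) ((map snd p)[i := u])"
  by (metis fst_conv snd_conv update_zip zip_map_fst_snd)

text \<open>Derivatives of the coefficients are chosen separately for each pattern of bits and
  glued, with value 0 off the cube. Unlike \<open>d1\<close>, this derivative leaves the bit of
  label \<open>j\<close> unchanged.\<close>

lemma cube_forms_partial_deriv:
  assumes F: "F \<in> cube_forms n" and j: "j < n"
  shows "\<exists>F'\<in>cube_forms n. \<forall>p. map snd p \<in> cube n \<longrightarrow>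
     ((\<lambda>u. F (p[j := (fst (p ! j), u)])) has_real_derivative F' p) (at (snd (p ! j)) within {0..1})"
proof -
  define h where "h bs = (SOME h. cube_smooth n h \<and> partial_deriv n j (\<lambda>t. F (zip bs t)) h)" for bs
  have h: "cube_smooth n (h bs) \<and> partial_deriv n j (\<lambda>t. F (zip bs t)) (h bs)"
    if "length bs = n" for bs
    unfolding h_def using cube_smooth_partial_deriv[OF cube_forms_smooth[OF F that] j] by (rule someI_ex)
  define F' where "F' p = (if map snd p \<in> cube n then h (map fst p) (map snd p) else 0)" for p
  have "F' \<in> cube_forms n"
    unfolding cube_forms_def
  proof (intro CollectI conjI allI impI)
    show "F' p = 0" if "map snd p \<notin> cube n" for p using that by (simp add: F'_def)
    fix bs :: "bool list" assume bs: "length bs = n"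
    show "cube_smooth n (\<lambda>t. F' (zip bs t))"
      by (rule cube_smooth_cong[of n "h bs"]) (use h[OF bs] bs in \<open>auto simp: F'_def cube_length\<close>)
  qed
  moreover have "((\<lambda>u. F (p[j := (fst (p ! j), u)])) has_real_derivative F' p)
      (at (snd (p ! j)) within {0..1})" if p: "map snd p \<in> cube n" for p
  proof -
    have len: "length p = n" using cube_length[OF p] by simp
    then have "((\<lambda>u. F (zip (map fst p) ((map snd p)[j := u]))) has_real_derivative
        h (map fst p) (map snd p)) (at (map snd p ! j) within {0..1})"
      using h[of "map fst p"] p unfolding partial_deriv_def by simp
    moreover have "(map fst p)[j := fst (p ! j)] = map fst p"
      using j len by (metis list_update_id map_update)
    ultimately show ?thesis using p j len by (simp add: F'_def zip_fst_snd_update)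
  qed
  ultimately show ?thesis by blast
qed

lemma cube_forms_continuous_on:
  assumes F: "F \<in> cube_forms n"
    and g: "\<And>z. z \<in> X \<Longrightarrow> map fst (g z) = bs" "\<And>z. z \<in> X \<Longrightarrow> map snd (g z) \<in> cube n"
    and cont: "\<And>i. i < n \<Longrightarrow> continuous_on X (\<lambda>z. snd (g z ! i))"
  shows "continuous_on X (\<lambda>z. F (g z))"
\<comment> \<open>The length of \<open>bs\<close> can only be read off from a point of
  \<open>X\<close>.\<close>
proof (cases "X = {}")
  case False
  have len: "length (g z) = n" if "z \<in> X" for z
    using cube_length[OF g(2)[OF that]] by simp
  with False g(1) have bs: "length bs = n" by fastforce
  have "continuous_on X (\<lambda>z. F (zip bs (map snd (g z))))"
    by (rule cube_continuous_on_compose[OF cube_smooth_continuous[OF cube_forms_smooth[OF F bs]] g(2)])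
      (use cont len in \<open>simp_all cong: continuous_on_cong\<close>)
  moreover have "zip bs (map snd (g z)) = g z" if "z \<in> X" for z
    using g(1)[OF that] by (metis zip_map_fst_snd)
  ultimately show ?thesis by (simp cong: continuous_on_cong)
qed simp

lemma map_snd_update_cube:
  assumes "length p = n" "i < n" "\<And>k. k < n \<Longrightarrow> k \<noteq> i \<Longrightarrow> snd (p ! k) \<in> {0..1}" "snd x \<in> {0..1}"
  shows "map snd (p[i := x]) \<in> cube n"
  using assms by (intro cubeI) (auto simp: nth_list_update)

lemma map_snd_cubeD: "map snd p \<in> cube n \<Longrightarrow> k < n \<Longrightarrow> snd (p ! k) \<in> {0..1}"
  using cube_nth[of "map snd p" n k] cube_length[of "map snd p" n] by simp

lemma cube_forms_slice:
  assumes F: "F \<in> cube_forms n" and i: "i < n"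
  shows "smooth_slice (\<lambda>x. F (p[i := x]))"
\<comment> \<open>Label \<open>i\<close> gets overwritten, so the other labels decide whether the
  slice meets the cube at all; if it does not, the slice is identically zero.\<close>
proof (cases "length p = n \<and> (\<forall>k<n. k \<noteq> i \<longrightarrow> snd (p ! k) \<in> {0..1})")
  case True
  then have p: "map snd (p[i := x]) \<in> cube n" if "snd x \<in> {0..1}" for x
    using map_snd_update_cube i that by blast
  obtain F' where F': "F' \<in> cube_forms n" "\<And>p. map snd p \<in> cube n \<Longrightarrow>
     ((\<lambda>u. F (p[i := (fst (p ! i), u)])) has_real_derivative F' p) (at (snd (p ! i)) within {0..1})"
    using cube_forms_partial_deriv[OF F i] by blast
  have "continuous_on {0..1} (\<lambda>u. F' (p[i := (b, u)]))" for b
  proof (rule cube_forms_continuous_on[OF F'(1), where bs = "(map fst p)[i := b]"])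
    show "continuous_on {0..1} (\<lambda>u. snd (p[i := (b, u)] ! k))" for k
      using i True by (cases "k = i") simp_all
  qed (use p[of "(b, _)"] in \<open>simp_all add: map_update\<close>)
  moreover have "((\<lambda>u. F (p[i := (b, u)])) has_real_derivative F' (p[i := (b, t)])) (at t within {0..1})"
    if "t \<in> {0..1}" for b t
    using F'(2)[OF p[of "(b, t)"]] that True i by simp
  moreover have "F (p[i := (b, t)]) = 0" if "t \<notin> {0..1}" for b t
    using that True i map_snd_cubeD[of "p[i := (b, t)]" n i] by (intro cube_forms_zero[OF F]) auto
  ultimately show ?thesis
    unfolding smooth_slice_def by (intro conjI exI[of _ "\<lambda>x. F' (p[i := x])"]) auto
next
  case False
  have "F (p[i := x]) = 0" for x
  proof (cases "length p = n")
    case True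
    with False obtain k where "k < n" "k \<noteq> i" "snd (p ! k) \<notin> {0..1}" by blast
    then show ?thesis
      using map_snd_cubeD[of "p[i := x]" n k] by (intro cube_forms_zero[OF F]) auto
  qed (simp add: cube_forms_zero_length[OF F])
  then show ?thesis by (simp add: smooth_slice_0)
qed

lemma map_snd_update2_cube:
  assumes "length p = n" "i < n" "j < n" "\<And>k. k < n \<Longrightarrow> k \<noteq> i \<Longrightarrow> k \<noteq> j \<Longrightarrow> snd (p ! k) \<in> {0..1}"
    "snd x \<in> {0..1}" "snd y \<in> {0..1}"
  shows "map snd (p[i := x, j := y]) \<in> cube n"
  using assms by (intro cubeI) (auto simp: nth_list_update)

lemma cube_forms_continuous_slice2:
  assumes F: "F \<in> cube_forms n" and ij: "i < n" "j < n" "i \<noteq> j"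
  shows "continuous_slice2 (\<lambda>x y. F (p[i := x, j := y]))"
proof (cases "length p = n \<and> (\<forall>k<n. k \<noteq> i \<longrightarrow> k \<noteq> j \<longrightarrow> snd (p ! k) \<in> {0..1})")
  case True
  then have p: "map snd (p[i := x, j := y]) \<in> cube n" if "snd x \<in> {0..1}" "snd y \<in> {0..1}" for x y
    using map_snd_update2_cube ij that by blast
  have "continuous_on ({0..1} \<times> {0..1}) (\<lambda>z. F (p[i := (b, fst z), j := (b', snd z)]))" for b b'
  proof (rule cube_forms_continuous_on[OF F, where bs = "(map fst p)[i := b, j := b']"])
    show "continuous_on ({0..1} \<times> {0..1}) (\<lambda>z. snd (p[i := (b, fst z), j := (b', snd z)] ! k))" for k
      using ij True by (cases "k = j"; cases "k = i") (auto intro: continuous_intros)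
  qed (use p[of "(b, _)" "(b', _)"] in \<open>auto simp: map_update\<close>)
  then show ?thesis by (simp add: continuous_slice2_def split_def)
next
  case False
  have "F (p[i := x, j := y]) = 0" for x y
  proof (cases "length p = n")
    case True
    with False obtain k where "k < n" "k \<noteq> i" "k \<noteq> j" "snd (p ! k) \<notin> {0..1}" by blast
    then show ?thesis
      using map_snd_cubeD[of "p[i := x, j := y]" n k] by (intro cube_forms_zero[OF F]) auto
  qed (simp add: cube_forms_zero_length[OF F])
  then show ?thesis by (simp add: continuous_slice2_def)
qed

section \<open>Exchange of operators acting in different slots\<close>

lemma slot_swap:
  assumes T: "slice_map T" "slice_map T'"
    and F: "F \<in> cube_forms n" and ij: "i < n" "j < n" "i \<noteq> j"
  shows "slot i T (slot j T' F) p = slot j T' (slot i T F) p"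
  using slice_functional_swap[OF slice_map_functional[OF T(1), of "p ! i"]
      slice_map_functional[OF T(2), of "p ! j"] cube_forms_continuous_slice2[OF F ij, of p]] ij
  by (simp add: slot_def list_update_swap[of i j])

lemma slot_swap_d1:
  assumes T: "slice_map T"
    and F: "F \<in> cube_forms n" and ij: "i < n" "j < n" "i \<noteq> j" and len: "length p = n"
  shows "slot i T (slot j d1 F) p = slot j d1 (slot i T F) p"
proof -
  let ?G = "\<lambda>x y. F (p[i := x, j := y])"
  obtain F' where F': "F' \<in> cube_forms n" "\<And>p. map snd p \<in> cube n \<Longrightarrow>
     ((\<lambda>u. F (p[j := (fst (p ! j), u)])) has_real_derivative F' p) (at (snd (p ! j)) within {0..1})"
    using cube_forms_partial_deriv[OF F ij(2)] by blast
  let ?G' = "\<lambda>x y. F' (p[i := x, j := y])"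
  have LR: "slot i T (slot j d1 F) p = T (\<lambda>x. d1 (?G x) (p ! j)) (p ! i)"
    "slot j d1 (slot i T F) p = d1 (\<lambda>y. T (\<lambda>x. ?G x y) (p ! i)) (p ! j)"
    using ij by (simp_all add: slot_def list_update_swap[of i j])
  show ?thesis
  proof (cases "fst (p ! j) \<and> snd (p ! j) \<in> {0..1}")
    case True
    then obtain v where v: "p ! j = (True, v)" "v \<in> {0..1}" by (cases "p ! j") auto
    have deriv: "((\<lambda>v. ?G x (b, v)) has_real_derivative ?G' x (b, v)) (at v within {0..1})"
      if "v \<in> {0..1}" for x b v
    proof (cases "map snd (p[i := x, j := (b, v)]) \<in> cube n")
      case True
      then show ?thesis using F'(2)[OF True] ij len by simp
    next
      case False
      \<comment> \<open>As \<open>v\<close> lies in the interval, the point leaves the cube through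
        another coordinate. This persists for every \<open>u\<close>, so \<open>?G\<close> vanishes
        along the line and its derivative is 0, in agreement with \<open>F'\<close> off the
        cube.\<close>
      have "map snd (p[i := x, j := (b, u)]) \<notin> cube n" if "u \<in> {0..1}" for u
        using False cube_update[OF _ \<open>v \<in> {0..1}\<close>, of "map snd (p[i := x, j := (b, u)])" n j]
        by (auto simp: map_update)
      then have "?G x (b, u) = 0" if "u \<in> {0..1}" for u
        using cube_forms_zero[OF F] that by blast
      then have "((\<lambda>v. ?G x (b, v)) has_real_derivative 0) (at v within {0..1})"
        using that
        by (intro has_field_derivative_transform_within[OF DERIV_const zero_less_one, of _ _ 0]) auto
      then show ?thesis using cube_forms_zero[OF F'(1) False] by simp
    qed
    have "T (\<lambda>x. d1 (?G x) (True, v)) (p ! i) = T (\<lambda>x. ?G' x (False, v)) (p ! i)"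
      using d1_eq[OF deriv[OF v(2)] v(2)] by simp
    moreover have "d1 (\<lambda>y. T (\<lambda>x. ?G x y) (p ! i)) (True, v) = T (\<lambda>x. ?G' x (False, v)) (p ! i)"
      by (intro d1_eq slice_functional_deriv[OF slice_map_functional[OF T] cube_forms_continuous_slice2[OF F ij]
            cube_forms_continuous_slice2[OF F'(1) ij] deriv v(2)] v(2))
    ultimately show ?thesis using LR v by simp
  next
    case False
    then show ?thesis
      using LR slice_linear_0[OF slice_map_linear[OF T]] by (simp add: d1_eq_0)
  qed
qed

section \<open>One-slot operators preserve smooth forms\<close>

lemma slot_zip:
  "length bs = n \<Longrightarrow> t \<in> cube n \<Longrightarrow> i < n \<Longrightarrow>
    slot i T F (zip bs t) = T (\<lambda>x. F (zip (bs[i := fst x]) (t[i := snd x]))) (bs ! i, t ! i)"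
  by (simp add: slot_def update_zip cube_length)

lemma slot_cube_forms:
  assumes F: "F \<in> cube_forms n" and i: "i < n"
    and T: "\<And>y. T (\<lambda>x. 0) y = 0" "\<And>f y. snd y \<notin> {0..1} \<Longrightarrow> T f y = 0"
    and smooth: "\<And>bs. length bs = n \<Longrightarrow> cube_smooth n (\<lambda>t. slot i T F (zip bs t))"
  shows "slot i T F \<in> cube_forms n"
  unfolding cube_forms_def
proof (intro CollectI conjI allI impI smooth)
  fix p :: "form_label list" assume p: "map snd p \<notin> cube n"
  show "slot i T F p = 0"
  proof (cases "length p = n \<and> snd (p ! i) \<in> {0..1}")
    case True
    \<comment> \<open>Slot \<open>i\<close> lies in the interval, so another coordinate is to blame
      and the whole slice of \<open>F\<close> is zero.\<close>
    have "map snd (p[i := x]) \<notin> cube n" for x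
    proof
      assume "map snd (p[i := x]) \<in> cube n"
      then have "(map snd (p[i := x]))[i := snd (p ! i)] \<in> cube n"
        using True cube_update by blast
      moreover have "(map snd (p[i := x]))[i := snd (p ! i)] = map snd p"
        using True i by (metis list_update_id list_update_overwrite map_update)
      ultimately show False using p by simp
    qed
    then have "F (p[i := x]) = 0" for x using cube_forms_zero[OF F] by blast
    then show ?thesis by (simp add: slot_def T(1))
  next
    case False
    then show ?thesis
      using cube_forms_zero_length[OF F, of "p[i := x]" for x]
      by (cases "length p = n") (simp_all add: slot_def T)
  qed
qed

lemma slot_whitney_proj_forms:
  assumes F: "F \<in> cube_forms n" and i: "i < n"
  shows "slot i whitney_proj F \<in> cube_forms n"
proof (rule slot_cube_forms[OF F i])
  show "whitney_proj (\<lambda>x. 0) y = 0" for y by (rule slice_linear_0[OF whitney_proj_slice_linear])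
  show "whitney_proj f y = 0" if "snd y \<notin> {0..1}" for f y using that by (cases y) (auto simp: whitney_proj_def W1_def)
  fix bs :: "bool list" assume bs: "length bs = n"
  let ?f = "\<lambda>t. F (zip bs t)"
  note f = cube_forms_smooth[OF F bs]
  show "cube_smooth n (\<lambda>t. slot i whitney_proj F (zip bs t))"
  proof (cases "bs ! i")
    case True
    then have "bs[i := True] = bs" using list_update_id[of bs i] by simp
    then have "integral_upto i ?f (t[i := 1]) = slot i whitney_proj F (zip bs t)" if "t \<in> cube n" for t
      using that bs i True cube_nth[OF that i]
      by (simp add: slot_zip[OF bs] whitney_proj_def W1_def integral_upto_def cube_length)
    then show ?thesis
      by (rule cube_smooth_cong[OF cube_smooth_eval[OF cube_smooth_integral_upto[OF f i] i], rotated]) auto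
  next
    case False
    then have b: "bs[i := False] = bs" using list_update_id[of bs i] by simp
    \<comment> \<open>Linear interpolation between the two faces, written with explicit coefficients
      as the face value at 0 plus \<open>t ! i\<close> times the difference, so that the closure
      lemmas match.\<close>
    let ?g = "\<lambda>t. 1 * ?f (t[i := 0]) + 1 * (t ! i * (1 * ?f (t[i := 1]) + (-1) * ?f (t[i := 0])))"
    have "cube_smooth n ?g"
      using i by (intro cube_smooth_lin cube_smooth_mult_coord cube_smooth_eval[OF f]) auto
    moreover have "?g t = slot i whitney_proj F (zip bs t)" if "t \<in> cube n" for t
      using that b bs i False cube_nth[OF that i]
      by (simp add: slot_zip[OF bs] whitney_proj_def W1_def algebra_simps)
    ultimately show ?thesis by (rule cube_smooth_cong)
  qed
qed

lemma slot_s1_forms: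
  assumes F: "F \<in> cube_forms n" and i: "i < n"
  shows "slot i s1 F \<in> cube_forms n"
proof (rule slot_cube_forms[OF F i])
  show "s1 (\<lambda>x. 0) y = 0" for y by (rule slice_linear_0[OF s1_slice_linear])
  show "s1 f y = 0" if "snd y \<notin> {0..1}" for f y using that by (cases y) (auto simp: s1_def)
  fix bs :: "bool list" assume bs: "length bs = n"
  \<comment> \<open>The contraction reads the coefficient that contains \<open>dt\<close> in
    coordinate \<open>i\<close>, whatever the bit of the output label.\<close>
  let ?f = "\<lambda>t. F (zip (bs[i := True]) t)"
  have f: "cube_smooth n ?f" using cube_forms_smooth[OF F] bs by simp
  show "cube_smooth n (\<lambda>t. slot i s1 F (zip bs t))"
  proof (cases "bs ! i")
    case True
    then have "slot i s1 F (zip bs t) = 0" if "t \<in> cube n" for t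
      using that bs i by (simp add: slot_zip[OF bs] s1_def)
    then show ?thesis by (intro cube_smooth_cong[OF cube_smooth_const[of n 0]]) simp
  next
    case False
    let ?g = "\<lambda>t. 1 * integral_upto i ?f t + (-1) * (t ! i * integral_upto i ?f (t[i := 1]))"
    have "cube_smooth n ?g"
      using i by (intro cube_smooth_lin cube_smooth_mult_coord cube_smooth_eval
          cube_smooth_integral_upto f) auto
    moreover have "?g t = slot i s1 F (zip bs t)" if "t \<in> cube n" for t
      using that bs i False cube_nth[OF that i]
      by (simp add: slot_zip[OF bs] s1_def integral_upto_def cube_length)
    ultimately show ?thesis by (rule cube_smooth_cong)
  qed
qed

lemma slot_d1_forms:
  assumes F: "F \<in> cube_forms n" and i: "i < n"
  shows "slot i d1 F \<in> cube_forms n"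
proof (rule slot_cube_forms[OF F i])
  show "d1 (\<lambda>x. 0) y = 0" for y by (rule slice_linear_0[OF d1_slice_linear])
  show "d1 f y = 0" if "snd y \<notin> {0..1}" for f y using that by (simp add: d1_eq_0)
  fix bs :: "bool list" assume bs: "length bs = n"
  let ?f = "\<lambda>t. F (zip (bs[i := False]) t)"
  have "cube_smooth n ?f" using cube_forms_smooth[OF F] bs by simp
  then obtain h where h: "cube_smooth n h" "partial_deriv n i ?f h"
    using cube_smooth_partial_deriv i by blast
  show "cube_smooth n (\<lambda>t. slot i d1 F (zip bs t))"
  proof (cases "bs ! i")
    case True
    have "h t = slot i d1 F (zip bs t)" if "t \<in> cube n" for t
      using h(2) that True cube_nth[OF that i]
      by (subst slot_zip[OF bs that i], simp only: True)
        (rule d1_eq[symmetric], auto simp: partial_deriv_def)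
    with h(1) show ?thesis by (rule cube_smooth_cong)
  next
    case False
    then have "slot i d1 F (zip bs t) = 0" if "t \<in> cube n" for t
      using that bs i by (simp add: slot_zip[OF bs] d1_eq_0)
    then show ?thesis by (intro cube_smooth_cong[OF cube_smooth_const[of n 0]]) simp
  qed
qed

section \<open>Koszul signs of one-slot operators\<close>

lemma prefix_sign_forms:
  assumes F: "F \<in> cube_forms n" and i: "i < n"
  shows "(\<lambda>p. prefix_sign form_deg i p * F p) \<in> cube_forms n"
  unfolding cube_forms_def
proof (intro CollectI conjI allI impI)
  show "prefix_sign form_deg i p * F p = 0" if "map snd p \<notin> cube n" for p
    using cube_forms_zero[OF F that] by simp
  fix bs :: "bool list" assume bs: "length bs = n"
  \<comment> \<open>For a fixed pattern of bits the sign is a constant on the cube; the summand with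
    factor 0 below gives the product the shape of \<open>cube_smooth_lin\<close>.\<close>
  let ?c = "\<Prod>k<i. koszul 1 (if bs ! k then 1 else 0)"
  have "cube_smooth n (\<lambda>t. ?c * F (zip bs t) + 0 * F (zip bs t))"
    by (intro cube_smooth_lin cube_forms_smooth[OF F bs])
  moreover have "prefix_sign form_deg i (zip bs t) = ?c" if "t \<in> cube n" for t
    unfolding prefix_sign_def using bs i that
    by (intro prod.cong) (auto simp: form_deg_def cube_length)
  ultimately show "cube_smooth n (\<lambda>t. prefix_sign form_deg i (zip bs t) * F (zip bs t))"
    by (elim cube_smooth_cong) simp
qed

lemma sslot_forms: "slot i T F \<in> cube_forms n \<Longrightarrow> i < n \<Longrightarrow> sslot i T F \<in> cube_forms n"
  using prefix_sign_forms unfolding sslot_def[abs_def] by simp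

text \<open>Odd degree is encoded as anticommutation with the grading involution, the form in which
  it is used when an operator crosses the prefix sign of a later slot.\<close>

definition odd_map :: "((form_label \<Rightarrow> real) \<Rightarrow> form_label \<Rightarrow> real) \<Rightarrow> bool" where
  "odd_map T \<longleftrightarrow> slice_linear T \<and>
     (\<forall>f y. T (\<lambda>x. koszul 1 (form_deg x) * f x) y = - koszul 1 (form_deg y) * T f y)"

lemma odd_map_linear: "odd_map T \<Longrightarrow> slice_linear T"
  by (simp add: odd_map_def)

lemma odd_map_sign:
  "odd_map T \<Longrightarrow> T (\<lambda>x. koszul 1 (form_deg x) * f x) y = - koszul 1 (form_deg y) * T f y"
  unfolding odd_map_def by blast

lemma koszul_form_deg: "koszul 1 (form_deg (b, t)) = (if b then -1 else 1)"
  by (simp add: koszul_def form_deg_def)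

lemma odd_map_s1: "odd_map s1"
  unfolding odd_map_def using s1_slice_linear
  by (auto simp: s1_def koszul_form_deg)

lemma odd_map_d1: "odd_map d1"
  unfolding odd_map_def using d1_slice_linear
  by (auto simp: d1_def koszul_form_deg)

lemma even_map_whitney_proj: "whitney_proj (\<lambda>x. koszul 1 (form_deg x) * f x) y = koszul 1 (form_deg y) * whitney_proj f y"
  by (cases y) (auto simp: whitney_proj_def W1_def koszul_form_deg)

lemma slot_lin:
  assumes "slice_linear T" "F \<in> cube_forms n" "G \<in> cube_forms n" "i < n"
  shows "slot i T (\<lambda>p. a * F p + b * G p) p = a * slot i T F p + b * slot i T G p"
  using assms cube_forms_slice unfolding slot_def slice_linear_def by blast

lemma sslot_lin:
  assumes "slice_linear T" "F \<in> cube_forms n" "G \<in> cube_forms n" "i < n"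
  shows "sslot i T (\<lambda>p. a * F p + b * G p) p = a * sslot i T F p + b * sslot i T G p"
  unfolding sslot_def slot_lin[OF assms] by (simp add: algebra_simps)

text \<open>Proportionality is demanded only along the slice through \<open>p\<close>, since a
  prefix sign is constant on such a slice but not globally.\<close>

lemma slot_scale:
  assumes "slice_linear T" "F \<in> cube_forms n" "i < n" "\<And>x. F' (p[i := x]) = c * F (p[i := x])"
  shows "slot i T F' p = c * slot i T F p"
  unfolding slot_def assms(4)
  by (rule slice_linear_scale[OF assms(1) cube_forms_slice[OF assms(2,3)]])

text \<open>Changing slot \<open>i\<close> leaves the labels before it alone, so both operators
  carry the same prefix sign and the two cancel. Compositions in one slot thus become compositions
  on the interval.\<close>

lemma sslot_same:
  assumes U: "slice_linear U" and VF: "slot i V F \<in> cube_forms n" and i: "i < n"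
    and len: "length p = n"
  shows "sslot i U (sslot i V F) p = U (V (\<lambda>x. F (p[i := x]))) (p ! i)"
proof -
  have "slot i U (sslot i V F) p = prefix_sign form_deg i p * slot i U (slot i V F) p"
    by (rule slot_scale[OF U VF i]) (simp add: sslot_def prefix_sign_update_ge)
  moreover have "slot i U (slot i V F) p = U (V (\<lambda>x. F (p[i := x]))) (p ! i)"
    using len i by (simp add: slot_def)
  ultimately show ?thesis
    using prefix_sign_square[of form_deg i p] by (simp add: sslot_def mult.assoc[symmetric])
qed

text \<open>The prefix of \<open>j\<close> contains slot \<open>i\<close>, so \<open>U\<close> has
  to cross the grading sign of its own label, which costs a minus sign by oddness. The prefix of
  \<open>i\<close> does not see slot \<open>j\<close>, so the other order costs nothing.\<close>

lemma sslot_anticommute_less: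
  assumes U: "odd_map U" and V: "odd_map V" and ij: "i < j" "j < n"
    and VF: "slot j V F \<in> cube_forms n" and UF: "slot i U F \<in> cube_forms n"
    and swap: "slot i U (slot j V F) p = slot j V (slot i U F) p" and len: "length p = n"
  shows "sslot i U (sslot j V F) p = - sslot j V (sslot i U F) p"
proof -
  let ?H = "slot j V F" and ?k = "koszul 1 (form_deg (p ! i))" and ?sj = "prefix_sign form_deg j p"
  have sm: "smooth_slice (\<lambda>x. ?H (p[i := x]))"
    using cube_forms_slice[OF VF] ij by simp
  \<comment> \<open>The factor \<open>?k\<close> cancels the sign of the old label
    \<open>p ! i\<close>, leaving the sign of the new label \<open>x\<close> for \<open>U\<close> to
    cross.\<close>
  have "slot i U (sslot j V F) p = U (\<lambda>x. koszul 1 (form_deg x) * (?k * ?sj * ?H (p[i := x]))) (p ! i)"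
    using ij len by (simp add: slot_def[of i] sslot_def prefix_sign_update_less mult_ac)
  also have "\<dots> = - ?k * U (\<lambda>x. ?k * ?sj * ?H (p[i := x])) (p ! i)"
    by (rule odd_map_sign[OF U])
  also have "U (\<lambda>x. ?k * ?sj * ?H (p[i := x])) (p ! i) = ?k * ?sj * slot i U ?H p"
    unfolding slot_def[of i] by (rule slice_linear_scale[OF odd_map_linear[OF U] sm])
  finally have 1: "slot i U (sslot j V F) p = - ?sj * slot i U ?H p"
    using koszul_square[of 1 "form_deg (p ! i)"] by (simp add: mult.assoc[symmetric])
  have "slot j V (sslot i U F) p = prefix_sign form_deg i p * slot j V (slot i U F) p"
    using V ij by (intro slot_scale[OF _ UF]) (auto simp: odd_map_def sslot_def prefix_sign_update_ge)
  then show ?thesis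
    using 1 swap by (simp add: sslot_def)
qed

lemma sslot_anticommute:
  assumes "odd_map U" "odd_map V" "i < n" "j < n" "i \<noteq> j"
    and "slot j V F \<in> cube_forms n" "slot i U F \<in> cube_forms n"
    and "slot i U (slot j V F) p = slot j V (slot i U F) p" and "length p = n"
  shows "sslot i U (sslot j V F) p = - sslot j V (sslot i U F) p"
proof (cases "i < j")
  case True
  then show ?thesis using assms sslot_anticommute_less by blast
next
  case False
  then show ?thesis
    using sslot_anticommute_less[OF assms(2,1), of j i n F p] assms by simp
qed

text \<open>Either the prefix of \<open>i\<close> does not contain slot \<open>j\<close>, or the
  even operator crosses the grading sign of slot \<open>j\<close> unchanged.\<close>

lemma sslot_slot_commute:
  assumes U: "odd_map U" and ij: "i < n" "j < n" "i \<noteq> j"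
    and F: "F \<in> cube_forms n" and UF: "slot i U F \<in> cube_forms n"
    and swap: "slot i U (slot j whitney_proj F) p = slot j whitney_proj (slot i U F) p"
    and len: "length p = n"
  shows "sslot i U (slot j whitney_proj F) p = slot j whitney_proj (sslot i U F) p"
proof (cases "i < j")
  case True
  have "slot j whitney_proj (sslot i U F) p = prefix_sign form_deg i p * slot j whitney_proj (slot i U F) p"
    using ij True
    by (intro slot_scale[OF whitney_proj_slice_linear UF]) (auto simp: sslot_def prefix_sign_update_ge)
  then show ?thesis using swap by (simp add: sslot_def)
next
  case False
  let ?H = "slot i U F" and ?k = "koszul 1 (form_deg (p ! j))" and ?si = "prefix_sign form_deg i p"
  have "slot j whitney_proj (sslot i U F) p =
      whitney_proj (\<lambda>x. koszul 1 (form_deg x) * (?k * ?si * ?H (p[j := x]))) (p ! j)"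
    using ij len False by (simp add: slot_def[of j] sslot_def prefix_sign_update_less mult_ac)
  also have "\<dots> = ?k * whitney_proj (\<lambda>x. ?k * ?si * ?H (p[j := x])) (p ! j)"
    by (rule even_map_whitney_proj)
  also have "whitney_proj (\<lambda>x. ?k * ?si * ?H (p[j := x])) (p ! j) = ?k * ?si * slot j whitney_proj ?H p"
    unfolding slot_def[of j]
    by (rule slice_linear_scale[OF whitney_proj_slice_linear cube_forms_slice[OF UF ij(2)]])
  finally have "slot j whitney_proj (sslot i U F) p = ?si * slot j whitney_proj ?H p"
    using koszul_square[of 1 "form_deg (p ! j)"] by (simp add: mult.assoc[symmetric])
  then show ?thesis
    unfolding sslot_def[of i U "slot j whitney_proj F" p] swap by simp
qed

section \<open>The algebra of one-slot operators\<close>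

text \<open>The relations from which the homotopy identities follow by algebra alone. Relations at
  equal indices are interval identities, those at distinct indices are Koszul commutations.
  \<open>S_S\<close> includes the case \<open>i = j\<close>, where it says that the square of
  \<open>S i\<close> is zero; \<open>D_P\<close> includes it because the projection is a cochain
  map.\<close>

locale slot_algebra =
  fixes n :: nat and A :: "('p \<Rightarrow> real) set"
    and D S P :: "nat \<Rightarrow> ('p \<Rightarrow> real) \<Rightarrow> 'p \<Rightarrow> real"
  assumes zero_closed: "(\<lambda>p. 0) \<in> A"
    and lin_closed: "F \<in> A \<Longrightarrow> G \<in> A \<Longrightarrow> (\<lambda>p. a * F p + b * G p) \<in> A"
    and D_closed: "i < n \<Longrightarrow> F \<in> A \<Longrightarrow> D i F \<in> A"
    and S_closed: "i < n \<Longrightarrow> F \<in> A \<Longrightarrow> S i F \<in> A"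
    and P_closed: "i < n \<Longrightarrow> F \<in> A \<Longrightarrow> P i F \<in> A"
    and D_lin: "i < n \<Longrightarrow> F \<in> A \<Longrightarrow> G \<in> A \<Longrightarrow>
      D i (\<lambda>p. a * F p + b * G p) = (\<lambda>p. a * D i F p + b * D i G p)"
    and S_lin: "i < n \<Longrightarrow> F \<in> A \<Longrightarrow> G \<in> A \<Longrightarrow>
      S i (\<lambda>p. a * F p + b * G p) = (\<lambda>p. a * S i F p + b * S i G p)"
    and P_lin: "i < n \<Longrightarrow> F \<in> A \<Longrightarrow> G \<in> A \<Longrightarrow>
      P i (\<lambda>p. a * F p + b * G p) = (\<lambda>p. a * P i F p + b * P i G p)"
    and P_P: "i < n \<Longrightarrow> j < n \<Longrightarrow> F \<in> A \<Longrightarrow> P i (P j F) = P j (P i F)"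
    and P_idem: "i < n \<Longrightarrow> F \<in> A \<Longrightarrow> P i (P i F) = P i F"
    and D_P: "i < n \<Longrightarrow> j < n \<Longrightarrow> F \<in> A \<Longrightarrow> D i (P j F) = P j (D i F)"
    and S_P: "i < n \<Longrightarrow> j < n \<Longrightarrow> i \<noteq> j \<Longrightarrow> F \<in> A \<Longrightarrow> S i (P j F) = P j (S i F)"
    and S_P_same: "i < n \<Longrightarrow> F \<in> A \<Longrightarrow> S i (P i F) = (\<lambda>p. 0)"
    and P_S_same: "i < n \<Longrightarrow> F \<in> A \<Longrightarrow> P i (S i F) = (\<lambda>p. 0)"
    and S_S: "i < n \<Longrightarrow> j < n \<Longrightarrow> F \<in> A \<Longrightarrow> S i (S j F) = (\<lambda>p. - S j (S i F) p)"
    and D_S: "i < n \<Longrightarrow> j < n \<Longrightarrow> i \<noteq> j \<Longrightarrow> F \<in> A \<Longrightarrow> D i (S j F) = (\<lambda>p. - S j (D i F) p)"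
    and D_S_same: "i < n \<Longrightarrow> F \<in> A \<Longrightarrow> D i (S i F) p + S i (D i F) p = F p - P i F p"
begin

definition lin_op :: "(('p \<Rightarrow> real) \<Rightarrow> 'p \<Rightarrow> real) \<Rightarrow> bool" where
  "lin_op T \<longleftrightarrow> (\<forall>F\<in>A. T F \<in> A) \<and>
     (\<forall>F\<in>A. \<forall>G\<in>A. \<forall>a b. T (\<lambda>p. a * F p + b * G p) = (\<lambda>p. a * T F p + b * T G p))"

lemma lin_op_closed: "lin_op T \<Longrightarrow> F \<in> A \<Longrightarrow> T F \<in> A"
  unfolding lin_op_def by blast

lemma lin_op_lin:
  "lin_op T \<Longrightarrow> F \<in> A \<Longrightarrow> G \<in> A \<Longrightarrow> T (\<lambda>p. a * F p + b * G p) = (\<lambda>p. a * T F p + b * T G p)"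
  unfolding lin_op_def by blast

lemma lin_op_scale: "lin_op T \<Longrightarrow> F \<in> A \<Longrightarrow> T (\<lambda>p. a * F p) = (\<lambda>p. a * T F p)"
  using lin_op_lin[of T F F a 0] by simp

lemma lin_op_zero: "lin_op T \<Longrightarrow> T (\<lambda>p. 0) = (\<lambda>p. 0)"
  using lin_op_scale[of T "\<lambda>p. 0" 0] zero_closed by simp

lemma scale_closed: "F \<in> A \<Longrightarrow> (\<lambda>p. a * F p) \<in> A"
  using lin_closed[of F F a 0] by simp

lemma sum_closed:
  assumes "finite K" "\<And>k. k \<in> K \<Longrightarrow> F k \<in> A"
  shows "(\<lambda>p. \<Sum>k\<in>K. F k p) \<in> A"
  using assms
proof (induction K)
  case (insert k K)
  then show ?case using lin_closed[of "F k" "\<lambda>p. \<Sum>k\<in>K. F k p" 1 1] by simp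
qed (simp add: zero_closed)

lemma lin_op_sum:
  assumes T: "lin_op T" and "finite K" "\<And>k. k \<in> K \<Longrightarrow> F k \<in> A"
  shows "T (\<lambda>p. \<Sum>k\<in>K. F k p) = (\<lambda>p. \<Sum>k\<in>K. T (F k) p)"
  using assms(2,3)
proof (induction K)
  case (insert k K)
  then show ?case
    using lin_op_lin[OF T, of "F k" "\<lambda>p. \<Sum>k\<in>K. F k p" 1 1] sum_closed[of K F] by simp
qed (simp add: lin_op_zero[OF T])

lemma lin_op_comp: "lin_op T \<Longrightarrow> lin_op U \<Longrightarrow> lin_op (\<lambda>F. T (U F))"
  unfolding lin_op_def by simp

lemma lin_op_sum_ops:
  assumes "finite K" "\<And>k. k \<in> K \<Longrightarrow> lin_op (T k)"
  shows "lin_op (\<lambda>F p. c * (\<Sum>k\<in>K. T k F p))"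
  unfolding lin_op_def
proof (intro conjI ballI allI)
  fix F assume F: "F \<in> A"
  have "T k F \<in> A" if "k \<in> K" for k using lin_op_closed[OF assms(2)[OF that] F] .
  then show "(\<lambda>p. c * (\<Sum>k\<in>K. T k F p)) \<in> A"
    by (intro scale_closed[OF sum_closed[OF assms(1), of "\<lambda>k. T k F"]])
  fix G and a b :: real assume G: "G \<in> A"
  have "T k (\<lambda>p. a * F p + b * G p) = (\<lambda>p. a * T k F p + b * T k G p)" if "k \<in> K" for k
    using lin_op_lin[OF assms(2)[OF that] F G] .
  then have "(\<Sum>k\<in>K. T k (\<lambda>p. a * F p + b * G p) p) = a * (\<Sum>k\<in>K. T k F p) + b * (\<Sum>k\<in>K. T k G p)" for p
    by (simp add: sum.distrib sum_distrib_left)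
  then show "(\<lambda>p. c * (\<Sum>k\<in>K. T k (\<lambda>p. a * F p + b * G p) p)) =
      (\<lambda>p. a * (c * (\<Sum>k\<in>K. T k F p)) + b * (c * (\<Sum>k\<in>K. T k G p)))"
    by (simp add: algebra_simps)
qed

lemma lin_op_D: "i < n \<Longrightarrow> lin_op (D i)"
  unfolding lin_op_def using D_closed D_lin by simp

lemma lin_op_S: "i < n \<Longrightarrow> lin_op (S i)"
  unfolding lin_op_def using S_closed S_lin by simp

lemma lin_op_P: "i < n \<Longrightarrow> lin_op (P i)"
  unfolding lin_op_def using P_closed P_lin by simp

text \<open>Exchanging the two summation indices and anticommuting shows that the double sum is its
  own negative.\<close>

lemma anticommuting_sum_square:
  fixes c :: real
  assumes "finite K" and T: "\<And>k. k \<in> K \<Longrightarrow> lin_op (T k)"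
    and anti: "\<And>k l p. k \<in> K \<Longrightarrow> l \<in> K \<Longrightarrow> T k (T l F) p = - T l (T k F) p"
    and F: "F \<in> A"
    and h_def: "h = (\<lambda>F p. c * (\<Sum>k\<in>K. T k F p))"
  shows "h (h F) = (\<lambda>p. 0)"
proof
  fix p
  have TF: "T k F \<in> A" if "k \<in> K" for k using lin_op_closed T that F by blast
  let ?X = "\<Sum>k\<in>K. \<Sum>l\<in>K. T k (T l F) p"
  have "T k (h F) p = c * (\<Sum>l\<in>K. T k (T l F) p)" if "k \<in> K" for k
    unfolding h_def
    using lin_op_scale[OF T[OF that] sum_closed[OF \<open>finite K\<close> TF], of "\<lambda>k. k" c]
      lin_op_sum[OF T[OF that] \<open>finite K\<close> TF, of "\<lambda>k. k"] by simp
  then have "h (h F) p = c * c * ?X"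
    by (subst h_def) (simp add: sum_distrib_left mult.assoc)
  moreover have "?X = - ?X"
  proof -
    have "?X = (\<Sum>l\<in>K. \<Sum>k\<in>K. T k (T l F) p)" by (rule sum.swap)
    also have "\<dots> = (\<Sum>l\<in>K. \<Sum>k\<in>K. - T l (T k F) p)"
      by (intro sum.cong refl anti)
    finally show ?thesis by (simp add: sum_negf)
  qed
  ultimately show "h (h F) p = 0" by simp
qed

section \<open>Products of projections\<close>

definition PP :: "nat list \<Rightarrow> ('p \<Rightarrow> real) \<Rightarrow> 'p \<Rightarrow> real" where
  "PP L = foldr P L"

lemma PP_simps [simp]: "PP [] F = F" "PP (i # L) F = P i (PP L F)"
  by (simp_all add: PP_def)

lemma lin_op_PP: "set L \<subseteq> {..<n} \<Longrightarrow> lin_op (PP L)"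
proof (induction L)
  case (Cons i L)
  then show ?case using lin_op_comp[OF lin_op_P, of i "PP L"] by (simp add: PP_def comp_def)
qed (simp add: lin_op_def)

lemmas PP_closed = lin_op_closed[OF lin_op_PP]

lemma P_PP: "i < n \<Longrightarrow> set L \<subseteq> {..<n} \<Longrightarrow> F \<in> A \<Longrightarrow> P i (PP L F) = PP L (P i F)"
  by (induction L) (simp_all add: P_P[of i] PP_closed)

lemma D_PP: "i < n \<Longrightarrow> set L \<subseteq> {..<n} \<Longrightarrow> F \<in> A \<Longrightarrow> D i (PP L F) = PP L (D i F)"
  by (induction L) (simp_all add: D_P PP_closed)

lemma S_PP: "i < n \<Longrightarrow> set L \<subseteq> {..<n} \<Longrightarrow> i \<notin> set L \<Longrightarrow> F \<in> A \<Longrightarrow> S i (PP L F) = PP L (S i F)"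
  by (induction L) (simp_all add: S_P PP_closed)

lemma PP_PP: "set L \<subseteq> {..<n} \<Longrightarrow> set M \<subseteq> {..<n} \<Longrightarrow> F \<in> A \<Longrightarrow> PP L (PP M F) = PP M (PP L F)"
  by (induction L) (simp_all add: P_PP PP_closed)

text \<open>\<open>P i\<close> is commuted inward to its occurrence in \<open>L\<close>, where
  idempotence applies.\<close>

lemma P_PP_absorb: "i \<in> set L \<Longrightarrow> set L \<subseteq> {..<n} \<Longrightarrow> F \<in> A \<Longrightarrow> P i (PP L F) = PP L F"
proof (induction L)
  case (Cons j L)
  then have "i < n" by auto
  then show ?case
    using Cons P_P[of i j "PP L F"] by (cases "i = j") (auto simp: P_idem PP_closed)
qed simp

lemma S_PP_eq_0: "i \<in> set L \<Longrightarrow> set L \<subseteq> {..<n} \<Longrightarrow> F \<in> A \<Longrightarrow> S i (PP L F) = (\<lambda>p. 0)"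
  using S_P_same[of i "PP L F"] P_PP_absorb[of i L F] PP_closed[of L F] by auto

lemma PP_S_eq_0: "i \<in> set L \<Longrightarrow> set L \<subseteq> {..<n} \<Longrightarrow> F \<in> A \<Longrightarrow> PP L (S i F) = (\<lambda>p. 0)"
  using P_PP_absorb[of i L "S i F"] P_PP[of i L "S i F"] P_S_same[of i F] S_closed[of i F]
    lin_op_zero[OF lin_op_PP, of L] by auto

text \<open>If neither contracted index meets the other list of projections, everything commutes
  down to the pair \<open>S i\<close>, \<open>S k\<close>. If one does, both sides vanish
  separately.\<close>

lemma S_PP_anticommute:
  assumes "i < n" "k < n" "set L \<subseteq> {..<n}" "set M \<subseteq> {..<n}" "i \<notin> set L" "k \<notin> set M" and F: "F \<in> A"
  shows "S i (PP L (S k (PP M F))) p = - S k (PP M (S i (PP L F))) p"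
proof -
  note * = assms(1-4) S_closed PP_closed
  have comm: "S i (PP L (S k (PP M F))) = PP L (S i (S k (PP M F)))"
    "S k (PP M (S i (PP L F))) = PP M (S k (S i (PP L F)))"
    using assms by (simp_all add: S_PP *)
  consider "k \<in> set L" | "i \<in> set M" | "k \<notin> set L" "i \<notin> set M" by blast
  then show ?thesis
  proof cases
    case 1
    then have "S i (PP L (S k (PP M F))) p = 0"
      using PP_S_eq_0[of k L "PP M F"] lin_op_zero[OF lin_op_S] * F by simp
    \<comment> \<open>Swapping the contractions brings \<open>S k\<close> next to the product
      containing \<open>P k\<close>, which it annihilates.\<close>
    moreover have "S k (S i (PP L F)) = (\<lambda>p. - S i (S k (PP L F)) p)"
      by (intro S_S PP_closed assms)
    then have "S k (S i (PP L F)) = (\<lambda>p. 0)"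
      using S_PP_eq_0[OF 1] lin_op_zero[OF lin_op_S] * F by simp
    then have "S k (PP M (S i (PP L F))) p = 0"
      using comm(2) lin_op_zero[OF lin_op_PP] * by simp
    ultimately show ?thesis by simp
  next
    case 2
    then have "S k (PP M (S i (PP L F))) p = 0"
      using PP_S_eq_0[of i M "PP L F"] lin_op_zero[OF lin_op_S] * F by simp
    moreover have "S i (S k (PP M F)) = (\<lambda>p. - S k (S i (PP M F)) p)"
      by (intro S_S PP_closed assms)
    then have "S i (S k (PP M F)) = (\<lambda>p. 0)"
      using S_PP_eq_0[OF 2] lin_op_zero[OF lin_op_S] * F by simp
    then have "S i (PP L (S k (PP M F))) p = 0"
      using comm(1) lin_op_zero[OF lin_op_PP] * by simp
    ultimately show ?thesis by simp
  next
    case 3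
    have "S i (PP L (S k (PP M F))) = S i (S k (PP L (PP M F)))"
      using 3 F * by (simp add: S_PP[of k L])
    also have "\<dots> = (\<lambda>p. - S k (S i (PP M (PP L F))) p)"
      using F * by (simp add: S_S[of i k] PP_PP[of L M])
    also have "S i (PP M (PP L F)) = PP M (S i (PP L F))"
      using 3 F * by (simp add: S_PP)
    finally show ?thesis by simp
  qed
qed

section \<open>The averaged homotopy and its identities\<close>

definition d :: "('p \<Rightarrow> real) \<Rightarrow> 'p \<Rightarrow> real" where
  "d F p = (\<Sum>j<n. D j F p)"

text \<open>
  The summand of the contraction along the order \<open>\<sigma> 0, \<dots>, \<sigma> (n - 1)\<close> of the coordinates that
  contracts the coordinate \<open>\<sigma> j\<close>.
\<close>

definition contraction_summand :: "(nat \<Rightarrow> nat) \<Rightarrow> nat \<Rightarrow> ('p \<Rightarrow> real) \<Rightarrow> 'p \<Rightarrow> real" where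
  "contraction_summand \<sigma> j F = S (\<sigma> j) (PP (map \<sigma> [Suc j..<n]) F)"

definition h :: "('p \<Rightarrow> real) \<Rightarrow> 'p \<Rightarrow> real" where
  "h F p = 1 / fact n * (\<Sum>\<sigma> | \<sigma> permutes {..<n}. \<Sum>j<n. contraction_summand \<sigma> j F p)"

lemma permutes_less: "\<sigma> permutes {..<n} \<Longrightarrow> j < n \<Longrightarrow> \<sigma> j < n"
  by (metis lessThan_iff permutes_in_image)

lemma permutes_image_subset:
  assumes "\<sigma> permutes {..<n}"
  shows "set (map \<sigma> [j..<n]) \<subseteq> {..<n}"
  using permutes_less[OF assms] by auto

lemma upt_subset: "set [0..<n] \<subseteq> {..<n}"
  by auto

lemma permutes_notin_tail:
  assumes "\<sigma> permutes {..<n}"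
  shows "\<sigma> j \<notin> set (map \<sigma> [Suc j..<n])"
  using injD[OF permutes_inj[OF assms]] by fastforce

lemma lin_op_contraction_summand:
  "\<sigma> permutes {..<n} \<Longrightarrow> j < n \<Longrightarrow> lin_op (contraction_summand \<sigma> j)"
  unfolding contraction_summand_def[abs_def]
  by (rule lin_op_comp[OF lin_op_S[OF permutes_less] lin_op_PP[OF permutes_image_subset]])

text \<open>Flattens the average into one sum over pairs, the shape in which
  \<open>anticommuting_sum_square\<close> treats all permutations at once.\<close>

lemma h_eq:
  "h = (\<lambda>F p. 1 / fact n * (\<Sum>k\<in>{\<sigma>. \<sigma> permutes {..<n}} \<times> {..<n}. contraction_summand (fst k) (snd k) F p))"
  by (simp add: h_def fun_eq_iff sum.cartesian_product split_def)

lemma lin_op_h: "lin_op h"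
  unfolding h_eq
proof (rule lin_op_sum_ops)
  show "lin_op (contraction_summand (fst k) (snd k))"
    if "k \<in> {\<sigma>. \<sigma> permutes {..<n}} \<times> {..<n}" for k
    using that by (intro lin_op_contraction_summand) auto
qed (simp add: finite_permutations)

lemma lin_op_d: "lin_op d"
  using lin_op_sum_ops[of "{..<n}" D 1] lin_op_D by (simp add: d_def[abs_def])

lemma h_h:
  assumes F: "F \<in> A"
  shows "h (h F) = (\<lambda>p. 0)"
proof (rule anticommuting_sum_square[OF _ _ _ F h_eq])
  fix k l p
  assume kl: "k \<in> {\<sigma>. \<sigma> permutes {..<n}} \<times> {..<n}" "l \<in> {\<sigma>. \<sigma> permutes {..<n}} \<times> {..<n}"
  then have k: "fst k permutes {..<n}" "snd k < n" and l: "fst l permutes {..<n}" "snd l < n"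
    by auto
  show "lin_op (contraction_summand (fst k) (snd k))"
    using lin_op_contraction_summand[OF k] .
  show "contraction_summand (fst k) (snd k) (contraction_summand (fst l) (snd l) F) p =
      - contraction_summand (fst l) (snd l) (contraction_summand (fst k) (snd k) F) p"
    unfolding contraction_summand_def
    by (rule S_PP_anticommute[OF permutes_less[OF k] permutes_less[OF l] permutes_image_subset[OF k(1)]
          permutes_image_subset[OF l(1)] permutes_notin_tail[OF k(1)] permutes_notin_tail[OF l(1)] F])
qed (simp add: finite_permutations)

lemma h_eq_0:
  "(\<And>\<sigma> j. \<sigma> permutes {..<n} \<Longrightarrow> j < n \<Longrightarrow> contraction_summand \<sigma> j F p = 0) \<Longrightarrow> h F p = 0"
  by (simp add: h_def)

text \<open>Becomes s W = 0, as Whitney forms are fixed by the full product of projections. In each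
  summand the contraction meets the projection of its own coordinate.\<close>

lemma h_PP: "F \<in> A \<Longrightarrow> h (PP [0..<n] F) = (\<lambda>p. 0)"
proof
  fix p assume F: "F \<in> A"
  show "h (PP [0..<n] F) p = 0"
  proof (rule h_eq_0)
    fix \<sigma> j assume *: "\<sigma> permutes {..<n}" "j < n"
    then have "\<sigma> j < n" by (rule permutes_less)
    have "contraction_summand \<sigma> j (PP [0..<n] F) =
        S (\<sigma> j) (PP [0..<n] (PP (map \<sigma> [Suc j..<n]) F))"
      unfolding contraction_summand_def
      by (simp only: PP_PP[OF permutes_image_subset[OF *(1)] upt_subset F])
    also have "\<dots> = (\<lambda>p. 0)"
      using \<open>\<sigma> j < n\<close>
      by (intro S_PP_eq_0[OF _ upt_subset] PP_closed permutes_image_subset *(1) F) simp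
    finally show "contraction_summand \<sigma> j (PP [0..<n] F) p = 0" by simp
  qed
qed

lemma lin_op_apply_h:
  assumes U: "lin_op U" and F: "F \<in> A"
  shows "U (h F) p = 1 / fact n *
    (\<Sum>\<sigma> | \<sigma> permutes {..<n}. \<Sum>j<n. U (contraction_summand \<sigma> j F) p)"
proof -
  let ?K = "{\<sigma>. \<sigma> permutes {..<n}} \<times> {..<n}"
  let ?t = "\<lambda>k. contraction_summand (fst k) (snd k) F"
  have K: "finite ?K" by (simp add: finite_permutations)
  have t: "?t k \<in> A" if "k \<in> ?K" for k
    using that by (intro lin_op_closed[OF lin_op_contraction_summand F]) auto
  have "U (h F) p = 1 / fact n * (\<Sum>k\<in>?K. U (?t k) p)"
    unfolding h_eq by (simp only: lin_op_scale[OF U sum_closed[OF K t]] lin_op_sum[OF U K t])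
  then show ?thesis by (simp add: sum.cartesian_product split_def)
qed

text \<open>Becomes R s = 0: the full product contains the projection that annihilates the
  contraction from the left.\<close>

lemma PP_h: "F \<in> A \<Longrightarrow> PP [0..<n] (h F) = (\<lambda>p. 0)"
proof
  fix p assume F: "F \<in> A"
  have "PP [0..<n] (contraction_summand \<sigma> j F) = (\<lambda>p. 0)" if "\<sigma> permutes {..<n}" "j < n" for \<sigma> j
    unfolding contraction_summand_def using permutes_less[OF that]
    by (intro PP_S_eq_0[OF _ upt_subset] PP_closed permutes_image_subset that(1) F) simp_all
  then show "PP [0..<n] (h F) p = 0"
    by (simp add: lin_op_apply_h[OF lin_op_PP[OF upt_subset] F])
qed

lemma PP_d: "F \<in> A \<Longrightarrow> set L \<subseteq> {..<n} \<Longrightarrow> PP L (d F) = d (PP L F)"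
  using lin_op_sum[OF lin_op_PP, of L "{..<n}" "\<lambda>j. D j F"]
  by (simp add: d_def[abs_def] D_closed D_PP)

text \<open>The partial differentials in the other coordinates anticommute with \<open>S i\<close>
  and drop out, which leaves the homotopy formula of one interval.\<close>

lemma d_S:
  assumes "i < n" "F \<in> A"
  shows "d (S i F) p + S i (d F) p = F p - P i F p"
proof -
  have "S i (d F) p = (\<Sum>j<n. S i (D j F) p)"
    using lin_op_sum[OF lin_op_S, of i "{..<n}" "\<lambda>j. D j F"] assms
    by (simp add: d_def[abs_def] D_closed)
  then have "d (S i F) p + S i (d F) p = (\<Sum>j<n. D j (S i F) p + S i (D j F) p)"
    by (simp add: d_def sum.distrib)
  also have "\<dots> = (\<Sum>j<n. if j = i then F p - P i F p else 0)"
    using assms by (intro sum.cong) (auto simp: D_S D_S_same)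
  finally show ?thesis using assms by simp
qed

text \<open>Position \<open>j\<close> contributes \<open>?Q (Suc j) - ?Q j\<close>, where
  \<open>?Q j\<close> projects the coordinates from position \<open>j\<close> on. The sum telescopes
  from the full product at 0 to the empty product at \<open>n\<close>.\<close>

lemma d_contraction:
  assumes \<sigma>: "\<sigma> permutes {..<n}" and F: "F \<in> A"
  shows "(\<Sum>j<n. d (contraction_summand \<sigma> j F) p + contraction_summand \<sigma> j (d F) p) = F p - PP [0..<n] F p"
proof -
  let ?Q = "\<lambda>j. PP (map \<sigma> [j..<n]) F"
  have "d (contraction_summand \<sigma> j F) p + contraction_summand \<sigma> j (d F) p = ?Q (Suc j) p - ?Q j p"
    if "j < n" for j
  proof -
    have "[j..<n] = j # [Suc j..<n]" using that by (rule upt_conv_Cons)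
    then show ?thesis
      using d_S[OF permutes_less[OF \<sigma> that] PP_closed[OF permutes_image_subset[OF \<sigma>] F], of "Suc j" p]
      by (simp add: contraction_summand_def PP_d[OF F permutes_image_subset[OF \<sigma>]] del: upt_Suc)
  qed
  then have "(\<Sum>j<n. d (contraction_summand \<sigma> j F) p + contraction_summand \<sigma> j (d F) p) =
      ?Q n p - ?Q 0 p"
    using sum_lessThan_telescope[of "\<lambda>j. ?Q j p" n] by simp
  moreover have "?Q 0 = PP [0..<n] F"
  proof -
    \<comment> \<open>The projections commute, so a product depends only on the multiset of its
      indices; all values of a permutation give the full product.\<close>
    have comm: "PP L F = PP M F" if "mset L = mset M" "set L \<subseteq> {..<n}" for L M
      using that
    proof (induction L arbitrary: M)
      case (Cons i L)
      then have "i \<in> set M" by (metis list.set_intros(1) mset_eq_setD)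
      then obtain M1 M2 where M: "M = M1 @ i # M2" by (metis split_list)
      have sub: "set M1 \<subseteq> {..<n}" "set M2 \<subseteq> {..<n}" "i < n"
        using Cons.prems mset_eq_setD[OF Cons.prems(1)] M by auto
      have "PP L F = PP (M1 @ M2) F" using Cons M by (intro Cons.IH) auto
      then show ?case
        using P_PP[OF sub(3,1), of "PP M2 F"] PP_closed[OF sub(2) F] M by (simp add: PP_def)
    qed simp
    have "mset (map \<sigma> [0..<n]) = mset [0..<n]"
      using permutes_image[OF \<sigma>] permutes_inj_on[OF \<sigma>]
      by (intro set_eq_iff_mset_eq_distinct[THEN iffD1]) (simp_all add: distinct_map atLeast0LessThan)
    then show ?thesis by (intro comm permutes_image_subset \<sigma>)
  qed
  ultimately show ?thesis by simp
qed

lemma d_h: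
  assumes F: "F \<in> A"
  shows "d (h F) p + h (d F) p = F p - PP [0..<n] F p"
proof -
  let ?S = "{\<sigma>. \<sigma> permutes {..<n}}"
  have "d (h F) p + h (d F) p = 1 / fact n *
      (\<Sum>\<sigma>\<in>?S. \<Sum>j<n. d (contraction_summand \<sigma> j F) p + contraction_summand \<sigma> j (d F) p)"
    by (simp add: lin_op_apply_h[OF lin_op_d F] h_def sum.distrib add_divide_distrib)
  also have "\<dots> = 1 / fact n * (\<Sum>\<sigma>\<in>?S. F p - PP [0..<n] F p)"
    using d_contraction[OF _ F] by simp
  \<comment> \<open>There are \<open>fact n\<close> equal summands, one for each
    permutation.\<close>
  also have "\<dots> = F p - PP [0..<n] F p"
    using card_permutations[of "{..<n}" n] by simp
  finally show ?thesis .
qed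

end

section \<open>One-slot operators on forms\<close>

lemma cube_forms_eqI:
  "F \<in> cube_forms n \<Longrightarrow> G \<in> cube_forms n \<Longrightarrow> (\<And>p. length p = n \<Longrightarrow> F p = G p) \<Longrightarrow> F = G"
  using cube_forms_zero_length[of F n] cube_forms_zero_length[of G n] by (metis ext)

lemma W1_0: "W1 (\<lambda>z. 0) = (\<lambda>x. 0)"
  by (auto simp: W1_def fun_eq_iff)

lemma cube_forms_uminus: "F \<in> cube_forms n \<Longrightarrow> (\<lambda>p. - F p) \<in> cube_forms n"
  using cube_forms_lin[of F n F "-1" 0] by simp

text \<open>The differential and the contraction are odd and enter with their prefix sign, the
  projection is even and enters without one. Equal indices use the interval, distinct indices the
  exchange lemmas.\<close>

interpretation forms: slot_algebra n "cube_forms n" "\<lambda>i. sslot i d1" "\<lambda>i. sslot i s1"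
    "\<lambda>i. slot i whitney_proj" for n
proof
  fix i j F G and a b :: real and p
  show "(\<lambda>p. 0) \<in> cube_forms n" by (rule cube_forms_const0)
  show "(\<lambda>p. a * F p + b * G p) \<in> cube_forms n" if "F \<in> cube_forms n" "G \<in> cube_forms n"
    using that by (rule cube_forms_lin)
  have d: "sslot i d1 F \<in> cube_forms n" and s: "sslot i s1 F \<in> cube_forms n"
    and P: "slot i whitney_proj F \<in> cube_forms n" if "i < n" "F \<in> cube_forms n" for i F
    using that by (simp_all add: sslot_forms slot_d1_forms slot_s1_forms slot_whitney_proj_forms)
  have linP: "slot i whitney_proj (\<lambda>p. a * F p + b * G p) =
      (\<lambda>p. a * slot i whitney_proj F p + b * slot i whitney_proj G p)"
    if "i < n" "F \<in> cube_forms n" "G \<in> cube_forms n" for i F G a b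
    using slot_lin[OF whitney_proj_slice_linear that(2,3,1)] by blast
  show "i < n \<Longrightarrow> F \<in> cube_forms n \<Longrightarrow> sslot i d1 F \<in> cube_forms n" by (rule d)
  show "i < n \<Longrightarrow> F \<in> cube_forms n \<Longrightarrow> sslot i s1 F \<in> cube_forms n" by (rule s)
  show "i < n \<Longrightarrow> F \<in> cube_forms n \<Longrightarrow> slot i whitney_proj F \<in> cube_forms n" by (rule P)
  show "sslot i d1 (\<lambda>p. a * F p + b * G p) = (\<lambda>p. a * sslot i d1 F p + b * sslot i d1 G p)"
    if "i < n" "F \<in> cube_forms n" "G \<in> cube_forms n"
    using sslot_lin[OF d1_slice_linear that(2,3,1)] by blast
  show "sslot i s1 (\<lambda>p. a * F p + b * G p) = (\<lambda>p. a * sslot i s1 F p + b * sslot i s1 G p)"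
    if "i < n" "F \<in> cube_forms n" "G \<in> cube_forms n"
    using sslot_lin[OF s1_slice_linear that(2,3,1)] by blast
  show "slot i whitney_proj (\<lambda>p. a * F p + b * G p) =
      (\<lambda>p. a * slot i whitney_proj F p + b * slot i whitney_proj G p)"
    if "i < n" "F \<in> cube_forms n" "G \<in> cube_forms n"
    using that by (rule linP)
  have idem: "slot i whitney_proj (slot i whitney_proj F) = slot i whitney_proj F"
    if "i < n" "F \<in> cube_forms n" for i F
    by (rule cube_forms_eqI[of _ n])
      (use that in \<open>simp_all add: P\<close>, simp add: slot_def whitney_proj_def R1_W1)
  then show "slot i whitney_proj (slot i whitney_proj F) = slot i whitney_proj F"
    if "i < n" "F \<in> cube_forms n" using that by blast
  show "slot i whitney_proj (slot j whitney_proj F) = slot j whitney_proj (slot i whitney_proj F)"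
    if "i < n" "j < n" "F \<in> cube_forms n"
  proof (cases "i = j")
    case False
    then show ?thesis using slot_swap[OF slice_map_whitney_proj slice_map_whitney_proj that(3,1,2) False] by blast
  qed simp
  have slice_scale: "slot i whitney_proj (sslot i U F) p =
      prefix_sign form_deg i p * whitney_proj (U (\<lambda>x. F (p[i := x]))) (p ! i)"
    if "i < n" "slot i U F \<in> cube_forms n" "length p = n" for i U F p
  proof -
    have "slot i whitney_proj (sslot i U F) p = prefix_sign form_deg i p * slot i whitney_proj (slot i U F) p"
      by (rule slot_scale[OF whitney_proj_slice_linear that(2,1)])
        (simp add: sslot_def prefix_sign_update_ge)
    then show ?thesis using that by (simp add: slot_def)
  qed
  show "sslot i d1 (slot j whitney_proj F) = slot j whitney_proj (sslot i d1 F)"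
    if *: "i < n" "j < n" "F \<in> cube_forms n"
  proof (rule cube_forms_eqI[OF d P])
    fix p :: "form_label list" assume len: "length p = n"
    show "sslot i d1 (slot j whitney_proj F) p = slot j whitney_proj (sslot i d1 F) p"
    proof (cases "i = j")
      case True
      have sm: "smooth_slice (\<lambda>x. F (p[i := x]))" using cube_forms_slice[OF *(3,1)] .
      have "sslot i d1 (slot i whitney_proj F) p =
          prefix_sign form_deg i p * d1 (W1 (R1 (\<lambda>x. F (p[i := x])))) (p ! i)"
        using * len by (simp add: sslot_def slot_def whitney_proj_def)
      \<comment> \<open>Both interval maps are cochain maps: d W R equals W \<delta> R, which equals
        W R d.\<close>
      also have "\<dots> = prefix_sign form_deg i p * whitney_proj (d1 (\<lambda>x. F (p[i := x]))) (p ! i)"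
        by (simp add: d1_W1 whitney_proj_def R1_d1[OF sm])
      finally show ?thesis
        using slice_scale[OF *(1) slot_d1_forms[OF *(3,1)] len] True by simp
    next
      case False
      show ?thesis
        by (rule sslot_slot_commute[OF odd_map_d1 *(1,2) False *(3) slot_d1_forms[OF *(3,1)] _ len])
          (rule slot_swap_d1[OF slice_map_whitney_proj *(3,2,1) _ len, symmetric],
            use False in simp)
    qed
  qed (use * d P in auto)
  show "sslot i s1 (slot j whitney_proj F) = slot j whitney_proj (sslot i s1 F)"
    if *: "i < n" "j < n" "i \<noteq> j" "F \<in> cube_forms n"
  proof (rule cube_forms_eqI[OF s P])
    fix p :: "form_label list" assume len: "length p = n"
    show "sslot i s1 (slot j whitney_proj F) p = slot j whitney_proj (sslot i s1 F) p"
      by (rule sslot_slot_commute[OF odd_map_s1 *(1,2,3,4) slot_s1_forms[OF *(4,1)]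
            slot_swap[OF slice_map_s1 slice_map_whitney_proj *(4,1,2,3)] len])
  qed (use * s P in auto)
  show "sslot i s1 (slot i whitney_proj F) = (\<lambda>p. 0)" if "i < n" "F \<in> cube_forms n"
  proof (rule cube_forms_eqI[OF s[OF that(1) P[OF that]] cube_forms_const0])
    fix p :: "form_label list" assume "length p = n"
    then show "sslot i s1 (slot i whitney_proj F) p = 0"
      using that by (simp add: sslot_def slot_def whitney_proj_def s1_W1)
  qed
  show "slot i whitney_proj (sslot i s1 F) = (\<lambda>p. 0)" if "i < n" "F \<in> cube_forms n"
  proof (rule cube_forms_eqI[OF P[OF that(1) s[OF that]] cube_forms_const0])
    fix p :: "form_label list" assume "length p = n"
    then show "slot i whitney_proj (sslot i s1 F) p = 0"
      using slice_scale[OF that(1) slot_s1_forms[OF that(2,1)]]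
      by (simp add: whitney_proj_def R1_s1 W1_0)
  qed
  show "sslot i s1 (sslot j s1 F) = (\<lambda>p. - sslot j s1 (sslot i s1 F) p)"
    if *: "i < n" "j < n" "F \<in> cube_forms n"
  proof (rule cube_forms_eqI[OF s[OF *(1) s[OF *(2,3)]] cube_forms_uminus[OF s[OF *(2) s[OF *(1,3)]]]])
    fix p :: "form_label list" assume len: "length p = n"
    show "sslot i s1 (sslot j s1 F) p = - sslot j s1 (sslot i s1 F) p"
    proof (cases "i = j")
      case True
      then show ?thesis
        using sslot_same[OF s1_slice_linear slot_s1_forms[OF *(3,1)] *(1) len] by (simp add: s1_s1)
    next
      case False
      show ?thesis
        by (rule sslot_anticommute[OF odd_map_s1 odd_map_s1 *(1,2) False slot_s1_forms[OF *(3,2)]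
              slot_s1_forms[OF *(3,1)]
              slot_swap[OF slice_map_s1 slice_map_s1 *(3,1,2) False] len])
    qed
  qed
  show "sslot i d1 (sslot j s1 F) = (\<lambda>p. - sslot j s1 (sslot i d1 F) p)"
    if *: "i < n" "j < n" "i \<noteq> j" "F \<in> cube_forms n"
  proof (rule cube_forms_eqI[OF d[OF *(1) s[OF *(2,4)]] cube_forms_uminus[OF s[OF *(2) d[OF *(1,4)]]]])
    fix p :: "form_label list" assume len: "length p = n"
    show "sslot i d1 (sslot j s1 F) p = - sslot j s1 (sslot i d1 F) p"
      by (rule sslot_anticommute[OF odd_map_d1 odd_map_s1 *(1,2,3) slot_s1_forms[OF *(4,2)]
            slot_d1_forms[OF *(4,1)]
            slot_swap_d1[OF slice_map_s1 *(4,2,1) *(3)[symmetric] len, symmetric] len])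
  qed
  show "sslot i d1 (sslot i s1 F) p + sslot i s1 (sslot i d1 F) p = F p - slot i whitney_proj F p"
    if *: "i < n" "F \<in> cube_forms n"
  proof (cases "length p = n")
    case True
    have "sslot i d1 (sslot i s1 F) p = d1 (s1 (\<lambda>x. F (p[i := x]))) (p ! i)"
      "sslot i s1 (sslot i d1 F) p = s1 (d1 (\<lambda>x. F (p[i := x]))) (p ! i)"
      using sslot_same[OF d1_slice_linear slot_s1_forms[OF *(2,1)] *(1) True]
        sslot_same[OF s1_slice_linear slot_d1_forms[OF *(2,1)] *(1) True] .
    then show ?thesis
      using d1_s1[OF cube_forms_slice[OF *(2,1), of p], of "p ! i"]
      by (simp add: slot_def whitney_proj_def)
  next
    case False
    then show ?thesis
      using cube_forms_zero_length[OF d[OF *(1) s[OF *]]] cube_forms_zero_length[OF s[OF *(1) d[OF *]]]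
        cube_forms_zero_length[OF P[OF *]] cube_forms_zero_length[OF *(2)] by simp
  qed
qed

section \<open>Tensor products as compositions of one-slot operators\<close>

text \<open>Running out of labels or of factors yields 0 at the end of the recursion, and each
  factor passes the zero function on as 0.\<close>

lemma tensor_length:
  assumes "\<forall>(k, T)\<in>set Ts. \<forall>y. T (\<lambda>x. 0) y = 0" "length ys \<noteq> length Ts"
  shows "tensor dg Ts F ys = 0"
  using assms
proof (induction Ts arbitrary: F ys)
  case Nil
  then show ?case by (cases ys) auto
next
  case (Cons T Ts)
  then show ?case by (cases T; cases ys) auto
qed

lemma koszul_0: "koszul 0 k = 1"
  by (simp add: koszul_def)

text \<open>The prefix \<open>q\<close> collects the labels already consumed by the recursion, so
  that the remaining factors act in slots counted from \<open>length q\<close>. All degrees are 0,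
  hence no sign appears.\<close>

lemma tensor_replicate:
  "length r = m \<Longrightarrow> tensor dg (replicate m (0, T)) (\<lambda>xs. F (q @ xs)) r =
     foldr (\<lambda>i. slot i T) [length q..<length q + m] F (q @ r)"
proof (induction m arbitrary: q r)
  case (Suc m)
  then obtain y r' where r: "r = y # r'" "length r' = m" by (cases r) auto
  have "[length q..<length q + Suc m] = length q # [length (q @ [x])..<length (q @ [x]) + m]" for x :: 'a
    by (simp add: upt_conv_Cons del: upt_Suc)
  moreover have "tensor dg (replicate m (0, T)) (\<lambda>xs. F (q @ x # xs)) r' =
      foldr (\<lambda>i. slot i T) [length (q @ [x])..<length (q @ [x]) + m] F (q @ x # r')" for x
    using Suc.IH[OF r(2), of "q @ [x]"] by simp
  ultimately show ?case
    using r(2) by (simp add: r(1) slot_def[of "length q"] koszul_0 sum_list_replicate del: upt_Suc)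
qed simp

text \<open>While an identity factor is peeled off, the factors still to come have total degree
  \<open>k\<close>, which produces one \<open>koszul k\<close> for each label before the
  distinguished slot. Behind that slot the total degree is 0.\<close>

lemma tensor_single:
  "length r = j + Suc m \<Longrightarrow>
   tensor dg (replicate j (0, \<lambda>G. G) @ [(k, T)] @ replicate m (0, U)) (\<lambda>xs. F (q @ xs)) r =
     (\<Prod>i<j. koszul k (dg (r ! i))) *
     slot (length q + j) T (foldr (\<lambda>i. slot i U) [Suc (length q + j)..<Suc (length q + j) + m] F) (q @ r)"
proof (induction j arbitrary: q r)
  case 0
  then obtain y r' where r: "r = y # r'" "length r' = m" by (cases r) auto
  have "tensor dg (replicate m (0, U)) (\<lambda>xs. F (q @ x # xs)) r' =
      foldr (\<lambda>i. slot i U) [Suc (length q)..<Suc (length q) + m] F (q @ x # r')" for x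
    using tensor_replicate[OF r(2), of dg U F "q @ [x]"] by simp
  then show ?case
    by (simp add: r(1) slot_def[of "length q"] koszul_0 sum_list_replicate del: upt_Suc)
next
  case (Suc j)
  then obtain y r' where r: "r = y # r'" "length r' = j + Suc m" by (cases r) auto
  show ?case
    using Suc.IH[OF r(2), of "q @ [y]"]
    by (simp add: r(1) sum_list_replicate prod.lessThan_Suc_shift mult_ac del: upt_Suc prod.lessThan_Suc)
qed

text \<open>Only the parity of the degree matters, so the differential and the contraction share one
  prefix sign.\<close>

lemma tensor_single_sign:
  assumes "length p = n" "j < n" "k = 1 \<or> k = -1"
  shows "tensor dg (replicate j (0, \<lambda>G. G) @ [(k, T)] @ replicate (n - 1 - j) (0, U)) F p =
     prefix_sign dg j p * slot j T (foldr (\<lambda>i. slot i U) [Suc j..<n] F) p"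
proof -
  have "koszul k a = koszul 1 a" for a using assms(3) by (auto simp: koszul_def)
  then show ?thesis
    using tensor_single[of p j "n - 1 - j" dg k T U F "[]"] assms
    by (simp add: prefix_sign_def del: upt_Suc)
qed

lemma foldr_slot_id: "foldr (\<lambda>i. slot i (\<lambda>G. G)) L F = F"
  by (induction L) (simp_all add: slot_def fun_eq_iff)

lemma d_form_eq:
  assumes F: "F \<in> cube_forms n"
  shows "d_form n F = forms.d n F"
proof
  fix p
  show "d_form n F p = forms.d n F p"
  proof (cases "length p = n")
    case True
    then show ?thesis
      unfolding d_form_def forms.d_def
      by (intro sum.cong refl, subst tensor_single_sign) (simp_all add: foldr_slot_id sslot_def)
  next
    case False
    have "d_form n F p = 0"
      unfolding d_form_def using False slice_linear_0[OF d1_slice_linear]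
      by (intro sum.neutral ballI tensor_length) auto
    moreover have "forms.d n F p = 0"
      using cube_forms_zero_length[OF forms.lin_op_closed[OF forms.lin_op_d F] False] .
    ultimately show ?thesis by simp
  qed
qed

lemma delta1_0: "delta1 (\<lambda>x. 0) z = 0"
  by (cases z) auto

lemma d_cochain_eq:
  "length p = n \<Longrightarrow> d_cochain n c p = (\<Sum>j<n. prefix_sign cell_deg j p * slot j delta1 c p)"
  unfolding d_cochain_def
  by (intro sum.cong refl, subst tensor_single_sign) (simp_all add: foldr_slot_id)

lemma d_cochain_closed: "d_cochain n c \<in> cube_cochains n"
  unfolding cube_cochains_def d_cochain_def using delta1_0
  by (intro CollectI allI impI sum.neutral ballI tensor_length) auto

lemma cubical_s0_eq:
  assumes "length p = n"
  shows "cubical_s0 n F p = (\<Sum>j<n. sslot j s1 (forms.PP [Suc j..<n] F) p)"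
  using assms unfolding cubical_s0_def
  by (intro sum.cong refl, subst tensor_single_sign)
    (simp_all add: forms.PP_def sslot_def whitney_proj_def[symmetric])

lemma cubical_s0_length:
  assumes "length p \<noteq> n"
  shows "cubical_s0 n F p = 0"
  unfolding cubical_s0_def
  using assms slice_linear_0[OF s1_slice_linear] slice_linear_0[OF whitney_proj_slice_linear]
  by (intro sum.neutral ballI tensor_length) (auto simp: whitney_proj_def)

section \<open>Permutations of the coordinates\<close>

definition inversions :: "nat \<Rightarrow> (nat \<Rightarrow> nat) \<Rightarrow> (nat \<times> nat) set" where
  "inversions n \<sigma> = {(i, j). i < j \<and> j < n \<and> \<sigma> j < \<sigma> i}"

definition perm_sign :: "(nat \<Rightarrow> nat) \<Rightarrow> form_label list \<Rightarrow> real" where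
  "perm_sign \<sigma> p =
     (\<Prod>(i, j)\<in>inversions (length p) \<sigma>. koszul (form_deg (p ! \<sigma> i)) (form_deg (p ! \<sigma> j)))"

definition permute_slots :: "(nat \<Rightarrow> nat) \<Rightarrow> 'x list \<Rightarrow> 'x list" where
  "permute_slots \<sigma> p = map (\<lambda>i. p ! \<sigma> i) [0..<length p]"

lemma form_perm_eq: "form_perm \<sigma> F p = perm_sign \<sigma> p * F (permute_slots \<sigma> p)"
  by (simp add: form_perm_def perm_sign_def permute_slots_def inversions_def)

lemma length_permute_slots [simp]: "length (permute_slots \<sigma> p) = length p"
  by (simp add: permute_slots_def)

lemma nth_permute_slots [simp]: "i < length p \<Longrightarrow> permute_slots \<sigma> p ! i = p ! \<sigma> i"
  by (simp add: permute_slots_def)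

lemma permute_slots_update:
  assumes "\<sigma> permutes {..<length p}" "j < length p"
  shows "permute_slots \<sigma> (p[\<sigma> j := x]) = (permute_slots \<sigma> p)[j := x]"
  using forms.permutes_less[OF assms] permutes_inj[OF assms(1)] forms.permutes_less[OF assms(1)]
  by (intro nth_equalityI) (auto simp: nth_list_update inj_eq)

lemma finite_inversions: "finite (inversions n \<sigma>)"
  by (rule finite_subset[of _ "{..<n} \<times> {..<n}"]) (auto simp: inversions_def)

lemma koszul_commute: "koszul a b = koszul b a"
  by (simp add: koszul_def conj_commute)

lemma perm_sign_square: "perm_sign \<sigma> p * perm_sign \<sigma> p = 1"
  unfolding perm_sign_def
  by (simp add: prod.distrib[symmetric] split_def koszul_square)

text \<open>An inversion \<open>(i, j)\<close> of \<open>\<sigma>\<close> corresponds to the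
  inversion \<open>(\<sigma> j, \<sigma> i)\<close> of the inverse, and the two compare the same
  pair of labels.\<close>

lemma perm_sign_inv:
  assumes \<sigma>: "\<sigma> permutes {..<length p}"
  shows "perm_sign (inv \<sigma>) (permute_slots \<sigma> p) = perm_sign \<sigma> p"
proof -
  have \<sigma>': "inv \<sigma> permutes {..<length p}" using permutes_inv[OF \<sigma>] .
  note [simp] = permutes_inverses[OF \<sigma>]
  have lt: "\<sigma> i < length p" "inv \<sigma> i < length p" if "i < length p" for i
    using forms.permutes_less[OF \<sigma> that] forms.permutes_less[OF \<sigma>' that] by auto
  have "perm_sign (inv \<sigma>) (permute_slots \<sigma> p) =
      (\<Prod>(i, j)\<in>inversions (length p) (inv \<sigma>). koszul (form_deg (p ! i)) (form_deg (p ! j)))"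
    unfolding perm_sign_def by (rule prod.cong) (auto simp: inversions_def lt)
  also have "\<dots> = perm_sign \<sigma> p"
    unfolding perm_sign_def
    by (rule prod.reindex_bij_witness[of _ "\<lambda>(a, b). (\<sigma> b, \<sigma> a)" "\<lambda>(i, j). (inv \<sigma> j, inv \<sigma> i)"])
      (auto simp: inversions_def lt koszul_commute)
  finally show ?thesis .
qed

lemma form_perm_inverse:
  assumes \<sigma>: "\<sigma> permutes {..<n}" and F: "\<And>p. length p \<noteq> n \<Longrightarrow> F p = 0"
  shows "form_perm \<sigma> (form_perm (inv \<sigma>) F) = F"
proof
  fix p
  show "form_perm \<sigma> (form_perm (inv \<sigma>) F) p = F p"
  proof (cases "length p = n")
    case True
    have "permute_slots (inv \<sigma>) (permute_slots \<sigma> p) = p"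
      using True forms.permutes_less[OF permutes_inv[OF \<sigma>]] permutes_inverses[OF \<sigma>]
      by (intro nth_equalityI) auto
    then show ?thesis
      using perm_sign_inv[of \<sigma> p] perm_sign_square[of \<sigma> p] \<sigma> True
      by (simp add: form_perm_eq mult.assoc[symmetric])
  qed (simp add: form_perm_eq F)
qed

section \<open>Dependence of the reordering sign on a single label\<close>

lemma prod_symmetric_difference:
  fixes f :: "'a \<Rightarrow> real"
  assumes "finite X" "finite Y" "\<And>k. f k * f k = 1"
  shows "prod f X = prod f Y * prod f ((X - Y) \<union> (Y - X))"
proof -
  have "prod f X = prod f (X \<inter> Y) * prod f (X - Y)" "prod f Y = prod f (X \<inter> Y) * prod f (Y - X)"
    using prod.Int_Diff[OF assms(1), of f Y] prod.Int_Diff[OF assms(2), of f X]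
    by (simp_all add: Int_commute)
  moreover have "prod f ((X - Y) \<union> (Y - X)) = prod f (X - Y) * prod f (Y - X)"
    using assms by (intro prod.union_disjoint) auto
  moreover have "prod f (Y - X) * prod f (Y - X) = 1"
    by (simp add: prod.distrib[symmetric] assms(3))
  ultimately show ?thesis by (simp add: mult_ac)
qed

text \<open>For \<open>j < n\<close> these are the positions \<open>k\<close> whose order relative
  to \<open>j\<close> is reversed by \<open>\<sigma>\<close>. Writing them as a symmetric difference
  matches the comparison of the two prefixes in \<open>prefix_sign_permute\<close>.\<close>

definition crossings :: "nat \<Rightarrow> (nat \<Rightarrow> nat) \<Rightarrow> nat \<Rightarrow> nat set" where
  "crossings n \<sigma> j = ({..<j} - {k. k < n \<and> \<sigma> k < \<sigma> j}) \<union> ({k. k < n \<and> \<sigma> k < \<sigma> j} - {..<j})"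

text \<open>Inversions avoiding position \<open>j\<close> do not see the new label and make up
  \<open>E\<close>. Those involving \<open>j\<close> pair it with the crossings, and their signs are
  trivial when the new label has degree 0.\<close>

lemma perm_sign_split:
  assumes \<sigma>: "\<sigma> permutes {..<length p}" and j: "j < length p"
  shows "\<exists>E. \<forall>x. perm_sign \<sigma> (p[\<sigma> j := x]) =
    E * (if fst x then \<Prod>k\<in>crossings (length p) \<sigma> j. koszul 1 (form_deg (p ! \<sigma> k)) else 1)"
proof -
  let ?n = "length p" and ?f = "\<lambda>k. if j < k then (j, k) else (k, j)"
  let ?B = "crossings ?n \<sigma> j"
  let ?g = "\<lambda>p (a, b). koszul (form_deg (p ! \<sigma> a)) (form_deg (p ! \<sigma> b))"
  have eq: "\<sigma> k = \<sigma> l \<longleftrightarrow> k = l" for k l using permutes_inj[OF \<sigma>] by (simp add: inj_eq)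
  have lt: "\<sigma> k < ?n" if "k < ?n" for k using forms.permutes_less[OF \<sigma> that] .
  have B: "k < ?n \<and> k \<noteq> j" if "k \<in> ?B" for k
    using that j by (auto simp: crossings_def)
  have sub: "?f ` ?B \<subseteq> inversions ?n \<sigma>"
  proof
    fix z assume "z \<in> ?f ` ?B"
    then obtain k where k: "k \<in> ?B" "z = ?f k" by blast
    then have "\<sigma> k \<noteq> \<sigma> j" using B[of k] eq[of k j] by simp
    then show "z \<in> inversions ?n \<sigma>"
      using k j by (auto simp: crossings_def inversions_def)
  qed
  \<comment> \<open>Every inversion involving \<open>j\<close> comes from a crossing, so the
    remaining ones avoid \<open>j\<close>.\<close>
  have rest: "a \<noteq> j \<and> b \<noteq> j \<and> a < ?n \<and> b < ?n" if "(a, b) \<in> inversions ?n \<sigma> - ?f ` ?B" for a b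
  proof -
    have 1: "(a, j) \<in> ?f ` ?B" if "(a, j) \<in> inversions ?n \<sigma>" for a
      using that by (intro image_eqI[of _ _ a]) (auto simp: inversions_def crossings_def)
    have 2: "(j, b) \<in> ?f ` ?B" if "(j, b) \<in> inversions ?n \<sigma>" for b
      using that by (intro image_eqI[of _ _ b]) (auto simp: inversions_def crossings_def)
    have "b \<noteq> j" "a \<noteq> j" using that 1[of a] 2[of b] by blast+
    then show ?thesis using that by (auto simp: inversions_def)
  qed
  let ?E = "\<Prod>z\<in>inversions ?n \<sigma> - ?f ` ?B. ?g p z"
  have "perm_sign \<sigma> (p[\<sigma> j := x]) = ?E * (\<Prod>k\<in>?B. koszul (form_deg x) (form_deg (p ! \<sigma> k)))" for x
  proof -
    let ?p = "p[\<sigma> j := x]"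
    have "perm_sign \<sigma> ?p =
        (\<Prod>z\<in>inversions ?n \<sigma> - ?f ` ?B. ?g ?p z) * (\<Prod>z\<in>?f ` ?B. ?g ?p z)"
      unfolding perm_sign_def by (simp add: prod.subset_diff[OF sub finite_inversions])
    also have "(\<Prod>z\<in>inversions ?n \<sigma> - ?f ` ?B. ?g ?p z) = ?E"
    proof (rule prod.cong)
      fix z assume z: "z \<in> inversions ?n \<sigma> - ?f ` ?B"
      obtain a b where ab: "z = (a, b)" by (cases z)
      then have "a \<noteq> j" "b \<noteq> j" using rest[of a b] z by blast+
      then have "\<sigma> j \<noteq> \<sigma> a" "\<sigma> j \<noteq> \<sigma> b" using eq[of j a] eq[of j b] by simp_all
      then show "?g ?p z = ?g p z" by (simp add: ab)
    qed simp
    also have "(\<Prod>z\<in>?f ` ?B. ?g ?p z) = (\<Prod>k\<in>?B. ?g ?p (?f k))"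
      by (rule prod.reindex_cong[of ?f]) (auto simp: inj_on_def split: if_splits)
    also have "\<dots> = (\<Prod>k\<in>?B. koszul (form_deg x) (form_deg (p ! \<sigma> k)))"
    proof (intro prod.cong refl)
      fix k assume "k \<in> ?B"
      then have "\<sigma> j \<noteq> \<sigma> k" using B[of k] eq[of j k] by simp
      then show "?g ?p (?f k) = koszul (form_deg x) (form_deg (p ! \<sigma> k))"
        by (simp add: lt j koszul_commute)
    qed
    finally show ?thesis .
  qed
  moreover have "(\<Prod>k\<in>?B. koszul (form_deg x) (form_deg (p ! \<sigma> k))) =
      (if fst x then \<Prod>k\<in>?B. koszul 1 (form_deg (p ! \<sigma> k)) else 1)" for x
    by (simp add: form_deg_def koszul_0)
  ultimately show ?thesis by auto
qed

text \<open>One prefix runs over the positions before \<open>j\<close>, the other over the positions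
  whose image lies before \<open>\<sigma> j\<close>. Products of signs over two index sets differ by
  the product over their symmetric difference.\<close>

lemma prefix_sign_permute:
  assumes \<sigma>: "\<sigma> permutes {..<length p}" and j: "j < length p"
  shows "prefix_sign form_deg j (permute_slots \<sigma> p) =
    prefix_sign form_deg (\<sigma> j) p * (\<Prod>k\<in>crossings (length p) \<sigma> j. koszul 1 (form_deg (p ! \<sigma> k)))"
proof -
  let ?f = "\<lambda>k. koszul 1 (form_deg (p ! \<sigma> k))" and ?Y = "{k. k < length p \<and> \<sigma> k < \<sigma> j}"
  note \<sigma>' = permutes_inv[OF \<sigma>]
  have "prefix_sign form_deg (\<sigma> j) p = prod ?f ?Y"
    unfolding prefix_sign_def
    using forms.permutes_less[OF \<sigma>'] forms.permutes_less[OF \<sigma> j]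
    by (intro prod.reindex_bij_witness[of _ \<sigma> "inv \<sigma>"]) (auto simp: permutes_inverses[OF \<sigma>])
  moreover have "prefix_sign form_deg j (permute_slots \<sigma> p) = prod ?f {..<j}"
    unfolding prefix_sign_def using j by (intro prod.cong) auto
  moreover have "prod ?f {..<j} = prod ?f ?Y * prod ?f (({..<j} - ?Y) \<union> (?Y - {..<j}))"
    by (rule prod_symmetric_difference) (simp_all add: koszul_square)
  ultimately show ?thesis by (simp only: crossings_def)
qed

lemma whitney_proj_scale: "whitney_proj (\<lambda>x. c * f x) y = c * whitney_proj f y"
  by (cases y) (auto simp: whitney_proj_def W1_def algebra_simps)

text \<open>The label-dependent part of the sign depends only on the bit, and the projection
  preserves the bit.\<close>

lemma form_perm_slot_whitney_proj:
  assumes \<sigma>: "\<sigma> permutes {..<length p}" and j: "j < length p"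
  shows "form_perm \<sigma> (slot j whitney_proj G) p = slot (\<sigma> j) whitney_proj (form_perm \<sigma> G) p"
proof -
  define \<kappa> where "\<kappa> = (\<Prod>k\<in>crossings (length p) \<sigma> j. koszul 1 (form_deg (p ! \<sigma> k)))"
  let ?m = "\<lambda>x :: form_label. if fst x then \<kappa> else 1"
  obtain E where E: "\<And>x. perm_sign \<sigma> (p[\<sigma> j := x]) = E * ?m x"
    using perm_sign_split[OF assms] unfolding \<kappa>_def by blast
  have m: "whitney_proj (\<lambda>x. ?m x * g x) y = ?m y * whitney_proj g y" for g y
    by (cases y) (simp add: whitney_proj_def W1_def)
  have "slot (\<sigma> j) whitney_proj (form_perm \<sigma> G) p =
      whitney_proj (\<lambda>x. E * (?m x * G ((permute_slots \<sigma> p)[j := x]))) (p ! \<sigma> j)"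
    by (simp only: slot_def form_perm_eq E permute_slots_update[OF assms] mult.assoc)
  also have "\<dots> = E * ?m (p ! \<sigma> j) * slot j whitney_proj G (permute_slots \<sigma> p)"
    unfolding whitney_proj_scale m using j by (simp add: slot_def)
  also have "E * ?m (p ! \<sigma> j) = perm_sign \<sigma> p"
    using E[of "p ! \<sigma> j"] by simp
  finally show ?thesis by (simp only: form_perm_eq[of \<sigma> "slot j whitney_proj G" p])
qed

text \<open>The contraction reads a label with \<open>dt\<close>, where the sign carries
  \<open>\<kappa>\<close>, and writes one without, where it does not. The leftover
  \<open>\<kappa>\<close> is exactly the discrepancy of the prefix signs at \<open>j\<close> and
  \<open>\<sigma> j\<close>.\<close>

lemma form_perm_sslot_s1:
  assumes \<sigma>: "\<sigma> permutes {..<length p}" and j: "j < length p"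
  shows "form_perm \<sigma> (sslot j s1 G) p = sslot (\<sigma> j) s1 (form_perm \<sigma> G) p"
proof -
  define \<kappa> where "\<kappa> = (\<Prod>k\<in>crossings (length p) \<sigma> j. koszul 1 (form_deg (p ! \<sigma> k)))"
  let ?m = "\<lambda>x :: form_label. if fst x then \<kappa> else 1"
  obtain E where E: "\<And>x. perm_sign \<sigma> (p[\<sigma> j := x]) = E * ?m x"
    using perm_sign_split[OF assms] unfolding \<kappa>_def by blast
  have scale: "s1 (\<lambda>x. c * g x) y = c * s1 g y" for c g y
    by (cases y) (simp add: s1_def right_diff_distrib mult.left_commute)
  have "s1 (\<lambda>x. ?m x * g x) y = s1 (\<lambda>x. \<kappa> * g x) y" for g y
    by (cases y) (simp add: s1_def)
  then have m: "s1 (\<lambda>x. ?m x * g x) y = \<kappa> * s1 g y" for g y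
    by (simp only: scale)
  have "slot (\<sigma> j) s1 (form_perm \<sigma> G) p =
      s1 (\<lambda>x. E * (?m x * G ((permute_slots \<sigma> p)[j := x]))) (p ! \<sigma> j)"
    by (simp only: slot_def form_perm_eq E permute_slots_update[OF assms] mult.assoc)
  also have "\<dots> = E * \<kappa> * slot j s1 G (permute_slots \<sigma> p)"
    unfolding scale m using j by (simp add: slot_def)
  \<comment> \<open>The output vanishes at a label with \<open>dt\<close>; at a label without it,
    \<open>E\<close> is the full sign.\<close>
  also have "\<dots> = perm_sign \<sigma> p * \<kappa> * slot j s1 G (permute_slots \<sigma> p)"
  proof (cases "fst (p ! \<sigma> j)")
    case True
    then have "slot j s1 G (permute_slots \<sigma> p) = 0"
      using j by (cases "p ! \<sigma> j") (simp add: slot_def s1_def)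
    then show ?thesis by simp
  next
    case False
    then have "perm_sign \<sigma> p = E" using E[of "p ! \<sigma> j"] by simp
    then show ?thesis by simp
  qed
  finally show ?thesis
    by (simp only: form_perm_eq[of \<sigma> "sslot j s1 G" p] sslot_def[of _ _ _ p]
        sslot_def[of _ _ _ "permute_slots \<sigma> p"] prefix_sign_permute[OF assms] \<kappa>_def mult_ac)
qed

lemma forms_PP_length:
  assumes "\<And>p. length p \<noteq> n \<Longrightarrow> F p = 0" "length p \<noteq> n"
  shows "forms.PP L F p = 0"
  using assms(2)
proof (induction L arbitrary: p)
  case (Cons i L)
  then show ?case
    using slice_linear_0[OF whitney_proj_slice_linear]
    by (simp add: slot_def[of i whitney_proj "forms.PP L F"])
qed (simp add: assms(1))

lemma form_perm_PP:
  assumes \<sigma>: "\<sigma> permutes {..<n}" and L: "set L \<subseteq> {..<n}" and G: "\<And>p. length p \<noteq> n \<Longrightarrow> G p = 0"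
  shows "form_perm \<sigma> (forms.PP L G) = forms.PP (map \<sigma> L) (form_perm \<sigma> G)"
  using L
proof (induction L)
  case (Cons i L)
  show ?case
  proof
    fix p
    show "form_perm \<sigma> (forms.PP (i # L) G) p = forms.PP (map \<sigma> (i # L)) (form_perm \<sigma> G) p"
    proof (cases "length p = n")
      case True
      then have "form_perm \<sigma> (slot i whitney_proj (forms.PP L G)) p =
          slot (\<sigma> i) whitney_proj (form_perm \<sigma> (forms.PP L G)) p"
        using \<sigma> Cons.prems by (intro form_perm_slot_whitney_proj) auto
      then show ?thesis using Cons by simp
    next
      case False
      then have "form_perm \<sigma> (forms.PP (i # L) G) p = 0"
        using forms_PP_length[where F = G and p = "permute_slots \<sigma> p" and L = "i # L", OF G]
        by (simp add: form_perm_eq[of \<sigma> _ p])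
      moreover have "forms.PP (map \<sigma> (i # L)) (form_perm \<sigma> G) p = 0"
        by (rule forms_PP_length[OF _ False]) (simp add: form_perm_eq G)
      ultimately show ?thesis by simp
    qed
  qed
qed simp

lemma cubical_s_eq:
  assumes F: "F \<in> cube_forms n"
  shows "cubical_s n F = forms.h n F"
proof
  fix p
  note F0 = cube_forms_zero_length[OF F]
  show "cubical_s n F p = forms.h n F p"
  proof (cases "length p = n")
    case True
    have "form_perm \<sigma> (cubical_s0 n (form_perm (inv \<sigma>) F)) p =
        (\<Sum>j<n. forms.contraction_summand n \<sigma> j F p)" if \<sigma>: "\<sigma> permutes {..<n}" for \<sigma>
    proof -
      let ?G = "form_perm (inv \<sigma>) F"
      \<comment> \<open>The sign lemmas hold for arbitrary functions, so vanishing at lists of the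
        wrong length is the one property carried over to the permuted form.\<close>
      have G: "?G p = 0" if "length p \<noteq> n" for p using F0 that by (simp add: form_perm_eq)
      have "form_perm \<sigma> (cubical_s0 n ?G) p =
          (\<Sum>j<n. form_perm \<sigma> (sslot j s1 (forms.PP [Suc j..<n] ?G)) p)"
        using True by (simp add: form_perm_eq[of \<sigma> _ p] cubical_s0_eq sum_distrib_left)
      also have "\<dots> = (\<Sum>j<n. forms.contraction_summand n \<sigma> j F p)"
      proof (rule sum.cong)
        fix j assume "j \<in> {..<n}"
        then have "form_perm \<sigma> (sslot j s1 (forms.PP [Suc j..<n] ?G)) p =
            sslot (\<sigma> j) s1 (form_perm \<sigma> (forms.PP [Suc j..<n] ?G)) p"
          using \<sigma> True by (intro form_perm_sslot_s1) auto
        also have "form_perm \<sigma> (forms.PP [Suc j..<n] ?G) = forms.PP (map \<sigma> [Suc j..<n]) F"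
          using form_perm_PP[where G = ?G and L = "[Suc j..<n]", OF \<sigma> _ G]
            form_perm_inverse[OF \<sigma> F0] by (simp add: subset_iff)
        finally show "form_perm \<sigma> (sslot j s1 (forms.PP [Suc j..<n] ?G)) p =
            forms.contraction_summand n \<sigma> j F p"
          by (simp only: forms.contraction_summand_def)
      qed simp
      finally show ?thesis .
    qed
    then show ?thesis by (simp add: cubical_s_def forms.h_def)
  next
    case False
    have "cubical_s n F p = 0"
      using False by (simp add: cubical_s_def form_perm_eq[of _ _ p] cubical_s0_length)
    moreover have "forms.h n F p = 0"
      using cube_forms_zero_length[OF forms.lin_op_closed[OF forms.lin_op_h F] False] .
    ultimately show ?thesis by simp
  qed
qed

section \<open>Whitney forms and integration\<close>

text \<open>
  The labels at which \<open>whitney_proj f\<close> takes the values of \<open>R1 f\<close>; on \<open>E01\<close> any point would do.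
\<close>

fun node :: "cell \<Rightarrow> form_label" where
  "node V0 = (False, 0)"
| "node V1 = (False, 1)"
| "node E01 = (True, 0)"

lemma form_deg_node: "form_deg (node z) = cell_deg z"
  by (cases z) (simp_all add: form_deg_def)

lemma W1_node: "W1 c (node z) = c z"
  by (cases z) (simp_all add: W1_def)

text \<open>Turns integration into an operator on forms followed by a reading at nodes, so that the
  relations for the projections apply to it.\<close>

lemma R1_eq_node: "R1 f z = whitney_proj f (node z)"
  by (simp add: whitney_proj_def W1_node)

lemma cubical_R_eq:
  assumes F: "F \<in> cube_forms n"
  shows "cubical_R n F = (\<lambda>zs. forms.PP [0..<n] F (map node zs))"
proof
  fix zs
  have R: "length zs = m \<Longrightarrow> tensor form_deg (replicate m (0, R1)) F zs =
      tensor form_deg (replicate m (0, whitney_proj)) F (map node zs)" for m F and zs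
  proof (induction m arbitrary: F zs)
    case (Suc m)
    then show ?case by (cases zs) (simp_all add: koszul_0 sum_list_replicate R1_eq_node)
  qed simp
  show "cubical_R n F zs = forms.PP [0..<n] F (map node zs)"
  proof (cases "length zs = n")
    case True
    then show ?thesis
      using R[OF True, of F] tensor_replicate[of "map node zs" n form_deg whitney_proj F "[]"]
      by (simp add: cubical_R_def forms.PP_def)
  next
    case False
    have "R1 (\<lambda>x. 0) z = 0" for z by (cases z) simp_all
    then have "cubical_R n F zs = 0"
      unfolding cubical_R_def using False by (intro tensor_length) auto
    moreover have "forms.PP [0..<n] F (map node zs) = 0"
      using False by (intro forms_PP_length[OF cube_forms_zero_length[OF F]]) auto
    ultimately show ?thesis by simp
  qed
qed

abbreviation whitney :: "nat \<Rightarrow> (cell list \<Rightarrow> real) \<Rightarrow> form_label list \<Rightarrow> real" where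
  "whitney m \<equiv> tensor cell_deg (replicate m (0, W1))"

lemma whitney_Cons: "whitney (Suc m) c (y # ys) = W1 (\<lambda>z. whitney m (\<lambda>zs. c (z # zs)) ys) y"
  by (simp add: koszul_0 sum_list_replicate)

lemma whitney_outside: "map snd ys \<notin> cube m \<Longrightarrow> whitney m c ys = 0"
proof (induction m arbitrary: c ys)
  case 0
  then show ?case by (cases ys) (auto simp: cube_def)
next
  case (Suc m)
  show ?case
  proof (cases ys)
    case (Cons y ys')
    show ?thesis
    proof (cases "snd y \<in> {0..1}")
      case True
      then have "map snd ys' \<notin> cube m" using Suc.prems Cons by (auto simp: cube_def)
      then show ?thesis unfolding Cons whitney_Cons by (simp add: Suc.IH W1_0)
    next
      case False
      then show ?thesis unfolding Cons whitney_Cons by (cases y) (auto simp: W1_def)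
    qed
  qed simp
qed

text \<open>Dropping \<open>k\<close> coordinates keeps the statement on the full cube, where the
  smoothness closure lemmas live, while the recursion consumes the factors.\<close>

lemma whitney_smooth:
  "length bs = m \<Longrightarrow> k + m = n \<Longrightarrow> cube_smooth n (\<lambda>t. whitney m c (zip bs (drop k t)))"
proof (induction m arbitrary: c bs k)
  case 0
  then show ?case by (simp add: cube_smooth_const)
next
  case (Suc m)
  then obtain b bs' where bs: "bs = b # bs'" "length bs' = m" by (cases bs) auto
  have k: "k < n" using Suc.prems by simp
  let ?f = "\<lambda>z t. whitney m (\<lambda>zs. c (z # zs)) (zip bs' (drop (Suc k) t))"
  let ?g = "\<lambda>t. if b then ?f E01 t else 1 * ?f V0 t + 1 * (t ! k * (1 * ?f V1 t + (-1) * ?f V0 t))"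
  have f: "cube_smooth n (?f z)" for z using Suc.IH[OF bs(2), of "Suc k"] Suc.prems by simp
  have "cube_smooth n ?g"
  proof (cases b)
    case True
    then show ?thesis using f by simp
  next
    case False
    then show ?thesis
      using cube_smooth_lin[OF f[of V0] cube_smooth_mult_coord[OF cube_smooth_lin[OF f[of V1] f[of V0], of 1 "-1"] k], of 1 1]
      by simp
  qed
  moreover have "?g t = whitney (Suc m) c (zip bs (drop k t))" if "t \<in> cube n" for t
  proof -
    have "drop k t = t ! k # drop (Suc k) t"
      using k cube_length[OF that] by (simp add: Cons_nth_drop_Suc)
    then have "whitney (Suc m) c (zip bs (drop k t)) = W1 (\<lambda>z. ?f z t) (b, t ! k)"
      unfolding bs(1) by (simp only: zip_Cons_Cons whitney_Cons)
    then show ?thesis using cube_nth[OF that k] by (simp add: W1_def algebra_simps)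
  qed
  ultimately show ?case by (rule cube_smooth_cong)
qed

lemma cubical_W_forms: "cubical_W n c \<in> cube_forms n"
  unfolding cube_forms_def cubical_W_def
  using whitney_outside whitney_smooth[of _ n 0 n c] by simp

text \<open>In each slot separately a Whitney form lies in the image of \<open>W1\<close>, with its
  values at the nodes as coefficients.\<close>

lemma whitney_interpolates:
  "length ys = m \<Longrightarrow> j < m \<Longrightarrow> whitney m c (ys[j := x]) = W1 (\<lambda>z. whitney m c (ys[j := node z])) x"
proof (induction m arbitrary: c ys j)
  case (Suc m)
  then obtain y ys' where ys: "ys = y # ys'" "length ys' = m" by (cases ys) auto
  show ?case
  proof (cases j)
    case 0
    then show ?thesis
      by (simp only: ys list_update.simps nat.case whitney_Cons W1_node)
  next
    case (Suc i)
    let ?g = "\<lambda>z z'. whitney m (\<lambda>zs. c (z # zs)) (ys'[i := node z'])"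
    have "whitney m (\<lambda>zs. c (z # zs)) (ys'[i := x]) = W1 (?g z) x" for z
      using Suc.IH[OF ys(2), of i "\<lambda>zs. c (z # zs)"] Suc.prems Suc by simp
    then have "whitney (Suc m) c (ys[j := x]) = W1 (\<lambda>z. W1 (?g z) x) y"
      by (simp only: ys Suc list_update.simps nat.case whitney_Cons)
    \<comment> \<open>Two interpolations in different variables are finite linear combinations and
      can be exchanged.\<close>
    also have "\<dots> = W1 (\<lambda>z'. W1 (\<lambda>z. ?g z z') y) x"
      by (simp add: W1_def split_def algebra_simps)
    also have "\<dots> = W1 (\<lambda>z'. whitney (Suc m) c (ys[j := node z'])) x"
      by (simp only: ys Suc list_update.simps nat.case whitney_Cons)
    finally show ?thesis .
  qed
qed simp

lemma whitney_node: "length zs = m \<Longrightarrow> whitney m c (map node zs) = c zs"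
proof (induction m arbitrary: c zs)
  case (Suc m)
  then obtain z zs' where zs: "zs = z # zs'" "length zs' = m" by (cases zs) auto
  show ?case
    unfolding zs(1) list.map whitney_Cons using Suc.IH[OF zs(2)] by (simp add: W1_node)
qed simp

text \<open>In slot \<open>j\<close> the form is \<open>W1\<close> of its node values, and W R W = W
  on the interval.\<close>

lemma slot_whitney_proj_cubical_W:
  assumes "j < n"
  shows "slot j whitney_proj (cubical_W n c) = cubical_W n c"
proof (rule cube_forms_eqI[OF slot_whitney_proj_forms[OF cubical_W_forms assms] cubical_W_forms])
  fix p :: "form_label list" assume "length p = n"
  note * = whitney_interpolates[OF this assms, of c]
  have "(\<lambda>x. whitney n c (p[j := x])) = W1 (\<lambda>z. whitney n c (p[j := node z]))"
    by (rule ext) (rule *)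
  then have "slot j whitney_proj (cubical_W n c) p = W1 (\<lambda>z. whitney n c (p[j := node z])) (p ! j)"
    by (simp only: slot_def cubical_W_def whitney_proj_def o_apply R1_W1)
  also have "\<dots> = whitney n c (p[j := p ! j])" by (rule *[symmetric])
  finally show "slot j whitney_proj (cubical_W n c) p = cubical_W n c p"
    by (simp add: cubical_W_def)
qed

text \<open>A form fixed by every projection is interpolated in each slot from its node values;
  replacing the slots one after another, with the prefix \<open>q\<close> already at nodes, recovers
  the whole form. Such forms are therefore Whitney forms.\<close>

lemma cubical_W_of_nodes:
  assumes G: "G \<in> cube_forms n" and PG: "\<And>j. j < n \<Longrightarrow> slot j whitney_proj G = G"
  shows "cubical_W n (\<lambda>zs. G (map node zs)) = G"
proof (rule cube_forms_eqI[OF cubical_W_forms G])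
  have interp: "G p = W1 (\<lambda>z. G (p[j := node z])) (p ! j)" if p: "length p = n" "j < n" for p j
  proof -
    have "R1 (\<lambda>x. G (p[j := x])) z = slot j whitney_proj G (p[j := node z])" for z
      using p by (simp add: R1_eq_node slot_def)
    then have "R1 (\<lambda>x. G (p[j := x])) = (\<lambda>z. G (p[j := node z]))"
      using PG p by (simp add: fun_eq_iff)
    moreover have "G p = slot j whitney_proj G p" using PG p by simp
    ultimately show ?thesis by (simp add: slot_def whitney_proj_def)
  qed
  have "length q + m = n \<Longrightarrow> length r = m \<Longrightarrow> whitney m (\<lambda>zs. G (q @ map node zs)) r = G (q @ r)"
    for m q r
  proof (induction m arbitrary: q r)
    case (Suc m)
    then obtain y r' where r: "r = y # r'" "length r' = m" by (cases r) auto
    have "whitney m (\<lambda>zs. G (q @ map node (z # zs))) r' = G (q @ node z # r')" for z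
      using Suc.IH[of "q @ [node z]" r'] Suc.prems r by simp
    then have "whitney (Suc m) (\<lambda>zs. G (q @ map node zs)) r = W1 (\<lambda>z. G (q @ node z # r')) y"
      by (simp only: r(1) whitney_Cons)
    also have "\<dots> = G (q @ r)"
      using interp[of "q @ r" "length q"] Suc.prems r by simp
    finally show ?case .
  qed simp
  from this[of "[]" n] show "cubical_W n (\<lambda>zs. G (map node zs)) p = G p" if "length p = n" for p
    using that by (simp add: cubical_W_def)
qed

lemma forms_PP_fixed: "(\<And>j. j \<in> set L \<Longrightarrow> slot j whitney_proj G = G) \<Longrightarrow> forms.PP L G = G"
  by (induction L) simp_all

lemma cubical_R_W:
  assumes c: "c \<in> cube_cochains n"
  shows "cubical_R n (cubical_W n c) = c"
proof
  fix zs
  have "forms.PP [0..<n] (cubical_W n c) = cubical_W n c"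
    by (rule forms_PP_fixed) (simp add: slot_whitney_proj_cubical_W)
  then have "cubical_R n (cubical_W n c) zs = cubical_W n c (map node zs)"
    by (simp add: cubical_R_eq[OF cubical_W_forms])
  also have "\<dots> = c zs"
  proof (cases "length zs = n")
    case True
    then show ?thesis by (simp add: cubical_W_def whitney_node)
  next
    case False
    then show ?thesis
      using c cube_forms_zero_length[OF cubical_W_forms, of "map node zs"]
      by (simp add: cube_cochains_def)
  qed
  finally show "cubical_R n (cubical_W n c) zs = c zs" .
qed

text \<open>The full product of projections absorbs each single projection, so its output is a
  Whitney form determined by its node values, and these are given by integration.\<close>

lemma cubical_W_R:
  assumes F: "F \<in> cube_forms n"
  shows "cubical_W n (cubical_R n F) = forms.PP [0..<n] F"
  unfolding cubical_R_eq[OF F]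
  using forms.P_PP_absorb[OF _ forms.upt_subset F]
  by (intro cubical_W_of_nodes forms.PP_closed[OF forms.upt_subset F]) simp

text \<open>The differential commutes with the projections, so the differential of a Whitney form is
  again fixed by them. Both sides are then compared at the nodes only, slot by slot.\<close>

lemma d_form_cubical_W: "d_form n (cubical_W n c) = cubical_W n (d_cochain n c)"
proof -
  let ?G = "forms.d n (cubical_W n c)"
  have G: "?G \<in> cube_forms n"
    by (rule forms.lin_op_closed[OF forms.lin_op_d cubical_W_forms])
  have "slot j whitney_proj ?G = ?G" if "j < n" for j
    using forms.PP_d[OF cubical_W_forms, of "[j]" n c] that
    by (simp add: slot_whitney_proj_cubical_W)
  then have "cubical_W n (\<lambda>zs. ?G (map node zs)) = ?G" by (rule cubical_W_of_nodes[OF G])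
  moreover have "?G (map node zs) = d_cochain n c zs" for zs
  proof (cases "length zs = n")
    case True
    have "sslot j d1 (cubical_W n c) (map node zs) = prefix_sign cell_deg j zs * slot j delta1 c zs"
      if j: "j < n" for j
    proof -
      have *: "whitney n c ((map node zs)[j := node z]) = c (zs[j := z])" for z
        using whitney_node[of "zs[j := z]" n c] True by (simp add: map_update)
      have "cubical_W n c ((map node zs)[j := x]) = W1 (\<lambda>z. c (zs[j := z])) x" for x
        unfolding cubical_W_def *[symmetric]
        by (rule whitney_interpolates) (simp_all add: True j)
      then have "slot j d1 (cubical_W n c) (map node zs) = slot j delta1 c zs"
        using True j by (simp add: slot_def d1_W1 W1_node)
      moreover have "prefix_sign form_deg j (map node zs) = prefix_sign cell_deg j zs"
        unfolding prefix_sign_def using True j by (intro prod.cong) (auto simp: form_deg_node)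
      ultimately show ?thesis by (simp add: sslot_def)
    qed
    then show ?thesis using True by (simp add: forms.d_def d_cochain_eq)
  next
    case False
    then show ?thesis
      using cube_forms_zero_length[OF G, of "map node zs"] d_cochain_closed[of n c]
      by (simp add: cube_cochains_def)
  qed
  ultimately show ?thesis by (simp add: d_form_eq[OF cubical_W_forms])
qed

lemma cubical_R_closed:
  assumes "F \<in> cube_forms n"
  shows "cubical_R n F \<in> cube_cochains n"
  using cube_forms_zero_length[OF forms.PP_closed[OF forms.upt_subset assms]]
  by (simp add: cube_cochains_def cubical_R_eq[OF assms])

lemma d_form_closed: "F \<in> cube_forms n \<Longrightarrow> d_form n F \<in> cube_forms n"
  by (simp add: d_form_eq forms.lin_op_closed[OF forms.lin_op_d])

text \<open>After applying W, which RW = 1 makes injective, the claim says that the differential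
  commutes with the product of projections.\<close>

lemma d_cochain_cubical_R:
  assumes F: "F \<in> cube_forms n"
  shows "d_cochain n (cubical_R n F) = cubical_R n (d_form n F)"
proof -
  have "cubical_W n (d_cochain n (cubical_R n F)) = cubical_W n (cubical_R n (d_form n F))"
    using forms.PP_d[OF F forms.upt_subset] forms.PP_closed[OF forms.upt_subset F] F
    by (simp add: d_form_cubical_W[symmetric] cubical_W_R d_form_closed) (simp add: d_form_eq)
  then have "cubical_R n (cubical_W n (d_cochain n (cubical_R n F))) =
      cubical_R n (cubical_W n (cubical_R n (d_form n F)))"
    by (rule arg_cong)
  then show ?thesis
    unfolding cubical_R_W[OF d_cochain_closed] cubical_R_W[OF cubical_R_closed[OF d_form_closed[OF F]]] .
qed

section \<open>Degrees\<close>

lemma form_degs_update: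
  "i < length p \<Longrightarrow> form_degs (p[i := x]) = form_degs p - form_deg (p ! i) + form_deg x"
proof (induction p arbitrary: i)
  case (Cons y p)
  then show ?case by (cases i) (simp_all add: form_degs_def)
qed simp

text \<open>Degrees are tracked through supports: a nonzero output at some label forces a nonzero
  input at a label whose degree differs by \<open>k\<close>.\<close>

lemma slot_homogeneous:
  assumes T: "\<And>f y. T f y \<noteq> 0 \<Longrightarrow> \<exists>x. f x \<noteq> 0 \<and> form_deg y = form_deg x + k"
    and F: "F \<in> homogeneous form_degs (cube_forms n) m" and i: "i < n"
    and p: "slot i T F p \<noteq> 0"
  shows "form_degs p = m + k"
proof -
  obtain x where x: "F (p[i := x]) \<noteq> 0" "form_deg (p ! i) = form_deg x + k"
    using T p unfolding slot_def by blast
  then have "length p = n"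
    using F cube_forms_zero_length[of F n "p[i := x]"] by (auto simp: homogeneous_def)
  then show ?thesis using x F i form_degs_update[of i p x] by (auto simp: homogeneous_def)
qed

lemma W1_nonzero:
  assumes "W1 c y \<noteq> 0"
  shows "\<exists>z. c z \<noteq> 0 \<and> form_deg y = cell_deg z"
proof (cases "fst y")
  case True
  then show ?thesis
    using assms by (intro exI[of _ E01]) (auto simp: W1_def form_deg_def split: if_splits prod.splits)
next
  case False
  then have "c V0 \<noteq> 0 \<or> c V1 \<noteq> 0"
    using assms by (auto simp: W1_def split: if_splits prod.splits)
  then show ?thesis using False by (auto simp: form_deg_def intro: exI[of _ V0] exI[of _ V1])
qed

lemma R1_nonzero:
  assumes "R1 f z \<noteq> 0"
  shows "\<exists>x. f x \<noteq> 0 \<and> cell_deg z = form_deg x"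
proof (cases z)
  case V0
  then show ?thesis using assms by (intro exI[of _ "(False, 0)"]) (simp add: form_deg_def)
next
  case V1
  then show ?thesis using assms by (intro exI[of _ "(False, 1)"]) (simp add: form_deg_def)
next
  case E01
  obtain t where "f (True, t) \<noteq> 0"
  proof (rule ccontr)
    assume "\<not> thesis"
    then have "f (True, t) = 0" for t using that by blast
    then show False using assms E01 by simp
  qed
  then show ?thesis using E01 by (intro exI[of _ "(True, t)"]) (simp add: form_deg_def)
qed

lemma forms_PP_homogeneous:
  assumes F: "F \<in> homogeneous form_degs (cube_forms n) m" and "set L \<subseteq> {..<n}"
  shows "forms.PP L F \<in> homogeneous form_degs (cube_forms n) m"
  using assms(2)
proof (induction L)
  case (Cons i L)
  have T: "\<exists>x. f x \<noteq> 0 \<and> form_deg y = form_deg x + 0" if "whitney_proj f y \<noteq> 0" for f y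
    using W1_nonzero[of "R1 f" y] R1_nonzero[of f] that by (auto simp: whitney_proj_def)
  have "slot i whitney_proj (forms.PP L F) \<in> cube_forms n"
    using Cons by (intro slot_whitney_proj_forms) (auto simp: homogeneous_def)
  moreover have "form_degs p = m + 0" if "slot i whitney_proj (forms.PP L F) p \<noteq> 0" for p
    by (rule slot_homogeneous[OF T _ _ that]) (use Cons in auto)
  ultimately show ?case by (simp add: homogeneous_def)
qed (use F in simp)

lemma s1_nonzero: "s1 f y \<noteq> 0 \<Longrightarrow> \<exists>x. f x \<noteq> 0 \<and> form_deg y = form_deg x + (-1)"
proof -
  assume y: "s1 f y \<noteq> 0"
  obtain t where "f (True, t) \<noteq> 0"
  proof (rule ccontr)
    assume "\<not> thesis"
    then have "f (True, t) = 0" for t using that by blast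
    then show False using y by (cases y) (simp add: s1_def split: if_splits)
  qed
  moreover from y have "form_deg y = 0"
    by (cases y) (simp add: s1_def form_deg_def split: if_splits)
  ultimately show ?thesis by (intro exI[of _ "(True, t)"]) (simp add: form_deg_def)
qed

lemma forms_h_homogeneous:
  assumes F: "F \<in> homogeneous form_degs (cube_forms n) m"
  shows "forms.h n F \<in> homogeneous form_degs (cube_forms n) (m + -1)"
proof -
  have "form_degs p = m + -1" if "forms.h n F p \<noteq> 0" for p
  proof (rule ccontr)
    assume p: "form_degs p \<noteq> m + -1"
    have "forms.contraction_summand n \<sigma> j F p = 0" if \<sigma>: "\<sigma> permutes {..<n}" "j < n" for \<sigma> j
    proof -
      have "slot (\<sigma> j) s1 (forms.PP (map \<sigma> [Suc j..<n]) F) p = 0"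
        using slot_homogeneous[OF s1_nonzero forms_PP_homogeneous[OF F forms.permutes_image_subset[OF \<sigma>(1)]]
            forms.permutes_less[OF \<sigma>]] p by blast
      then show ?thesis by (simp only: forms.contraction_summand_def sslot_def mult_zero_right)
    qed
    then show False using forms.h_eq_0[of n F p] \<open>forms.h n F p \<noteq> 0\<close> by simp
  qed
  then show ?thesis
    using F forms.lin_op_closed[OF forms.lin_op_h] by (simp add: homogeneous_def)
qed

lemma whitney_nonzero: "whitney m c ys \<noteq> 0 \<Longrightarrow> \<exists>zs. c zs \<noteq> 0 \<and> form_degs ys = cell_degs zs"
proof (induction m arbitrary: c ys)
  case 0
  then show ?case by (cases ys) (auto simp: form_degs_def cell_degs_def)
next
  case (Suc m)
  show ?case
  proof (cases ys)
    case Nil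
    then show ?thesis using Suc.prems by simp
  next
    case (Cons y ys')
    then obtain z where z: "whitney m (\<lambda>zs. c (z # zs)) ys' \<noteq> 0" "form_deg y = cell_deg z"
      using Suc.prems W1_nonzero unfolding Cons whitney_Cons by blast
    then obtain zs where "c (z # zs) \<noteq> 0" "form_degs ys' = cell_degs zs"
      using Suc.IH by blast
    then show ?thesis
      using z Cons by (intro exI[of _ "z # zs"]) (simp add: form_degs_def cell_degs_def)
  qed
qed

lemma whitney_lin:
  "whitney m (\<lambda>p. a * c p + b * c' p) ys = a * whitney m c ys + b * whitney m c' ys"
proof (induction m arbitrary: c c' ys)
  case 0
  show ?case by (cases ys) simp_all
next
  case (Suc m)
  show ?case
  proof (cases ys)
    case (Cons y ys')
    show ?thesis
      unfolding Cons whitney_Cons Suc.IH by (cases y) (simp add: W1_def algebra_simps)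
  qed simp
qed

lemma graded_linear_map_cubical_W:
  "graded_linear_map cell_degs (cube_cochains n) form_degs (cube_forms n) 0 (cubical_W n)"
  unfolding graded_linear_map_def
proof (intro conjI ballI allI)
  show "cubical_W n c \<in> cube_forms n" for c by (rule cubical_W_forms)
  show "cubical_W n (\<lambda>p. a * c p + b * c' p) = (\<lambda>q. a * cubical_W n c q + b * cubical_W n c' q)"
    for c c' a b
    unfolding cubical_W_def by (rule ext) (rule whitney_lin)
  show "cubical_W n c \<in> homogeneous form_degs (cube_forms n) (m + 0)"
    if c: "c \<in> homogeneous cell_degs (cube_cochains n) m" for c m
  proof -
    have "form_degs ys = m" if "cubical_W n c ys \<noteq> 0" for ys
      using whitney_nonzero[of n c ys] that c by (auto simp: cubical_W_def homogeneous_def)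
    then show ?thesis by (simp add: homogeneous_def cubical_W_forms)
  qed
qed

lemma graded_linear_map_cubical_R:
  "graded_linear_map form_degs (cube_forms n) cell_degs (cube_cochains n) 0 (cubical_R n)"
  unfolding graded_linear_map_def
proof (intro conjI ballI allI)
  show "cubical_R n F \<in> cube_cochains n" if "F \<in> cube_forms n" for F
    using that by (rule cubical_R_closed)
  show "cubical_R n (\<lambda>p. a * F p + b * G p) = (\<lambda>q. a * cubical_R n F q + b * cubical_R n G q)"
    if "F \<in> cube_forms n" "G \<in> cube_forms n" for F G a b
    using that forms.lin_op_lin[OF forms.lin_op_PP[OF forms.upt_subset] that]
    by (simp add: cubical_R_eq cube_forms_lin)
  show "cubical_R n F \<in> homogeneous cell_degs (cube_cochains n) (m + 0)"
    if F: "F \<in> homogeneous form_degs (cube_forms n) m" for F m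
  proof -
    have F': "F \<in> cube_forms n" using F by (simp add: homogeneous_def)
    have "form_degs (map node zs) = cell_degs zs" for zs
      by (simp add: form_degs_def cell_degs_def form_deg_node comp_def)
    then show ?thesis
      using forms_PP_homogeneous[OF F forms.upt_subset] cubical_R_closed[OF F']
      by (auto simp: homogeneous_def cubical_R_eq[OF F'])
  qed
qed

lemma graded_linear_map_cubical_s:
  "graded_linear_map form_degs (cube_forms n) form_degs (cube_forms n) (-1) (cubical_s n)"
  unfolding graded_linear_map_def
proof (intro conjI ballI allI)
  show "cubical_s n F \<in> cube_forms n" if "F \<in> cube_forms n" for F
    using that by (simp add: cubical_s_eq forms.lin_op_closed[OF forms.lin_op_h])
  show "cubical_s n (\<lambda>p. a * F p + b * G p) = (\<lambda>q. a * cubical_s n F q + b * cubical_s n G q)"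
    if "F \<in> cube_forms n" "G \<in> cube_forms n" for F G a b
    using that forms.lin_op_lin[OF forms.lin_op_h that] by (simp add: cubical_s_eq cube_forms_lin)
  show "cubical_s n F \<in> homogeneous form_degs (cube_forms n) (m + -1)"
    if F: "F \<in> homogeneous form_degs (cube_forms n) m" for F m
  proof -
    have "F \<in> cube_forms n" using F by (simp add: homogeneous_def)
    then show ?thesis using forms_h_homogeneous[OF F] by (simp add: cubical_s_eq)
  qed
qed

theorem mainTheorem5:
  fixes n :: nat
  assumes "n \<ge> 1"
  shows "special_deformation_retraction
    form_degs (cube_forms n) (d_form n)
    cell_degs (cube_cochains n) (d_cochain n)
    (cubical_W n) (cubical_R n) (cubical_s n)"
  unfolding special_deformation_retraction_def
proof (intro conjI ballI)
  have h: "forms.h n F \<in> cube_forms n" if "F \<in> cube_forms n" for F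
    using that by (rule forms.lin_op_closed[OF forms.lin_op_h])
  have hW: "forms.h n (cubical_W n c) = (\<lambda>x. 0)" for c
  proof -
    \<comment> \<open>A Whitney form equals its own projection, which puts it into the form required
      by \<open>forms.h_PP\<close>.\<close>
    have "forms.PP [0..<n] (cubical_W n c) = cubical_W n c"
      by (rule forms_PP_fixed) (simp add: slot_whitney_proj_cubical_W)
    then show ?thesis using forms.h_PP[OF cubical_W_forms[of n c]] by simp
  qed
  show "graded_linear_map cell_degs (cube_cochains n) form_degs (cube_forms n) 0 (cubical_W n)"
    by (rule graded_linear_map_cubical_W)
  show "graded_linear_map form_degs (cube_forms n) cell_degs (cube_cochains n) 0 (cubical_R n)"
    by (rule graded_linear_map_cubical_R)
  show "graded_linear_map form_degs (cube_forms n) form_degs (cube_forms n) (-1) (cubical_s n)"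
    by (rule graded_linear_map_cubical_s)
  show "d_form n (cubical_W n c) = cubical_W n (d_cochain n c)" for c
    by (rule d_form_cubical_W)
  show "cubical_R n (cubical_W n c) = c" if "c \<in> cube_cochains n" for c
    using that by (rule cubical_R_W)
  show "cubical_s n (cubical_W n c) = (\<lambda>x. 0)" for c
    by (simp add: cubical_s_eq cubical_W_forms hW)
  fix F assume F: "F \<in> cube_forms n"
  show "d_cochain n (cubical_R n F) = cubical_R n (d_form n F)"
    using F by (rule d_cochain_cubical_R)
  show "(\<lambda>x. d_form n (cubical_s n F) x + cubical_s n (d_form n F) x) =
      (\<lambda>x. F x - cubical_W n (cubical_R n F) x)"
    using forms.d_h[OF F] d_form_closed[OF F] F h[OF F]
    by (simp add: cubical_s_eq cubical_W_R d_form_eq)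
  show "cubical_s n (cubical_s n F) = (\<lambda>x. 0)"
    using F h[OF F] forms.h_h[OF F] by (simp add: cubical_s_eq)
  show "cubical_R n (cubical_s n F) = (\<lambda>y. 0)"
    using F h[OF F] forms.PP_h[OF F] by (simp add: cubical_s_eq cubical_R_eq)
qed

end
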